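(* Let $M$ be a discrete $AW^*$-algebra, let $A$ be the norm-closed linear span of all finite projections of $M$, and let $C$ be a masa of $A$. Then the closure of $C$ in $M$ with respect to the strict topology $\beta_A$ is equal to the relative commutant $C'\cap M$.
   Context: An $AW^*$-algebra is a (unital) $C^*$-algebra $M$ in which the right annihilator of every subset is of the form $eM$ with $e\in M$ a projection (self-adjoint idempotent). Projections $e,f\in M$ are equivalent, $e\sim f$, if $e=v^*v$, $f=vv^*$ for some $v\in M$; $e$ is finite if $e\sim f\le e$ implies $f=e$; $e$ is abelian if $eMe$ is commutative. $M$ is discrete (type I) if it contains an abelian projection of central support $1_M$. The norm-closed linear span $A$ of all finite projections is then an essential norm-closed two-sided ideal of $M$, and $M$ is canonically identified with the multiplier algebra $M(A)$. The strict topology $\beta_A$ on $M$ is the locally convex topology defined by the seminorms $x\mapsto\|xa\|$ and $x\mapsto\|ax\|$, $a\in A$. A masa of $A$ is a maximal abelian self-adjoint subalgebra of $A$. $C'\cap M$ denotes the set of elements of $M$ commuting with every element of $C$. *)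

theory Defs
  imports "HOL-Analysis.Analysis"
begin

text \<open>
  Unital \<open>C\<^sup>*\<close>-algebras, as a type class: the algebra is the whole type. The unit comes from
  \<^class>\<open>monoid_mult\<close> and not from \<^class>\<open>real_normed_algebra_1\<close>, so that the zero algebra is not
  excluded; \<open>norm 1 = 1\<close> follows from the \<open>C\<^sup>*\<close>-identity in all other cases. The real scalar
  multiplication inherited from \<^class>\<open>banach\<close> is the restriction of the complex one.
\<close>

class cstar_algebra = real_normed_algebra + banach + monoid_mult +
  fixes scaleC :: "complex \<Rightarrow> 'a \<Rightarrow> 'a"  (infixr \<open>*\<^sub>C\<close> 75)
    and star :: "'a \<Rightarrow> 'a"  (\<open>(_\<^sup>\<star>)\<close> [1000] 999)
  assumes scaleC_add_right: "c *\<^sub>C (x + y) = c *\<^sub>C x + c *\<^sub>C y"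
    and scaleC_add_left: "(c + d) *\<^sub>C x = c *\<^sub>C x + d *\<^sub>C x"
    and scaleC_scaleC: "c *\<^sub>C (d *\<^sub>C x) = (c * d) *\<^sub>C x"
    and scaleC_of_real: "complex_of_real r *\<^sub>C x = r *\<^sub>R x"
    and mult_scaleC_left: "(c *\<^sub>C x) * y = c *\<^sub>C (x * y)"
    and mult_scaleC_right: "x * (c *\<^sub>C y) = c *\<^sub>C (x * y)"
    and norm_scaleC: "norm (c *\<^sub>C x) = cmod c * norm x"
    and star_add: "(x + y)\<^sup>\<star> = x\<^sup>\<star> + y\<^sup>\<star>"
    and star_scaleC: "(c *\<^sub>C x)\<^sup>\<star> = cnj c *\<^sub>C x\<^sup>\<star>"
    and star_mult: "(x * y)\<^sup>\<star> = y\<^sup>\<star> * x\<^sup>\<star>"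
    and star_star: "(x\<^sup>\<star>)\<^sup>\<star> = x"
    and cstar_identity: "norm (x\<^sup>\<star> * x) = (norm x)\<^sup>2"

global_interpretation complex_vector: vector_space "scaleC :: complex \<Rightarrow> 'a \<Rightarrow> 'a::cstar_algebra"
  defines csubspace = complex_vector.subspace
    and cspan = complex_vector.span
proof
  show "1 *\<^sub>C x = x" for x :: 'a
    using scaleC_of_real[of 1 x] by simp
qed (simp_all add: scaleC_add_right scaleC_add_left scaleC_scaleC)

definition is_projection :: "'a::cstar_algebra \<Rightarrow> bool" where
  "is_projection e \<longleftrightarrow> e\<^sup>\<star> = e \<and> e * e = e"

definition right_annihilator :: "'a::cstar_algebra set \<Rightarrow> 'a set" where
  "right_annihilator S = {x. \<forall>s\<in>S. s * x = 0}"

class aw_star_algebra = cstar_algebra +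
  assumes right_annihilator_eq_projection_ideal:
    "\<exists>e. (e\<^sup>\<star> = e \<and> e * e = e) \<and> {x. \<forall>s\<in>S. s * x = 0} = range (\<lambda>x. e * x)"

lemma right_annihilator_ex_projection:
  fixes S :: "'a::aw_star_algebra set"
  shows "\<exists>e. is_projection e \<and> right_annihilator S = range (\<lambda>x. e * x)"
  unfolding is_projection_def right_annihilator_def
  by (rule right_annihilator_eq_projection_ideal)

definition proj_le :: "'a::cstar_algebra \<Rightarrow> 'a \<Rightarrow> bool" where
  "proj_le e f \<longleftrightarrow> e * f = e"

definition proj_equiv :: "'a::cstar_algebra \<Rightarrow> 'a \<Rightarrow> bool" where
  "proj_equiv e f \<longleftrightarrow> (\<exists>v. e = v\<^sup>\<star> * v \<and> f = v * v\<^sup>\<star>)"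

definition finite_projection :: "'a::cstar_algebra \<Rightarrow> bool" where
  "finite_projection e \<longleftrightarrow> is_projection e \<and>
     (\<forall>f. is_projection f \<and> proj_equiv e f \<and> proj_le f e \<longrightarrow> f = e)"

definition abelian_projection :: "'a::cstar_algebra \<Rightarrow> bool" where
  "abelian_projection e \<longleftrightarrow> is_projection e \<and>
     (\<forall>x y. (e * x * e) * (e * y * e) = (e * y * e) * (e * x * e))"

definition central_projection :: "'a::cstar_algebra \<Rightarrow> bool" where
  "central_projection z \<longleftrightarrow> is_projection z \<and> (\<forall>x. z * x = x * z)"

text \<open>The central support of a projection is the least central projection above it.\<close>

definition has_central_support :: "'a::cstar_algebra \<Rightarrow> 'a \<Rightarrow> bool" where
  "has_central_support e z \<longleftrightarrow> central_projection z \<and> proj_le e z \<and>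
     (\<forall>w. central_projection w \<and> proj_le e w \<longrightarrow> proj_le z w)"

definition discrete_algebra :: "'a::aw_star_algebra itself \<Rightarrow> bool" where
  "discrete_algebra _ \<longleftrightarrow> (\<exists>e::'a. abelian_projection e \<and> has_central_support e 1)"

definition finite_projection_ideal :: "'a::aw_star_algebra set" where
  "finite_projection_ideal = closure (cspan {e. finite_projection e})"

definition abelian_star_subalgebra :: "'a::cstar_algebra set \<Rightarrow> bool" where
  "abelian_star_subalgebra C \<longleftrightarrow> csubspace C \<and>
     (\<forall>x\<in>C. \<forall>y\<in>C. x * y \<in> C) \<and> (\<forall>x\<in>C. x\<^sup>\<star> \<in> C) \<and> (\<forall>x\<in>C. \<forall>y\<in>C. x * y = y * x)"

text \<open>
  Norm-closedness is not demanded: the norm closure of an abelian self-adjoint subalgebra is again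
  one, so for norm-closed \<open>A\<close> a maximal one is automatically closed.
\<close>

definition masa :: "'a::cstar_algebra set \<Rightarrow> 'a set \<Rightarrow> bool" where
  "masa A C \<longleftrightarrow> C \<subseteq> A \<and> abelian_star_subalgebra C \<and>
     (\<forall>D. D \<subseteq> A \<and> abelian_star_subalgebra D \<and> C \<subseteq> D \<longrightarrow> D = C)"

definition commutant :: "'a::cstar_algebra set \<Rightarrow> 'a set" where
  "commutant C = {x. \<forall>c\<in>C. x * c = c * x}"

text \<open>
  The locally convex topology defined by a family \<open>P\<close> of seminorms; its subbase consists of all
  open seminorm balls. The underlying space is the whole type as soon as \<open>P\<close> is nonempty.
\<close>

definition seminorm_topology :: "('a::real_vector \<Rightarrow> real) set \<Rightarrow> 'a topology" where
  "seminorm_topology P = topology_generated_by {{x. p (x - y) < r} | p y r. p \<in> P \<and> 0 < r}"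

definition strict_topology :: "'a::cstar_algebra set \<Rightarrow> 'a topology" where
  "strict_topology A =
     seminorm_topology ((\<lambda>a x. norm (x * a)) ` A \<union> (\<lambda>a x. norm (a * x)) ` A)"

end

theory Submission
  imports Defs
begin

text \<open>
  The point is that the projections of \<open>C\<close> form an approximate unit of \<open>A\<close>: for \<open>x\<close> in the relative
  commutant and \<open>p \<in> C\<close>, the element \<open>x p\<close> of \<open>A\<close> commutes with \<open>C\<close> and so lies in \<open>C\<close> by maximality, and
  \<open>x p \<rightarrow> x\<close> strictly.

  For an abelian projection \<open>f\<close> the left ideal \<open>M f\<close> is a Hilbert module over the commutative algebra
  \<open>f M f\<close>, all of whose projections are cut down from the centre. Since \<open>C\<close> is closed under gluing of its
  projections along central partitions, there are projections \<open>p\<^sub>n\<close> of \<open>C\<close> for which \<open>(1 - p\<^sub>n) f\<close> is minimal up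
  to \<open>1/n\<close> on every central piece at once. The limit \<open>w\<close> of \<open>(1 - p\<^sub>n) f\<close> is orthogonal to \<open>C f\<close>, hence \<open>C w = 0\<close>,
  hence \<open>w = 0\<close>, because the annihilator of \<open>C\<close> contains no nonzero abelian projection.

  Finite projections are locally, over a central partition, finite sums of abelian ones; otherwise
  they would contain infinitely many orthogonal copies of an abelian projection. Conversely, by
  Gaussian elimination over \<open>g M g\<close> with \<open>g\<close> abelian, every projection of \<open>A\<close> is finite. This makes
  the gluing possible, and reduces the approximation of \<open>A\<close> to abelian projections.
\<close>

section \<open>Positivity in a C*-algebra\<close>

text \<open>There is no functional calculus, no Hilbert space and no weak topology to work in. Order
  is therefore expressed through the norm, square roots come from an iteration, and infinite sums of
  orthogonal projections or partial isometries are replaced by projections that generate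
  annihilators. Instead of "the root is a limit of polynomials in \<open>h\<close>" one carries
  "whatever commutes with \<open>h\<close> commutes with the root".

  \<open>finite_projection_ideal\<close> is by definition only a closed linear span. That it absorbs
  multiplication rests on \<open>p * x = p * x * p + y\<close> for finite \<open>p\<close>: the
  off-diagonal \<open>y\<close> is a commutator with \<open>p\<close> and is reached through unitary
  conjugates of \<open>p\<close>, the corner \<open>p * x * p\<close> through dyadic expansions.

  The definition of a norm-closed span does not show that membership can be tested on a central
  partition, whereas finiteness of a projection can. For this reason the gluing in \<open>C\<close>
  passes from the ideal to finite projections and back.\<close>

lemma mult_assoc_rewrite: "a * b = c \<Longrightarrow> a * (b * x) = c * (x::'a::semigroup_mult)"
  by (simp add: mult.assoc[symmetric])

lemma star_scaleR: "(r *\<^sub>R x)\<^sup>\<star> = r *\<^sub>R (x::'a::cstar_algebra)\<^sup>\<star>"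
  using star_scaleC[of "complex_of_real r" x] by (simp add: scaleC_of_real)

lemma star_minus [simp]: "(- x)\<^sup>\<star> = - (x::'a::cstar_algebra)\<^sup>\<star>"
  using star_scaleR[of "-1" x] by simp

lemma star_diff: "(x - y)\<^sup>\<star> = (x::'a::cstar_algebra)\<^sup>\<star> - y\<^sup>\<star>"
  using star_add[of x "-y"] by simp

lemma star_0 [simp]: "(0::'a::cstar_algebra)\<^sup>\<star> = 0"
  using star_scaleR[of 0 "0::'a"] by simp

lemma star_1 [simp]: "(1::'a::cstar_algebra)\<^sup>\<star> = 1"
  using star_mult[of 1 "(1::'a)\<^sup>\<star>"] by (simp add: star_star)

lemmas star_simps = star_add star_diff star_mult star_star star_scaleR star_scaleC

lemma star_eq_0_iff [simp]: "(x::'a::cstar_algebra)\<^sup>\<star> = 0 \<longleftrightarrow> x = 0"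
  by (metis star_0 star_star)

lemma star_mult_self_eq_0_iff: "x\<^sup>\<star> * x = 0 \<longleftrightarrow> x = (0::'a::cstar_algebra)"
  by (metis cstar_identity mult_zero_right norm_eq_zero power_eq_0_iff)

lemma norm_star [simp]: "norm (x\<^sup>\<star>) = norm (x::'a::cstar_algebra)"
proof -
  have le: "norm y \<le> norm (y\<^sup>\<star>)" for y :: 'a
  proof (cases "y = 0")
    case False
    have "norm y * norm y \<le> norm (y\<^sup>\<star>) * norm y"
      using norm_mult_ineq[of "y\<^sup>\<star>" y] by (simp add: cstar_identity power2_eq_square)
    then show ?thesis using False by simp
  qed simp
  show ?thesis using le[of x] le[of "x\<^sup>\<star>"] by (simp add: star_star)
qed

text \<open>Not an equality: in the zero algebra the unit has norm 0.\<close>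

lemma norm_one_le: "norm (1::'a::cstar_algebra) \<le> 1"
  using cstar_identity[of "1::'a"] by (cases "norm (1::'a) = 0") (auto simp: power2_eq_square)

lemma scaleC_0_right [simp]: "c *\<^sub>C (0::'a::cstar_algebra) = 0"
  by (rule complex_vector.scale_zero_right)

lemma scaleC_scaleR: "c *\<^sub>C (r *\<^sub>R x) = r *\<^sub>R (c *\<^sub>C (x::'a::cstar_algebra))"
  by (simp flip: scaleC_of_real add: scaleC_scaleC mult.commute)

lemmas scaleC_simps = scaleC_add_right scaleC_scaleC mult_scaleC_left mult_scaleC_right
  complex_vector.scale_right_diff_distrib

lemma scaleC_minus_one: "(- 1) *\<^sub>C x = - (x::'a::cstar_algebra)"
  by (metis complex_vector.scale_minus_left complex_vector.scale_one)

text \<open>Here \<open>a + \<i>b\<close> is normal, so its norm is the square root of the norm of \<open>a\<^sup>2 + b\<^sup>2\<close>.\<close>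

lemma norm_le_if_sum_squares:
  fixes a b :: "'a::cstar_algebra"
  assumes sa: "a\<^sup>\<star> = a" "b\<^sup>\<star> = b" and comm: "a * b = b * a"
    and le: "norm (a * a + b * b) \<le> r\<^sup>2" and r: "0 \<le> r"
  shows "norm a \<le> r"
proof -
  define u where "u = a + \<i> *\<^sub>C b"
  have su: "u\<^sup>\<star> = a - \<i> *\<^sub>C b"
    by (simp add: u_def star_simps sa)
  have "u\<^sup>\<star> * u = a * a + b * b"
    unfolding su unfolding u_def
    by (simp add: algebra_simps scaleC_simps comm scaleC_minus_one)
  then have "(norm u)\<^sup>2 \<le> r\<^sup>2" using le cstar_identity[of u] by simp
  then have nu: "norm u \<le> r" using r by (simp add: power2_le_iff_abs_le)
  have "2 *\<^sub>R a = u + u\<^sup>\<star>" unfolding su unfolding u_def by (simp add: scaleR_2)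
  then have "norm (2 *\<^sub>R a) \<le> norm u + norm (u\<^sup>\<star>)" by (metis norm_triangle_ineq)
  then show ?thesis using nu by simp
qed

text \<open>A fixed point of \<open>r = (y + r * r) / 2\<close> solves the equation. The same
  recursion on the real number \<open>norm y\<close> gives \<rho>, whose increments dominate those
  of \<open>R\<close>. As \<rho> is increasing and bounded by \<open>norm y\<close>, this yields
  convergence also for \<open>norm y = 1\<close>, where the iteration need not be a strict
  contraction.\<close>

lemma sqrt_one_minus:
  fixes y :: "'a::cstar_algebra"
  assumes sa: "y\<^sup>\<star> = y" and y: "norm y \<le> 1"
  obtains r where "r\<^sup>\<star> = r" "(1 - r) * (1 - r) = 1 - y" "norm r \<le> norm y"
    "\<And>w. w * y = y * w \<Longrightarrow> w * r = r * w"
proof -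
  define R where "R = rec_nat (0::'a) (\<lambda>_ r. (1/2) *\<^sub>R (y + r * r))"
  define \<rho> where "\<rho> = rec_nat (0::real) (\<lambda>_ r. (norm y + r * r) / 2)"
  have R0: "R 0 = 0" and RS: "\<And>n. R (Suc n) = (1/2) *\<^sub>R (y + R n * R n)"
    by (simp_all add: R_def)
  have r0: "\<rho> 0 = 0" and rS: "\<And>n. \<rho> (Suc n) = (norm y + \<rho> n * \<rho> n) / 2"
    by (simp_all add: \<rho>_def)
  have rnn: "0 \<le> \<rho> n" for n by (induction n) (auto simp: r0 rS)
  have rle: "\<rho> n \<le> norm y" for n
  proof (induction n)
    case (Suc n)
    have "\<rho> n * \<rho> n \<le> norm y * 1" using Suc y rnn[of n] by (intro mult_mono) auto
    then show ?case by (simp add: rS)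
  qed (simp add: r0)
  have comm: "w * R n = R n * w" if "w * y = y * w" for w n
  proof (induction n)
    case (Suc n)
    have "w * (R n * R n) = R n * R n * w" by (metis Suc mult.assoc)
    then show ?case by (simp add: RS that distrib_left distrib_right)
  qed (simp add: R0)
  have RR: "R m * R n = R n * R m" for m n
    by (intro comm) (metis comm)
  have RN: "norm (R n) \<le> \<rho> n" for n
  proof (induction n)
    case (Suc n)
    have "norm (R n * R n) \<le> \<rho> n * \<rho> n"
      using norm_mult_ineq[of "R n" "R n"] mult_mono[OF Suc Suc] rnn[of n] by force
    then show ?case
      using norm_triangle_ineq[of y "R n * R n"] by (simp add: RS rS)
  qed (simp add: R0 r0)
  have sq_diff: "(1/2) *\<^sub>R (y + a * a) - (1/2) *\<^sub>R (y + b * b) = (1/2) *\<^sub>R ((a - b) * (a + b))"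
    if "a * b = b * a" for a b
    by (simp add: algebra_simps that)
  have step: "norm (R (Suc n) - R n) \<le> \<rho> (Suc n) - \<rho> n" for n
  proof (induction n)
    case (Suc n)
    have eq: "R (Suc (Suc n)) - R (Suc n) = (1/2) *\<^sub>R ((R (Suc n) - R n) * (R (Suc n) + R n))"
      by (rule trans[OF arg_cong2[where f = "(-)", OF RS RS] sq_diff[OF RR]])
    have "norm (R (Suc n) + R n) \<le> \<rho> (Suc n) + \<rho> n"
      by (meson RN add_mono norm_triangle_le)
    then have "norm ((R (Suc n) - R n) * (R (Suc n) + R n)) \<le> (\<rho> (Suc n) - \<rho> n) * (\<rho> (Suc n) + \<rho> n)"
      using norm_mult_ineq[of "R (Suc n) - R n" "R (Suc n) + R n"] Suc
      by (meson mult_mono norm_ge_zero order.trans)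
    moreover have "\<rho> (Suc (Suc n)) - \<rho> (Suc n) = (\<rho> (Suc n) - \<rho> n) * (\<rho> (Suc n) + \<rho> n) / 2"
      unfolding rS[of "Suc n"] using rS[of n] by (simp add: field_simps)
    ultimately show ?case by (simp add: eq)
  qed (simp add: R0 r0 RS rS)
  have mono: "\<rho> n \<le> \<rho> (Suc n)" for n using order.trans[OF norm_ge_zero step[of n]] by simp
  have "convergent \<rho>"
    by (rule Bseq_mono_convergent[OF BseqI'[of _ "norm y"]])
       (use rnn rle lift_Suc_mono_le[of \<rho>, OF mono] in auto)
  then have cau: "Cauchy \<rho>" by (rule convergent_Cauchy)
  have tele: "norm (R (n + k) - R n) \<le> \<rho> (n + k) - \<rho> n" for n k
  proof (induction k)
    case (Suc k)
    have "norm (R (n + Suc k) - R n) \<le> norm (R (Suc (n + k)) - R (n + k)) + norm (R (n + k) - R n)"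
      using norm_triangle_ineq[of "R (Suc (n + k)) - R (n + k)" "R (n + k) - R n"] by simp
    then show ?case using Suc step[of "n + k"] by simp
  qed simp
  have "Cauchy R"
  proof (rule metric_CauchyI)
    fix e :: real assume "e > 0"
    then obtain M where M: "\<And>m n. m \<ge> M \<Longrightarrow> n \<ge> M \<Longrightarrow> dist (\<rho> m) (\<rho> n) < e"
      using cau unfolding Cauchy_def by blast
    have *: "dist (R m) (R n) < e" if "m \<ge> n" "n \<ge> M" for m n
      using tele[of n "m - n"] M[of m n] that by (auto simp: dist_norm)
    show "\<exists>M. \<forall>m\<ge>M. \<forall>n\<ge>M. dist (R m) (R n) < e"
      by (metis * dist_commute nle_le)
  qed
  then obtain r where lim: "R \<longlonglongrightarrow> r" by (meson Cauchy_convergent convergent_def)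
  have lim2: "(\<lambda>n. (1/2) *\<^sub>R (y + R n * R n)) \<longlonglongrightarrow> (1/2) *\<^sub>R (y + r * r)"
    by (intro tendsto_intros lim)
  have "(\<lambda>n. R (Suc n)) \<longlonglongrightarrow> r" using lim by (rule LIMSEQ_Suc)
  then have fix_eq: "r = (1/2) *\<^sub>R (y + r * r)" using lim2 LIMSEQ_unique by (simp add: RS) blast
  have "2 *\<^sub>R r = y + r * r" by (subst fix_eq) simp
  then have sq: "(1 - r) * (1 - r) = 1 - y" by (simp add: algebra_simps scaleR_2)
  have "w * r = r * w" if "w * y = y * w" for w
  proof -
    have "(\<lambda>n. w * R n) \<longlonglongrightarrow> w * r" "(\<lambda>n. R n * w) \<longlonglongrightarrow> r * w" by (intro tendsto_intros lim)+
    then show ?thesis using comm[OF that] LIMSEQ_unique by simp blast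
  qed
  moreover have "norm r \<le> norm y"
    by (rule LIMSEQ_le_const2[OF tendsto_norm[OF lim]]) (meson RN rle order.trans)
  moreover have "r\<^sup>\<star> = r"
  proof -
    have sR: "(R n)\<^sup>\<star> = R n" for n by (induction n) (auto simp: R0 RS star_simps sa)
    have "norm (r\<^sup>\<star> - r) \<le> 0"
    proof (rule LIMSEQ_le_const)
      show "(\<lambda>n. norm (R n - r) + norm (R n - r)) \<longlonglongrightarrow> 0"
        using tendsto_add[OF tendsto_norm[OF LIM_zero[OF lim]] tendsto_norm[OF LIM_zero[OF lim]]] by simp
      have "norm (r\<^sup>\<star> - r) \<le> norm (R n - r) + norm (R n - r)" for n
        using norm_triangle_ineq4[of "R n - r" "(R n - r)\<^sup>\<star>"] norm_star[of "R n - r"]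
        by (simp add: star_diff sR del: norm_star)
      then show "\<exists>N. \<forall>n\<ge>N. norm (r\<^sup>\<star> - r) \<le> norm (R n - r) + norm (R n - r)" by blast
    qed
    then show ?thesis by simp
  qed
  ultimately show ?thesis using that sq by blast
qed

text \<open>For self-adjoint \<open>h\<close> in a nonzero algebra the norm condition says that the
  spectrum lies in \<open>[0, 2 * t]\<close>. In this form sums of positive elements are positive by
  the triangle inequality.\<close>

definition pos :: "'a::cstar_algebra \<Rightarrow> bool" where
  "pos h \<longleftrightarrow> h\<^sup>\<star> = h \<and> (\<exists>t\<ge>0. norm (t *\<^sub>R 1 - h) \<le> t)"

lemma pos_star: "pos h \<Longrightarrow> h\<^sup>\<star> = h"
  by (simp add: pos_def)

text \<open>Let \<open>y\<close> be \<open>s * s\<close> divided by \<open>t\<close>. The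
  self-adjoint \<open>1 - r\<close> and \<open>a\<close> commute and their squares add up to
  \<open>1\<close>, so \<open>norm (1 - r) \<le> 1\<close>; squaring gives
  \<open>norm (1 - y) \<le> 1\<close>.\<close>

lemma norm_diff_square_le:
  fixes s :: "'a::cstar_algebra"
  assumes sa: "s\<^sup>\<star> = s" and t: "(norm s)\<^sup>2 \<le> t"
  shows "norm (t *\<^sub>R 1 - s * s) \<le> t"
proof (cases "t = 0")
  case True
  then show ?thesis using t by simp
next
  case False
  then have tpos: "t > 0" using t by (smt (verit) zero_le_power2)
  define y where "y = (1 / t) *\<^sub>R (s * s)"
  have "norm (s * s) = (norm s)\<^sup>2" using cstar_identity[of s] sa by simp
  then have ny: "norm y \<le> 1" using t tpos by (simp add: y_def)
  have sy: "y\<^sup>\<star> = y" by (simp add: y_def star_simps sa)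
  obtain r where r: "r\<^sup>\<star> = r" "(1 - r) * (1 - r) = 1 - y"
    "\<And>w. w * y = y * w \<Longrightarrow> w * r = r * w"
    using sqrt_one_minus[OF sy ny] by blast
  define a where "a = (1 / sqrt t) *\<^sub>R s"
  have aa: "a * a = y" using tpos by (simp add: a_def y_def)
  have ar: "a * r = r * a" by (rule r(3)) (simp add: aa[symmetric] mult.assoc)
  have "norm (1 - r) \<le> 1"
  proof (rule norm_le_if_sum_squares[of _ a])
    show "(1 - r) * a = a * (1 - r)" using ar by (simp add: algebra_simps)
    show "norm ((1 - r) * (1 - r) + a * a) \<le> 1\<^sup>2" by (simp add: r(2) aa norm_one_le)
  qed (simp_all add: star_simps r(1) a_def sa)
  then have "norm (1 - y) \<le> 1"
    using norm_mult_ineq[of "1 - r" "1 - r"] mult_mono[of "norm (1 - r)" 1 "norm (1 - r)" 1]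
    by (simp add: r(2))
  moreover have "t *\<^sub>R 1 - s * s = t *\<^sub>R (1 - y)" using tpos by (simp add: y_def algebra_simps)
  ultimately show ?thesis using tpos by simp
qed

lemma pos_square: "s\<^sup>\<star> = s \<Longrightarrow> pos (s * s)"
  unfolding pos_def using norm_diff_square_le[of s "(norm s)\<^sup>2"]
  by (metis star_mult zero_le_power2 order_refl)

text \<open>A positive \<open>h\<close> is \<open>t *\<^sub>R (1 - y)\<close> with
  \<open>norm y \<le> 1\<close>, and the root is \<open>sqrt t *\<^sub>R (1 - r)\<close>. The bound
  on \<open>norm r\<close> makes the root itself positive.\<close>

lemma pos_sqrt:
  assumes "pos h"
  obtains s where "pos s" "s * s = h" "\<And>w. w * h = h * w \<Longrightarrow> w * s = s * w"
proof -
  obtain t where h: "h\<^sup>\<star> = h" and t: "t \<ge> 0" "norm (t *\<^sub>R 1 - h) \<le> t"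
    using assms pos_def by blast
  show ?thesis
  proof (cases "t = 0")
    case True
    then have "h = 0" using t by simp
    moreover have "pos (0::'a)" unfolding pos_def by (intro conjI exI[of _ 0]) auto
    ultimately show ?thesis using that[of 0] by simp
  next
    case False
    with t have tpos: "t > 0" by simp
    define y where "y = 1 - (1 / t) *\<^sub>R h"
    have y: "y = (1 / t) *\<^sub>R (t *\<^sub>R 1 - h)" using tpos by (simp add: y_def algebra_simps)
    have ny: "norm y \<le> 1" unfolding y using t(2) tpos by simp
    have sy: "y\<^sup>\<star> = y" by (simp add: y_def star_simps h)
    obtain r where r: "r\<^sup>\<star> = r" "(1 - r) * (1 - r) = 1 - y" "norm r \<le> norm y"
      "\<And>w. w * y = y * w \<Longrightarrow> w * r = r * w"
      using sqrt_one_minus[OF sy ny] by blast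
    show ?thesis
    proof (rule that[of "sqrt t *\<^sub>R (1 - r)"])
      have "norm (sqrt t *\<^sub>R 1 - sqrt t *\<^sub>R (1 - r)) \<le> sqrt t"
        using r(3) ny tpos by (simp add: algebra_simps)
      moreover have "(sqrt t *\<^sub>R (1 - r))\<^sup>\<star> = sqrt t *\<^sub>R (1 - r)" by (simp add: star_simps r(1))
      ultimately show "pos (sqrt t *\<^sub>R (1 - r))" unfolding pos_def using tpos by (metis real_sqrt_ge_0_iff less_imp_le)
      show "sqrt t *\<^sub>R (1 - r) * (sqrt t *\<^sub>R (1 - r)) = h"
        using tpos by (simp add: r(2) y_def)
      show "w * (sqrt t *\<^sub>R (1 - r)) = sqrt t *\<^sub>R (1 - r) * w" if "w * h = h * w" for w
        using r(4)[of w] that by (simp add: y_def algebra_simps)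
    qed
  qed
qed

section \<open>The positive cone and its relation to the norm\<close>

lemma pos_0 [simp]: "pos 0"
  using pos_square[of 0] by simp

lemma pos_add: "pos a \<Longrightarrow> pos b \<Longrightarrow> pos (a + b)"
proof -
  assume "pos a" "pos b"
  then obtain s t where *: "a\<^sup>\<star> = a" "b\<^sup>\<star> = b" "s \<ge> 0" "t \<ge> 0" "norm (s *\<^sub>R 1 - a) \<le> s" "norm (t *\<^sub>R 1 - b) \<le> t"
    unfolding pos_def by blast
  have "norm ((s + t) *\<^sub>R 1 - (a + b)) \<le> norm (s *\<^sub>R 1 - a) + norm (t *\<^sub>R 1 - b)"
    using norm_triangle_ineq[of "s *\<^sub>R 1 - a" "t *\<^sub>R 1 - b"] by (simp add: algebra_simps)
  then show "pos (a + b)" unfolding pos_def using * by (intro conjI exI[of _ "s + t"]) (auto simp: star_add)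
qed

lemma pos_scaleR: "pos a \<Longrightarrow> 0 \<le> c \<Longrightarrow> pos (c *\<^sub>R a)"
proof -
  assume "pos a" "0 \<le> c"
  then obtain t where *: "a\<^sup>\<star> = a" "t \<ge> 0" "norm (t *\<^sub>R 1 - a) \<le> t"
    unfolding pos_def by blast
  have "norm ((c * t) *\<^sub>R 1 - c *\<^sub>R a) = c * norm (t *\<^sub>R 1 - a)"
    using norm_scaleR[of c "t *\<^sub>R 1 - a"] \<open>0 \<le> c\<close> by (simp add: algebra_simps)
  then show "pos (c *\<^sub>R a)" unfolding pos_def using * \<open>0 \<le> c\<close>
    by (intro conjI exI[of _ "c * t"]) (auto simp: star_scaleR mult_left_mono)
qed

lemma pos_diff_if_norm_le: "h\<^sup>\<star> = h \<Longrightarrow> norm h \<le> r \<Longrightarrow> pos (r *\<^sub>R 1 - h)"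
  unfolding pos_def
  by (intro conjI exI[of _ r]) (auto simp: star_simps intro: order.trans[OF norm_ge_zero])

text \<open>The roots \<open>s\<close> of \<open>h\<close> and \<open>u\<close> of
  \<open>r *\<^sub>R 1 - h\<close> commute and their squares add up to \<open>r *\<^sub>R 1\<close>;
  hence \<open>norm s \<le> sqrt r\<close>.\<close>

lemma norm_le_if_pos:
  assumes "pos h" "pos (r *\<^sub>R 1 - h)" "0 \<le> r"
  shows "norm h \<le> r"
proof -
  obtain s where s: "pos s" "s * s = h" "\<And>w. w * h = h * w \<Longrightarrow> w * s = s * w"
    using pos_sqrt[OF assms(1)] by blast
  obtain u where u: "pos u" "u * u = r *\<^sub>R 1 - h"
    "\<And>w. w * (r *\<^sub>R 1 - h) = (r *\<^sub>R 1 - h) * w \<Longrightarrow> w * u = u * w"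
    using pos_sqrt[OF assms(2)] by blast
  have "s * h = h * s" using s(2) by (metis mult.assoc)
  then have su: "s * u = u * s" by (intro u(3)) (simp add: algebra_simps)
  have "norm (r *\<^sub>R (1::'a)) \<le> r * 1" using mult_left_mono[OF norm_one_le assms(3)] assms(3) by simp
  then have "norm s \<le> sqrt r"
    by (intro norm_le_if_sum_squares[OF pos_star[OF s(1)] pos_star[OF u(1)] su])
       (use assms(3) in \<open>auto simp: s(2) u(2)\<close>)
  then have "norm s * norm s \<le> sqrt r * sqrt r" by (intro mult_mono) (auto simp: assms(3))
  then show ?thesis using norm_mult_ineq[of s s] assms(3) by (simp add: s(2))
qed

lemma pos_antisym: "pos h \<Longrightarrow> pos (- h) \<Longrightarrow> h = 0"
  using norm_le_if_pos[of h 0] by simp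

text \<open>Half the sum of the squares of the self-adjoint \<open>v + v\<^sup>\<star>\<close> and
  \<open>\<i> *\<^sub>C (v - v\<^sup>\<star>)\<close>. Positivity of each summand by itself is
  harder and is deduced from this in \<open>pos_star_mult_self\<close>.\<close>

lemma pos_sum_squares_adjoint:
  fixes v :: "'a::cstar_algebra"
  shows "pos (v\<^sup>\<star> * v + v * v\<^sup>\<star>)"
proof -
  define a b where "a = v + v\<^sup>\<star>" and "b = \<i> *\<^sub>C (v - v\<^sup>\<star>)"
  have bb: "b * b = - ((v - v\<^sup>\<star>) * (v - v\<^sup>\<star>))"
    by (simp add: b_def mult_scaleC_left mult_scaleC_right scaleC_scaleC scaleC_minus_one)
  have sa: "a\<^sup>\<star> = a" by (simp add: a_def star_simps)
  have sb: "b\<^sup>\<star> = b" by (simp add: b_def star_simps complex_vector.scale_right_diff_distrib)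
  have "pos ((1/2) *\<^sub>R (a * a + b * b))"
    by (intro pos_scaleR pos_add pos_square sa sb) auto
  moreover have "(1/2) *\<^sub>R (a * a + b * b) = (1/2) *\<^sub>R (2 *\<^sub>R (v\<^sup>\<star> * v + v * v\<^sup>\<star>))"
    unfolding bb a_def by (rule arg_cong[where f = "scaleR (1/2)"]) (simp add: algebra_simps scaleR_2)
  ultimately show ?thesis by simp
qed

section \<open>Spectral projections and polar decomposition\<close>

lemma projection_star: "is_projection e \<Longrightarrow> e\<^sup>\<star> = e"
  and projection_idem: "is_projection e \<Longrightarrow> e * e = e"
  and projection_idem_left: "is_projection e \<Longrightarrow> e * (e * x) = e * x"
  by (auto simp: is_projection_def mult.assoc[symmetric])

lemma is_projection_0 [simp]: "is_projection 0"
  by (simp add: is_projection_def)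

lemma is_projection_compl: "is_projection e \<Longrightarrow> is_projection (1 - e)"
  by (auto simp: is_projection_def star_simps algebra_simps)

lemma is_projection_mult: "is_projection e \<Longrightarrow> is_projection f \<Longrightarrow> e * f = f * e \<Longrightarrow> is_projection (e * f)"
  unfolding is_projection_def by (metis mult.assoc star_mult)

lemma projection_le_commute: "is_projection e \<Longrightarrow> is_projection f \<Longrightarrow> e * f = e \<Longrightarrow> f * e = e"
  by (metis projection_star star_mult)

lemma projection_orth_commute: "is_projection e \<Longrightarrow> is_projection f \<Longrightarrow> e * f = 0 \<Longrightarrow> f * e = 0"
  by (metis projection_star star_mult star_0)

lemma is_projection_diff: "is_projection e \<Longrightarrow> is_projection f \<Longrightarrow> e * f = e \<Longrightarrow> is_projection (f - e)"
  using projection_le_commute[of e f] by (auto simp: is_projection_def star_simps algebra_simps)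

lemma is_projection_join:
  "is_projection e \<Longrightarrow> is_projection f \<Longrightarrow> e * f = f * e \<Longrightarrow> is_projection (e + f - e * f)"
  using is_projection_compl[OF is_projection_mult[OF is_projection_compl is_projection_compl], of e f]
  by (simp add: algebra_simps)

lemma norm_projection_le: "is_projection e \<Longrightarrow> norm e \<le> 1"
  using cstar_identity[of e]
  by (cases "norm e = 0") (auto simp: projection_star projection_idem power2_eq_square)

lemma norm_projection_mult_le:
  assumes "is_projection e"
  shows "norm (e * x) \<le> norm x" "norm (x * e) \<le> norm x"
  using norm_mult_ineq[of e x] norm_mult_ineq[of x e] norm_projection_le[OF assms]
    mult_left_le_one_le[of "norm x" "norm e"] mult_left_le[of "norm e" "norm x"] by auto

lemma pos_projection: "is_projection e \<Longrightarrow> pos e"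
  using pos_square[of e] by (simp add: is_projection_def)

lemma pos_mult_projection:
  assumes "pos h" "is_projection e" "h * e = e * h"
  shows "pos (h * e)"
proof -
  obtain s where s: "pos s" "s * s = h" "\<And>w. w * h = h * w \<Longrightarrow> w * s = s * w"
    using pos_sqrt[OF assms(1)] by blast
  have es: "e * s = s * e" by (rule s(3)) (simp add: assms)
  have "(s * e) * (s * e) = s * (e * s) * e" by (simp add: mult.assoc)
  also have "\<dots> = h * e"
    unfolding es using projection_idem[OF assms(2)] s(2) by (simp add: mult.assoc[symmetric]) (simp add: mult.assoc)
  finally have "(s * e) * (s * e) = h * e" .
  moreover have "(s * e)\<^sup>\<star> = s * e"
    using s(1) assms(2) es by (simp add: star_mult pos_star projection_star)
  ultimately show ?thesis using pos_square by metis
qed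

lemma pos_zero_if_neg_projection: "is_projection e \<Longrightarrow> pos (- e) \<Longrightarrow> e = 0"
  using pos_antisym pos_projection by blast

lemma pos_sum_zero: "pos a \<Longrightarrow> pos b \<Longrightarrow> pos (- (a + b)) \<Longrightarrow> a = 0"
  by (rule pos_antisym) (use pos_add[of b "- (a + b)"] in simp_all)

text \<open>The complement of the annihilator projection of \<open>S\<close>. The last property makes it commute with
  every \<open>w\<close> such that \<open>w\<close> and \<open>w\<^sup>\<star>\<close> leave the right annihilator invariant.\<close>

lemma support_projection:
  fixes S :: "'a::aw_star_algebra set"
  obtains E where "is_projection E" "\<And>s. s \<in> S \<Longrightarrow> s * E = s"
    "\<And>x. (\<And>s. s \<in> S \<Longrightarrow> s * x = 0) \<Longrightarrow> E * x = 0"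
    "\<And>w. (\<And>t s. (\<And>s. s \<in> S \<Longrightarrow> s * t = 0) \<Longrightarrow> s \<in> S \<Longrightarrow> s * (w * t) = 0 \<and> s * (w\<^sup>\<star> * t) = 0)
      \<Longrightarrow> w * E = E * w"
proof -
  obtain e where e: "is_projection e" "right_annihilator S = range ((*) e)"
    using right_annihilator_ex_projection by blast
  define E where "E = 1 - e"
  have E: "is_projection E" using e(1) by (simp add: E_def is_projection_compl)
  have a: "s * E = s" if "s \<in> S" for s
  proof -
    have "e * 1 \<in> right_annihilator S" unfolding e(2) by blast
    then show ?thesis using that by (simp add: right_annihilator_def E_def algebra_simps)
  qed
  have b: "E * x = 0" if "\<And>s. s \<in> S \<Longrightarrow> s * x = 0" for x
  proof -
    have "x \<in> range ((*) e)" using that by (simp add: e(2)[symmetric] right_annihilator_def)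
    then show ?thesis using e(1) by (auto simp: E_def algebra_simps projection_idem_left)
  qed
  have c: "w * E = E * w"
    if "\<And>t s. (\<And>s. s \<in> S \<Longrightarrow> s * t = 0) \<Longrightarrow> s \<in> S \<Longrightarrow> s * (w * t) = 0 \<and> s * (w\<^sup>\<star> * t) = 0" for w
  proof -
    have *: "s * (1 - E) = 0" if "s \<in> S" for s using a[OF that] by (simp add: algebra_simps)
    have 1: "E * (w * (1 - E)) = 0" and 2: "E * (w\<^sup>\<star> * (1 - E)) = 0"
      by (rule b, use that[of "1 - E"] * in blast)+
    \<comment> \<open>The adjoint of the identity for \<open>w\<^sup>\<star>\<close> is the other
      off-diagonal corner of \<open>w\<close>.\<close>
    have "(E * (w\<^sup>\<star> * (1 - E)))\<^sup>\<star> = 0" by (simp add: 2)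
    then have "(1 - E) * (w * E) = 0" by (simp add: star_simps projection_star[OF E] mult.assoc)
    with 1 show ?thesis by (simp add: algebra_simps)
  qed
  show ?thesis using that[OF E a b c] by blast
qed

lemma support_projection_of_set_of_projections:
  fixes S :: "'a::aw_star_algebra set"
  assumes "\<And>s. s \<in> S \<Longrightarrow> is_projection s"
  obtains E where "is_projection E" "\<And>s. s \<in> S \<Longrightarrow> s * E = s" "\<And>s. s \<in> S \<Longrightarrow> E * s = s"
    "\<And>x. (\<And>s. s \<in> S \<Longrightarrow> s * x = 0) \<Longrightarrow> E * x = 0"
  by (rule support_projection[of S]) (metis assms projection_le_commute)

lemma support_self_adjoint:
  fixes a :: "'a::aw_star_algebra"
  assumes "a\<^sup>\<star> = a"
  obtains E where "is_projection E" "a * E = a" "E * a = a" "\<And>x. a * x = 0 \<Longrightarrow> E * x = 0"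
    "\<And>w. w * a = a * w \<Longrightarrow> w * E = E * w"
proof (rule support_projection[of "{a}"])
  fix E :: 'a
  assume E: "is_projection E" "\<And>s. s \<in> {a} \<Longrightarrow> s * E = s"
    "\<And>x. (\<And>s. s \<in> {a} \<Longrightarrow> s * x = 0) \<Longrightarrow> E * x = 0"
    "\<And>w. (\<And>t s. (\<And>s. s \<in> {a} \<Longrightarrow> s * t = 0) \<Longrightarrow> s \<in> {a} \<Longrightarrow> s * (w * t) = 0 \<and> s * (w\<^sup>\<star> * t) = 0)
      \<Longrightarrow> w * E = E * w"
  have "w * E = E * w" if w: "w * a = a * w" for w
  proof (rule E(4))
    fix t s assume t: "\<And>s. s \<in> {a} \<Longrightarrow> s * t = 0" and s: "s \<in> {a}"
    have "a * w\<^sup>\<star> = w\<^sup>\<star> * a" using arg_cong[OF w, of star] assms by (simp add: star_mult)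
    then have "a * (w * t) = w * (a * t)" "a * (w\<^sup>\<star> * t) = w\<^sup>\<star> * (a * t)" using w by (metis mult.assoc)+
    then show "s * (w * t) = 0 \<and> s * (w\<^sup>\<star> * t) = 0" using t s by simp
  qed
  moreover have "E * a = a" using E(1) E(2)[of a] assms by (metis projection_star singletonI star_mult)
  ultimately show ?thesis using that[of E] E(1,2,3) by auto
qed

text \<open>With \<open>m\<close> the root of \<open>x * x\<close>, the projection \<open>e\<close>
  is the support of \<open>m + x\<close>, which is twice the positive part of \<open>x\<close>. From
  \<open>(m + x) * (m - x) = 0\<close> it follows that \<open>x\<close> is \<open>m\<close> on
  \<open>e\<close>, and since \<open>m + x\<close> vanishes off \<open>e\<close>, \<open>x\<close>
  is \<open>- m\<close> there.\<close>

lemma spectral_projection: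
  fixes x :: "'a::aw_star_algebra"
  assumes sa: "x\<^sup>\<star> = x"
  obtains e where "is_projection e" "\<And>w. w * x = x * w \<Longrightarrow> w * e = e * w"
    "pos (x * e)" "pos (- (x * (1 - e)))"
proof -
  obtain m where m: "pos m" "m * m = x * x" "\<And>w. w * (x * x) = (x * x) * w \<Longrightarrow> w * m = m * w"
    using pos_sqrt[OF pos_square[OF sa]] by blast
  have mx: "x * m = m * x" by (rule m(3)) (simp add: mult.assoc)
  have ms: "m\<^sup>\<star> = m" by (rule pos_star[OF m(1)])
  obtain e where e: "is_projection e" "(m + x) * e = m + x" "e * (m + x) = m + x"
    "\<And>y. (m + x) * y = 0 \<Longrightarrow> e * y = 0" "\<And>w. w * (m + x) = (m + x) * w \<Longrightarrow> w * e = e * w"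
    using support_self_adjoint[of "m + x"] sa ms by (auto simp: star_add)
  have comm: "w * e = e * w" if w: "w * x = x * w" for w
  proof (rule e(5))
    have "w * m = m * w" by (rule m(3)) (metis w mult.assoc)
    then show "w * (m + x) = (m + x) * w" by (simp add: algebra_simps w)
  qed
  have em: "m * e = e * m" by (rule comm) (simp add: mx)
  have ex: "x * e = e * x" by (rule comm) simp
  have "e * (m - x) = 0" by (rule e(4)) (simp add: algebra_simps mx m(2))
  then have xe: "x * e = m * e" by (simp add: algebra_simps em ex)
  have "x * (1 - e) + m * (1 - e) = m + x - (m + x) * e" by (simp add: algebra_simps)
  then have "- (x * (1 - e)) = m * (1 - e)" using e(2) by (simp add: add_eq_0_iff2)
  moreover have "m * (1 - e) = (1 - e) * m" using em by (simp add: algebra_simps)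
  ultimately have "pos (- (x * (1 - e)))"
    using pos_mult_projection[OF m(1) is_projection_compl[OF e(1)]] by simp
  moreover have "pos (x * e)" unfolding xe by (rule pos_mult_projection[OF m(1) e(1) em])
  ultimately show ?thesis using that e(1) comm by blast
qed

lemma spectral_projection_level:
  fixes k :: "'a::aw_star_algebra"
  assumes sa: "k\<^sup>\<star> = k"
  obtains e where "is_projection e" "\<And>w. w * k = k * w \<Longrightarrow> w * e = e * w"
    "pos (k * e - r *\<^sub>R e)" "pos (r *\<^sub>R (1 - e) - k * (1 - e))"
proof -
  have "(k - r *\<^sub>R 1)\<^sup>\<star> = k - r *\<^sub>R 1" by (simp add: star_simps sa)
  then obtain e where e: "is_projection e"
    "\<And>w. w * (k - r *\<^sub>R 1) = (k - r *\<^sub>R 1) * w \<Longrightarrow> w * e = e * w"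
    "pos ((k - r *\<^sub>R 1) * e)" "pos (- ((k - r *\<^sub>R 1) * (1 - e)))"
    using spectral_projection by blast
  show ?thesis
  proof (rule that[OF e(1)])
    show "w * e = e * w" if "w * k = k * w" for w
      by (rule e(2)) (simp add: algebra_simps that)
    show "pos (k * e - r *\<^sub>R e)" using e(3) by (simp add: algebra_simps)
    have "- ((k - r *\<^sub>R 1) * (1 - e)) = r *\<^sub>R (1 - e) - k * (1 - e)" by (simp add: algebra_simps)
    then show "pos (r *\<^sub>R (1 - e) - k * (1 - e))" using e(4) by simp
  qed
qed

lemma neumann_inverse:
  fixes n :: "'a::cstar_algebra"
  assumes n: "norm n < 1" and sa: "n\<^sup>\<star> = n"
  obtains j where "j * (1 - n) = 1" "(1 - n) * j = 1" "j\<^sup>\<star> = j" "\<And>w. w * n = n * w \<Longrightarrow> w * j = j * w"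
proof -
  have np: "norm (n ^ i) \<le> norm n ^ i" for i
  proof (induction i)
    case (Suc i)
    then show ?case using norm_mult_ineq[of n "n ^ i"] mult_left_mono[OF Suc, of "norm n"] by simp
  qed (simp add: norm_one_le)
  have "summable (\<lambda>i. norm (n ^ i))"
    by (rule summable_comparison_test[OF _ summable_geometric[of "norm n"]]) (use np n in auto)
  then have sm: "summable (\<lambda>i. n ^ i)" by (rule summable_norm_cancel)
  define j where "j = (\<Sum>i. n ^ i)"
  have comm: "w * j = j * w" if w: "w * n = n * w" for w
  proof -
    have "w * n ^ i = n ^ i * w" for i
      by (induction i) (simp_all, metis w mult.assoc)
    then show ?thesis unfolding j_def by (simp add: suminf_mult[OF sm, symmetric] suminf_mult2[OF sm])
  qed
  have "j = n * j + 1"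
    unfolding j_def using suminf_split_head[OF sm] by (simp add: suminf_mult[OF sm])
  then have l: "(1 - n) * j = 1" by (simp add: algebra_simps)
  then have r: "j * (1 - n) = 1" using comm[of n] by (simp add: algebra_simps)
  have "j\<^sup>\<star> * (1 - n) = 1" using arg_cong[OF l, of star] by (simp add: star_simps sa)
  then have "j\<^sup>\<star> = j" by (metis l mult.assoc mult_1_left mult_1_right)
  then show ?thesis using that l r comm by blast
qed

text \<open>Where \<open>k\<close> is bounded below by half its norm it has an inverse square root.\<close>

lemma pos_local_inverse_sqrt:
  fixes k :: "'a::aw_star_algebra"
  assumes k: "pos k" "k \<noteq> 0"
  obtains b e where "is_projection e" "e \<noteq> 0" "b\<^sup>\<star> = b" "b * k * b = e" "b * e = b"
    "\<And>w. w * k = k * w \<Longrightarrow> w * b = b * w" "\<And>w. w * k = k * w \<Longrightarrow> w * e = e * w"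
proof -
  define T where "T = norm k"
  have T: "T > 0" using k by (simp add: T_def)
  have ks: "k\<^sup>\<star> = k" by (rule pos_star[OF k(1)])
  obtain e where e: "is_projection e" "\<And>w. w * k = k * w \<Longrightarrow> w * e = e * w"
    "pos (k * e - (T/2) *\<^sub>R e)" "pos ((T/2) *\<^sub>R (1 - e) - k * (1 - e))"
    using spectral_projection_level[OF ks] by blast
  have ek: "k * e = e * k" by (rule e(2)) simp
  have e0: "e \<noteq> 0"
  proof
    assume "e = 0"
    then have "pos ((T/2) *\<^sub>R 1 - k)" using e(4) by simp
    then have "T \<le> T/2" using norm_le_if_pos[OF k(1), of "T/2"] T unfolding T_def by simp
    then show False using T by simp
  qed
  \<comment> \<open>On \<open>e\<close> the element \<open>k\<close> lies between \<open>T/2\<close>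
    and \<open>T\<close>, so \<open>n\<close> lies between \<open>0\<close> and \<open>1/2\<close>
    and \<open>1 - n\<close> is invertible; on \<open>e\<close>, \<open>1 - n\<close> is
    \<open>k\<close> divided by \<open>T\<close>.\<close>
  define n where "n = e - (1/T) *\<^sub>R (k * e)"
  have "pos ((T *\<^sub>R 1 - k) * e)"
    by (rule pos_mult_projection[OF pos_diff_if_norm_le[OF ks] e(1)]) (simp_all add: T_def algebra_simps ek)
  then have "pos ((1/T) *\<^sub>R ((T *\<^sub>R 1 - k) * e))" using T by (intro pos_scaleR) auto
  moreover have "(1/T) *\<^sub>R ((T *\<^sub>R 1 - k) * e) = n" using T by (simp add: n_def algebra_simps)
  ultimately have pn: "pos n" by simp
  have "pos ((1/2) *\<^sub>R (1 - e) + (1/T) *\<^sub>R (k * e - (T/2) *\<^sub>R e))"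
    using T by (intro pos_add pos_scaleR e(3) pos_projection is_projection_compl e(1)) auto
  moreover have "(1/2) *\<^sub>R (1 - e) + (1/T) *\<^sub>R (k * e - (T/2) *\<^sub>R e) = (1/2) *\<^sub>R 1 - n"
  proof -
    have "(1/T) *\<^sub>R (k * e - (T/2) *\<^sub>R e) = (1/T) *\<^sub>R (k * e) - (1/2) *\<^sub>R e"
      using T by (simp add: algebra_simps)
    moreover have "(1/2) *\<^sub>R (1 - e) + (v - (1/2) *\<^sub>R e) = (1/2) *\<^sub>R 1 - (((1/2) *\<^sub>R e + (1/2) *\<^sub>R e) - v)" for v
      by (simp only: scaleR_right_diff_distrib) (simp only: diff_add_eq diff_diff_eq add_diff_eq diff_diff_eq2 ac_simps)
    moreover have "(1/2) *\<^sub>R e + (1/2) *\<^sub>R e = e" by (simp flip: scaleR_add_left)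
    ultimately show ?thesis unfolding n_def by metis
  qed
  ultimately have "pos ((1/2) *\<^sub>R 1 - n)" by metis
  then have "norm n \<le> 1/2" by (intro norm_le_if_pos[OF pn]) auto
  then have "norm n < 1" by simp
  then obtain j where j: "j * (1 - n) = 1" "(1 - n) * j = 1" "j\<^sup>\<star> = j" "\<And>w. w * n = n * w \<Longrightarrow> w * j = j * w"
    using neumann_inverse[OF _ pos_star[OF pn]] by metis
  obtain s where s: "pos s" "s * s = k" "\<And>w. w * k = k * w \<Longrightarrow> w * s = s * w"
    using pos_sqrt[OF k(1)] by blast
  have cn: "w * n = n * w" if w: "w * k = k * w" for w
  proof -
    have "w * (k * e) = (k * e) * w" using e(2)[OF w] w by (metis mult.assoc)
    then show ?thesis using e(2)[OF w] by (simp add: n_def algebra_simps)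
  qed
  have cj: "w * j = j * w" if w: "w * k = k * w" for w
    by (rule j(4)[OF cn[OF w]])
  \<comment> \<open>On \<open>e\<close> the element \<open>j\<close> is \<open>T\<close> times the
    inverse of \<open>k\<close>, and root times inverse is the inverse root.\<close>
  define b where "b = (1/T) *\<^sub>R (s * j * e)"
  have sk: "s * k = k * s" using s(2) by (metis mult.assoc)
  have sj: "s * j = j * s" by (rule cj[OF sk])
  have se: "s * e = e * s" by (rule e(2)[OF sk])
  have ej: "e * j = j * e" by (rule cj) (simp add: ek)
  have kj: "k * j = j * k" by (rule cj) simp
  have ee: "e * e = e" by (rule projection_idem[OF e(1)])
  have ke: "(1/T) *\<^sub>R (k * e) * j = e"
  proof -
    have "(1/T) *\<^sub>R (k * e) = (1 - n) * e" by (simp add: n_def algebra_simps ee mult.assoc)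
    then have "(1/T) *\<^sub>R (k * e) * j = (1 - n) * j * e" by (simp add: mult.assoc ej)
    then show ?thesis by (simp add: j(2))
  qed
  have "b * k * b = ((1/T) *\<^sub>R (k * e) * j) * ((1/T) *\<^sub>R (k * e) * j)"
  proof -
    have "(s * j * e) * k * (s * j * e) = (k * e * j) * (k * e * j)"
    proof -
      have "(s * j * e) * k * (s * j * e) = s * j * e * (k * s) * j * e" by (simp add: mult.assoc)
      also have "\<dots> = s * j * (e * s) * k * j * e" by (simp add: sk[symmetric] mult.assoc)
      also have "\<dots> = s * (j * s) * e * k * j * e" by (simp add: se[symmetric] mult.assoc)
      also have "\<dots> = k * j * e * k * (j * e)" by (simp add: sj[symmetric] s(2) mult.assoc[symmetric])
      also have "\<dots> = k * (j * e) * k * (e * j)" by (simp add: ej[symmetric] mult.assoc)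
      finally show ?thesis by (simp add: ej[symmetric] mult.assoc)
    qed
    then show ?thesis by (simp add: b_def)
  qed
  then have bkb: "b * k * b = e" by (simp only: ke ee)
  have "(s * j * e)\<^sup>\<star> = e * (j * s)"
    by (simp add: star_mult j(3) pos_star[OF s(1)] projection_star[OF e(1)] mult.assoc)
  also have "\<dots> = s * j * e" by (metis ej se sj mult.assoc)
  finally have bs: "b\<^sup>\<star> = b" by (simp add: b_def star_scaleR)
  have be: "b * e = b" by (simp add: b_def mult.assoc ee)
  have "w * b = b * w" if w: "w * k = k * w" for w
  proof -
    have "w * (s * j * e) = (s * j * e) * w" using s(3)[OF w] cj[OF w] e(2)[OF w] by (metis mult.assoc)
    then show ?thesis by (simp add: b_def)
  qed
  then show ?thesis using that e(1) e0 bs bkb be e(2) by blast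
qed

text \<open>The negative part \<open>k\<close> of \<open>x\<^sup>\<star> * x\<close> is
  \<open>- (y\<^sup>\<star> * y)\<close> for a cut \<open>y\<close> of \<open>x\<close>. If it were
  nonzero, \<open>y\<close> could be normalised to a \<open>v\<close> with
  \<open>v\<^sup>\<star> * v = - f\<close> for a nonzero projection \<open>f\<close>. Then
  \<open>q = - (v * v\<^sup>\<star>)\<close> is a projection too, and
  \<open>pos_sum_squares_adjoint\<close> makes \<open>- (f + q)\<close> positive, which forces
  \<open>f = 0\<close>.\<close>

lemma pos_star_mult_self:
  fixes x :: "'a::aw_star_algebra"
  shows "pos (x\<^sup>\<star> * x)"
proof -
  define h where "h = x\<^sup>\<star> * x"
  have hs: "h\<^sup>\<star> = h" by (simp add: h_def star_simps)
  obtain e where e: "is_projection e" "\<And>w. w * h = h * w \<Longrightarrow> w * e = e * w"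
    "pos (h * e)" "pos (- (h * (1 - e)))"
    using spectral_projection[OF hs] by blast
  define k where "k = - (h * (1 - e))"
  define y where "y = x * (1 - e)"
  have he: "h * e = e * h" by (rule e(2)) simp
  have E: "is_projection (1 - e)" by (rule is_projection_compl[OF e(1)])
  have "y\<^sup>\<star> * y = (1 - e) * h * (1 - e)" by (simp add: y_def h_def star_mult projection_star[OF E] mult.assoc)
  also have "(1 - e) * h = h * (1 - e)" using he by (simp add: algebra_simps)
  also have "h * (1 - e) * (1 - e) = h * ((1 - e) * (1 - e))" by (rule mult.assoc)
  finally have yy: "y\<^sup>\<star> * y = - k" by (simp add: k_def projection_idem[OF E])
  have "k = 0"
  proof (rule ccontr)
    assume k0: "k \<noteq> 0"
    obtain b f where b: "is_projection f" "f \<noteq> 0" "b\<^sup>\<star> = b" "b * k * b = f" "b * f = b"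
      by (rule pos_local_inverse_sqrt[OF e(4)[folded k_def] k0])
    define v where "v = y * b"
    have "v\<^sup>\<star> * v = b * (y\<^sup>\<star> * y) * b" by (simp add: v_def star_mult b(3) mult.assoc)
    then have vv: "v\<^sup>\<star> * v = - f" by (simp add: yy b(4))
    have vf: "v * f = v" by (simp add: v_def mult.assoc b(5))
    define q where "q = - (v * v\<^sup>\<star>)"
    have "q * q = v * (v\<^sup>\<star> * v) * v\<^sup>\<star>" by (simp add: q_def mult.assoc)
    also have "\<dots> = q" by (simp add: vv vf q_def)
    finally have "is_projection q" by (simp add: is_projection_def q_def star_simps)
    moreover have "pos (- (f + q))"
      using pos_sum_squares_adjoint[of v] by (simp add: vv q_def)
    ultimately have "f = 0" using pos_sum_zero pos_projection b(1) by blast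
    then show False using b(2) by blast
  qed
  then have "h * e = h" by (simp add: k_def algebra_simps)
  then show ?thesis using e(3) by (simp add: h_def)
qed

lemma partial_isometry_of_nonzero:
  fixes x :: "'a::aw_star_algebra"
  assumes "x \<noteq> 0"
  obtains b e where "is_projection e" "e \<noteq> 0" "b\<^sup>\<star> = b" "(x * b)\<^sup>\<star> * (x * b) = e"
    "\<And>w. w * (x\<^sup>\<star> * x) = (x\<^sup>\<star> * x) * w \<Longrightarrow> w * b = b * w"
proof -
  have "x\<^sup>\<star> * x \<noteq> 0" using assms by (simp add: star_mult_self_eq_0_iff)
  then obtain b e where b: "is_projection e" "e \<noteq> 0" "b\<^sup>\<star> = b" "b * (x\<^sup>\<star> * x) * b = e"
    "\<And>w. w * (x\<^sup>\<star> * x) = (x\<^sup>\<star> * x) * w \<Longrightarrow> w * b = b * w"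
    using pos_local_inverse_sqrt[OF pos_star_mult_self] by metis
  moreover have "(x * b)\<^sup>\<star> * (x * b) = e" using b(3,4) by (simp add: star_mult mult.assoc)
  ultimately show ?thesis using that by blast
qed

section \<open>Central projections, abelian and finite projections\<close>

lemma central_is_projection: "central_projection z \<Longrightarrow> is_projection z"
  and central_commute: "central_projection z \<Longrightarrow> x * z = z * x"
  by (auto simp: central_projection_def)

lemma central_star: "central_projection z \<Longrightarrow> z\<^sup>\<star> = z"
  and central_idem: "central_projection z \<Longrightarrow> z * z = z"
  and central_idem_left: "central_projection z \<Longrightarrow> z * (z * x) = z * x"
  by (simp_all add: central_is_projection projection_star projection_idem projection_idem_left)

lemma central_left_commute: "central_projection z \<Longrightarrow> x * (z * y) = z * (x * y)"
  by (metis central_commute mult.assoc)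

lemma central_mult_mult: "central_projection z \<Longrightarrow> (z * x) * (z * y) = z * (x * y)"
  by (metis central_commute central_idem mult.assoc)

lemma central_star_mult: "central_projection z \<Longrightarrow> (z * x)\<^sup>\<star> = z * x\<^sup>\<star>"
  by (simp add: star_mult central_star central_commute)

lemma central_projection_compl: "central_projection z \<Longrightarrow> central_projection (1 - z)"
  by (auto simp: central_projection_def is_projection_compl algebra_simps)

lemma central_projection_mult: "central_projection z \<Longrightarrow> central_projection w \<Longrightarrow> central_projection (z * w)"
  unfolding central_projection_def by (metis is_projection_mult mult.assoc)

lemma is_projection_central_mult: "central_projection z \<Longrightarrow> is_projection e \<Longrightarrow> is_projection (z * e)"
  by (rule is_projection_mult) (auto simp: central_projection_def)

text \<open>The right annihilator of all \<open>x\<^sup>\<star> * y\<close> is a two-sided ideal, so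
  the projection generating it is central; \<open>z\<close> is its complement.\<close>

lemma central_support:
  fixes x :: "'a::aw_star_algebra"
  obtains z where "central_projection z" "z * x = x"
    "\<And>t. (\<And>y. x\<^sup>\<star> * (y * t) = 0) \<Longrightarrow> z * t = 0"
proof (rule support_projection[of "range (\<lambda>y. x\<^sup>\<star> * y)"])
  fix E :: 'a
  assume E: "is_projection E" "\<And>s. s \<in> range (\<lambda>y. x\<^sup>\<star> * y) \<Longrightarrow> s * E = s"
    "\<And>t. (\<And>s. s \<in> range (\<lambda>y. x\<^sup>\<star> * y) \<Longrightarrow> s * t = 0) \<Longrightarrow> E * t = 0"
    "\<And>w. (\<And>t s. (\<And>s. s \<in> range (\<lambda>y. x\<^sup>\<star> * y) \<Longrightarrow> s * t = 0) \<Longrightarrow> s \<in> range (\<lambda>y. x\<^sup>\<star> * y)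
       \<Longrightarrow> s * (w * t) = 0 \<and> s * (w\<^sup>\<star> * t) = 0) \<Longrightarrow> w * E = E * w"
  have "w * E = E * w" for w
  proof (rule E(4))
    fix t s assume *: "\<And>s. s \<in> range (\<lambda>y. x\<^sup>\<star> * y) \<Longrightarrow> s * t = 0" and s: "s \<in> range (\<lambda>y. x\<^sup>\<star> * y)"
    from s obtain y where y: "s = x\<^sup>\<star> * y" by blast
    have "x\<^sup>\<star> * (y * w) * t = 0" "x\<^sup>\<star> * (y * w\<^sup>\<star>) * t = 0" by (rule *, blast)+
    then show "s * (w * t) = 0 \<and> s * (w\<^sup>\<star> * t) = 0" by (simp add: y mult.assoc)
  qed
  then have "central_projection E" using E(1) by (simp add: central_projection_def)
  moreover have "E * x = x"
  proof -
    have "x\<^sup>\<star> * 1 * E = x\<^sup>\<star> * 1" by (rule E(2)) blast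
    then have "(x\<^sup>\<star> * E)\<^sup>\<star> = (x\<^sup>\<star>)\<^sup>\<star>" by simp
    then show ?thesis by (simp add: star_mult star_star projection_star[OF E(1)])
  qed
  moreover have "E * t = 0" if "\<And>y. x\<^sup>\<star> * (y * t) = 0" for t
    by (rule E(3)) (use that in \<open>auto simp: mult.assoc\<close>)
  ultimately show ?thesis using that by blast
qed

text \<open>That the supremum of \<open>Z\<close> is \<open>1\<close> is expressed as joint
  faithfulness, which is how it is applied: equations and norm bounds are verified piece by
  piece.\<close>

definition central_partition :: "'a::cstar_algebra set \<Rightarrow> bool" where
  "central_partition Z \<longleftrightarrow> (\<forall>z\<in>Z. central_projection z) \<and>
     (\<forall>z\<in>Z. \<forall>w\<in>Z. z \<noteq> w \<longrightarrow> z * w = 0) \<and> (\<forall>x. (\<forall>z\<in>Z. z * x = 0) \<longrightarrow> x = 0)"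

lemma central_partition_central: "central_partition Z \<Longrightarrow> z \<in> Z \<Longrightarrow> central_projection z"
  and central_partition_orth: "central_partition Z \<Longrightarrow> z \<in> Z \<Longrightarrow> w \<in> Z \<Longrightarrow> z \<noteq> w \<Longrightarrow> z * w = 0"
  and central_partition_zero: "central_partition Z \<Longrightarrow> (\<And>z. z \<in> Z \<Longrightarrow> z * x = 0) \<Longrightarrow> x = 0"
  by (auto simp: central_partition_def)

lemma central_partition_eq:
  assumes "central_partition Z" "\<And>z. z \<in> Z \<Longrightarrow> z * x = z * y"
  shows "x = y"
  using central_partition_zero[OF assms(1), of "x - y"] assms(2) by (simp add: right_diff_distrib)

text \<open>Zorn's lemma gives a maximal orthogonal family of nonzero central projections with
  \<open>Q\<close>. Its support \<open>E\<close> is central, and a nonzero \<open>1 - E\<close>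
  would contain a further member.\<close>

lemma exhaustion:
  fixes Q :: "'a::aw_star_algebra \<Rightarrow> bool"
  assumes ex: "\<And>z. central_projection z \<Longrightarrow> z \<noteq> 0 \<Longrightarrow>
    \<exists>w. central_projection w \<and> w \<noteq> 0 \<and> z * w = w \<and> Q w"
  obtains Z where "central_partition Z" "\<And>z. z \<in> Z \<Longrightarrow> Q z"
proof -
  define F where "F = {Z. (\<forall>z\<in>Z. central_projection z \<and> z \<noteq> 0 \<and> Q z) \<and> (\<forall>z\<in>Z. \<forall>w\<in>Z. z \<noteq> w \<longrightarrow> z * w = 0)}"
  have "\<exists>M\<in>F. \<forall>X\<in>F. M \<subseteq> X \<longrightarrow> X = M"
  proof (rule subset_Zorn')
    fix C assume C: "subset.chain F C"
    then have sub: "C \<subseteq> F" and ch: "\<And>X Y. X \<in> C \<Longrightarrow> Y \<in> C \<Longrightarrow> X \<subseteq> Y \<or> Y \<subseteq> X"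
      by (auto simp: subset_chain_def)
    have "z * w = 0" if z: "z \<in> \<Union>C" and w: "w \<in> \<Union>C" and ne: "z \<noteq> w" for z w
    proof -
      obtain X Y where "X \<in> C" "z \<in> X" "Y \<in> C" "w \<in> Y" using z w by blast
      then obtain W where "W \<in> C" "z \<in> W" "w \<in> W" using ch by blast
      then show ?thesis using sub ne by (auto simp: F_def)
    qed
    then show "\<Union>C \<in> F" using sub by (auto simp: F_def)
  qed
  then obtain Z where Z: "Z \<in> F" and max: "\<And>X. X \<in> F \<Longrightarrow> Z \<subseteq> X \<Longrightarrow> X = Z" by blast
  have cZ: "\<And>z. z \<in> Z \<Longrightarrow> central_projection z" and Q: "\<And>z. z \<in> Z \<Longrightarrow> Q z"
    and orth: "\<And>z w. z \<in> Z \<Longrightarrow> w \<in> Z \<Longrightarrow> z \<noteq> w \<Longrightarrow> z * w = 0"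
    using Z by (auto simp: F_def)
  have zero: "x = 0" if x: "\<And>z. z \<in> Z \<Longrightarrow> z * x = 0" for x
  proof (rule support_projection[of Z])
    fix E assume E: "is_projection E" "\<And>s. s \<in> Z \<Longrightarrow> s * E = s"
      "\<And>x. (\<And>s. s \<in> Z \<Longrightarrow> s * x = 0) \<Longrightarrow> E * x = 0"
      "\<And>w. (\<And>t s. (\<And>s. s \<in> Z \<Longrightarrow> s * t = 0) \<Longrightarrow> s \<in> Z \<Longrightarrow> s * (w * t) = 0 \<and> s * (w\<^sup>\<star> * t) = 0)
        \<Longrightarrow> w * E = E * w"
    have "w * E = E * w" for w
    proof (rule E(4))
      fix t s assume "\<And>s. s \<in> Z \<Longrightarrow> s * t = 0" "s \<in> Z"
      then show "s * (w * t) = 0 \<and> s * (w\<^sup>\<star> * t) = 0"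
        by (metis cZ central_left_commute mult_zero_right)
    qed
    then have cE: "central_projection E" using E(1) by (simp add: central_projection_def)
    show "x = 0"
    proof (rule ccontr)
      assume "x \<noteq> 0"
      moreover have "E * x = 0" using E(3) x by blast
      ultimately have "1 - E \<noteq> 0" by auto
      then obtain w where w: "central_projection w" "w \<noteq> 0" "(1 - E) * w = w" "Q w"
        using ex[OF central_projection_compl[OF cE]] by blast
      have zw: "z * w = 0" if "z \<in> Z" for z
      proof -
        have "z * (1 - E) = 0" using E(2)[OF that] by (simp add: algebra_simps)
        then show ?thesis by (metis w(3) mult.assoc mult_zero_left)
      qed
      moreover have "w * z = 0" if "z \<in> Z" for z
        using zw[OF that] by (simp add: central_commute[OF w(1)])
      ultimately have "insert w Z \<in> F" using Z w by (auto simp: F_def)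
      then have "w \<in> Z" using max by blast
      then show False using zw w(2) central_idem[OF w(1)] by force
    qed
  qed
  have "central_partition Z" unfolding central_partition_def using cZ orth zero by blast
  then show ?thesis using Q by (rule that)
qed

text \<open>\<open>P\<close> is the supremum of the \<open>z * p z\<close>. It has no part in
  \<open>z * (1 - p z)\<close>, because each \<open>w * p w\<close> annihilates that element: for
  \<open>w = z\<close> as \<open>p z\<close> is a projection, otherwise by orthogonality of the
  pieces.\<close>

lemma glue_projections:
  fixes Z :: "'a::aw_star_algebra set"
  assumes Z: "central_partition Z" and p: "\<And>z. z \<in> Z \<Longrightarrow> is_projection (p z)"
  obtains P where "is_projection P" "\<And>z. z \<in> Z \<Longrightarrow> z * P = z * p z"
proof -
  note cZ = central_partition_central[OF Z]
  have pr: "is_projection (z * p z)" if "z \<in> Z" for z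
    by (rule is_projection_central_mult[OF cZ p]) (use that in auto)
  obtain P where P: "is_projection P" "\<And>s. s \<in> (\<lambda>z. z * p z) ` Z \<Longrightarrow> s * P = s"
    "\<And>s. s \<in> (\<lambda>z. z * p z) ` Z \<Longrightarrow> P * s = s"
    "\<And>x. (\<And>s. s \<in> (\<lambda>z. z * p z) ` Z \<Longrightarrow> s * x = 0) \<Longrightarrow> P * x = 0"
    using support_projection_of_set_of_projections[of "(\<lambda>z. z * p z) ` Z"] pr by blast
  have "z * P = z * p z" if z: "z \<in> Z" for z
  proof -
    have "P * (z * (1 - p z)) = 0"
    proof (rule P(4))
      fix s assume "s \<in> (\<lambda>z. z * p z) ` Z"
      then obtain w where w: "w \<in> Z" "s = w * p w" by blast
      have "s * (z * (1 - p z)) = z * (w * (p w * (1 - p z)))"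
        by (simp only: w(2) mult.assoc central_left_commute[OF cZ[OF z], of "p w"]
          central_left_commute[OF cZ[OF z], of w])
      also have "\<dots> = 0"
      proof (cases "w = z")
        case True
        then show ?thesis using projection_idem[OF p[OF z]] by (simp add: right_diff_distrib)
      next
        case False
        then show ?thesis using central_partition_orth[OF Z z w(1)] by (simp add: mult.assoc[symmetric])
      qed
      finally show "s * (z * (1 - p z)) = 0" .
    qed
    then have "P * z = P * (z * p z)" by (simp add: algebra_simps)
    also have "\<dots> = z * p z" using P(3) z by blast
    finally show ?thesis using central_commute[OF cZ[OF z]] by simp
  qed
  then show ?thesis using that P(1) by blast
qed

text \<open>Let \<open>e\<close> be the spectral projection of
  \<open>h = x\<^sup>\<star> * x\<close> for the values above \<open>r\<^sup>2\<close>. On a piece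
  \<open>z\<close>, the element \<open>h * e - r\<^sup>2 *\<^sub>R e\<close> is positive by the
  choice of \<open>e\<close> and negative by the bound on \<open>z * x\<close>. It vanishes on every
  piece, hence altogether.\<close>

lemma norm_le_if_central_partition:
  fixes x :: "'a::aw_star_algebra"
  assumes Z: "central_partition Z" and le: "\<And>z. z \<in> Z \<Longrightarrow> norm (z * x) \<le> r" and r: "0 \<le> r"
  shows "norm x \<le> r"
proof -
  note cZ = central_partition_central[OF Z]
  define h where "h = x\<^sup>\<star> * x"
  have ph: "pos h" unfolding h_def by (rule pos_star_mult_self)
  note hs = pos_star[OF ph]
  obtain e where e: "is_projection e" "\<And>w. w * h = h * w \<Longrightarrow> w * e = e * w"
    "pos (h * e - r\<^sup>2 *\<^sub>R e)" "pos (r\<^sup>2 *\<^sub>R (1 - e) - h * (1 - e))"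
    using spectral_projection_level[OF hs] by blast
  have he: "h * e = e * h" by (rule e(2)) simp
  have "h * e - r\<^sup>2 *\<^sub>R e = 0"
  proof (rule central_partition_zero[OF Z])
    fix z assume z: "z \<in> Z"
    note c = cZ[OF z] note pz = central_is_projection[OF c]
    have "(z * x)\<^sup>\<star> * (z * x) = z * h"
      by (simp add: central_star_mult[OF c] central_mult_mult[OF c] h_def)
    then have "norm (z * h) = (norm (z * x))\<^sup>2" by (metis cstar_identity)
    then have nz: "norm (z * h) \<le> r\<^sup>2" using le[OF z] r by (simp add: power_mono)
    have "(z * h)\<^sup>\<star> = z * h" by (simp add: central_star_mult[OF c] hs)
    then have "pos (r\<^sup>2 *\<^sub>R 1 - z * h)" using nz by (rule pos_diff_if_norm_le)
    then have "pos ((r\<^sup>2 *\<^sub>R 1 - z * h) * (z * e))"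
      by (rule pos_mult_projection[OF _ is_projection_central_mult[OF c e(1)]])
        (simp add: left_diff_distrib right_diff_distrib central_mult_mult[OF c] he)
    moreover have "(r\<^sup>2 *\<^sub>R 1 - z * h) * (z * e) = - (z * (h * e - r\<^sup>2 *\<^sub>R e))"
      by (simp add: left_diff_distrib right_diff_distrib central_mult_mult[OF c])
    ultimately have "pos (- (z * (h * e - r\<^sup>2 *\<^sub>R e)))" by simp
    moreover have "pos ((h * e - r\<^sup>2 *\<^sub>R e) * z)"
      by (rule pos_mult_projection[OF e(3) pz central_commute[OF c]])
    ultimately show "z * (h * e - r\<^sup>2 *\<^sub>R e) = 0"
      using pos_antisym by (simp add: central_commute[OF c])
  qed
  then have "r\<^sup>2 *\<^sub>R (1 - e) - h * (1 - e) = r\<^sup>2 *\<^sub>R 1 - h" by (simp add: algebra_simps)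
  then have "norm h \<le> r\<^sup>2" using norm_le_if_pos[OF ph] e(4) by simp
  then show ?thesis using r by (simp add: h_def cstar_identity power2_le_iff_abs_le)
qed

section \<open>Abelian projections and partial isometries\<close>

lemma abelian_is_projection: "abelian_projection f \<Longrightarrow> is_projection f"
  by (simp add: abelian_projection_def)

lemma abelian_projection_commute:
  assumes "abelian_projection f" "f * x = x" "x * f = x" "f * y = y" "y * f = y"
  shows "x * y = y * x"
  using assms unfolding abelian_projection_def by (metis mult.assoc)

lemma abelian_projection_0 [simp]: "abelian_projection 0"
  by (simp add: abelian_projection_def)

text \<open>\<open>z\<close> is the central support of \<open>e\<close>. For
  \<open>t = z * f - e\<close>, commutativity of the corner of \<open>f\<close> turns
  \<open>e * y * t\<close> into \<open>f * y * f * e * t\<close>, which is 0 for all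
  \<open>y\<close>. Hence \<open>z\<close> annihilates \<open>t\<close>, although
  \<open>z * t = t\<close>.\<close>

lemma subprojection_of_abelian:
  fixes f :: "'a::aw_star_algebra"
  assumes f: "abelian_projection f" and e: "is_projection e" "e * f = e"
  obtains z where "central_projection z" "e = z * f"
proof -
  obtain z where z: "central_projection z" "z * e = e" "\<And>t. (\<And>y. e\<^sup>\<star> * (y * t) = 0) \<Longrightarrow> z * t = 0"
    using central_support by blast
  note pf = abelian_is_projection[OF f]
  have fe: "f * e = e" by (rule projection_le_commute[OF e(1) pf e(2)])
  have ff: "f * f = f" by (rule projection_idem[OF pf])
  define t where "t = z * f - e"
  have ft: "f * t = t" using ff by (simp add: t_def right_diff_distrib fe central_left_commute[OF z(1), of f])
  have et: "e * t = 0"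
    by (simp add: t_def right_diff_distrib central_left_commute[OF z(1), of e] e(2) z(2) projection_idem[OF e(1)])
  have "e\<^sup>\<star> * (y * t) = 0" for y
  proof -
    have "e * (f * y * f) = (f * y * f) * e"
      by (rule abelian_projection_commute[OF f]) (simp_all add: fe e(2) ff mult.assoc mult_assoc_rewrite[OF ff])
    then have "e * (f * y * f) * t = f * y * f * (e * t)" by (simp add: mult.assoc)
    then have "e * (f * y * f) * t = 0" by (simp add: et)
    then have "e * (y * t) = 0" by (simp add: mult.assoc ft mult_assoc_rewrite[OF e(2)])
    then show ?thesis by (simp add: projection_star[OF e(1)])
  qed
  then have "z * t = 0" by (rule z(3))
  then have "e = z * f" by (simp add: t_def right_diff_distrib z(2) central_idem_left[OF z(1)])
  then show ?thesis using that z(1) by blast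
qed

lemma abelian_projection_central_mult:
  assumes "abelian_projection f" "central_projection z"
  shows "abelian_projection (z * f)"
  unfolding abelian_projection_def
proof (intro conjI allI)
  note f = abelian_is_projection[OF assms(1)]
  show "is_projection (z * f)" by (rule is_projection_central_mult[OF assms(2) f])
  fix x y
  have zf: "z * f * w * (z * f) = f * (z * w) * f" for w
  proof -
    have "z * f * w * (z * f) = (z * (f * w)) * (z * f)" by (simp only: mult.assoc)
    also have "\<dots> = z * (f * w * f)" by (rule central_mult_mult[OF assms(2)])
    finally show ?thesis by (simp only: mult.assoc central_left_commute[OF assms(2), of f])
  qed
  show "z * f * x * (z * f) * (z * f * y * (z * f)) = z * f * y * (z * f) * (z * f * x * (z * f))"
    using assms(1) unfolding zf abelian_projection_def by blast
qed

lemma partial_isometry_mult: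
  fixes v :: "'a::cstar_algebra"
  assumes "is_projection (v\<^sup>\<star> * v)"
  shows "v * (v\<^sup>\<star> * v) = v"
proof -
  define e where "e = v\<^sup>\<star> * v"
  have e: "e\<^sup>\<star> = e" "e * e = e" using assms by (auto simp: e_def is_projection_def)
  have "(v - v * e)\<^sup>\<star> * (v - v * e) = v\<^sup>\<star> * v - v\<^sup>\<star> * v * e - e * (v\<^sup>\<star> * v) + e * (v\<^sup>\<star> * v) * e"
    by (simp add: star_simps e(1) algebra_simps)
  also have "\<dots> = 0" by (simp add: e_def[symmetric] e(2))
  finally show ?thesis by (simp add: star_mult_self_eq_0_iff e_def)
qed

lemma range_projection_of_partial_isometry:
  fixes v :: "'a::cstar_algebra"
  assumes "is_projection (v\<^sup>\<star> * v)"
  shows "is_projection (v * v\<^sup>\<star>)"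
proof -
  have "v * v\<^sup>\<star> * (v * v\<^sup>\<star>) = v * (v\<^sup>\<star> * v) * v\<^sup>\<star>" by (simp add: mult.assoc)
  then show ?thesis by (simp add: is_projection_def star_simps partial_isometry_mult[OF assms])
qed

text \<open>Conjugation by \<open>v\<close> carries products in the corner of
  \<open>v * v\<^sup>\<star>\<close> to products in the commutative corner of
  \<open>g\<close>.\<close>

lemma abelian_range_projection:
  fixes v :: "'a::cstar_algebra"
  assumes g: "abelian_projection g" and v: "is_projection (v\<^sup>\<star> * v)" "v * g = v"
  shows "abelian_projection (v * v\<^sup>\<star>)"
  unfolding abelian_projection_def
proof (intro conjI allI)
  show "is_projection (v * v\<^sup>\<star>)" by (rule range_projection_of_partial_isometry[OF v(1)])
  note vv = partial_isometry_mult[OF v(1)]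
  have gv: "g * v\<^sup>\<star> = v\<^sup>\<star>" using arg_cong[OF v(2), of star] projection_star[OF abelian_is_projection[OF g]]
    by (simp add: star_mult)
  fix x y
  have eq: "v * v\<^sup>\<star> * a * (v * v\<^sup>\<star>) * (v * v\<^sup>\<star> * b * (v * v\<^sup>\<star>)) = v * ((v\<^sup>\<star> * a * v) * (v\<^sup>\<star> * b * v)) * v\<^sup>\<star>" for a b
  proof -
    have "v * v\<^sup>\<star> * a * (v * v\<^sup>\<star>) * (v * v\<^sup>\<star> * b * (v * v\<^sup>\<star>))
      = v * (v\<^sup>\<star> * a) * (v * (v\<^sup>\<star> * v)) * (v\<^sup>\<star> * b * (v * v\<^sup>\<star>))" by (simp only: mult.assoc)
    then show ?thesis by (simp only: vv) (simp only: mult.assoc)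
  qed
  have "(v\<^sup>\<star> * x * v) * (v\<^sup>\<star> * y * v) = (v\<^sup>\<star> * y * v) * (v\<^sup>\<star> * x * v)"
    by (rule abelian_projection_commute[OF g]) (simp_all add: mult.assoc v(2) mult_assoc_rewrite[OF gv])
  then show "v * v\<^sup>\<star> * x * (v * v\<^sup>\<star>) * (v * v\<^sup>\<star> * y * (v * v\<^sup>\<star>)) = v * v\<^sup>\<star> * y * (v * v\<^sup>\<star>) * (v * v\<^sup>\<star> * x * (v * v\<^sup>\<star>))"
    unfolding eq by simp
qed

text \<open>As \<open>x\<^sup>\<star> * x\<close> lies in the corner of \<open>g\<close>, the
  normalising \<open>b\<close> commutes with \<open>g\<close> and the initial projection of
  \<open>x * b\<close> is a subprojection of \<open>g\<close>, that is, a central cut of it.\<close>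

lemma partial_isometry_into:
  fixes g :: "'a::aw_star_algebra"
  assumes g: "abelian_projection g" and x: "x \<noteq> 0" "x * g = x"
  obtains z b where "central_projection z" "z * g \<noteq> 0" "(x * b)\<^sup>\<star> * (x * b) = z * g" "x * b * g = x * b"
    "b * g = g * b"
proof -
  obtain b e where b: "is_projection e" "e \<noteq> 0" "b\<^sup>\<star> = b" "(x * b)\<^sup>\<star> * (x * b) = e"
    "\<And>w. w * (x\<^sup>\<star> * x) = (x\<^sup>\<star> * x) * w \<Longrightarrow> w * b = b * w"
    by (rule partial_isometry_of_nonzero[OF x(1)]) (rule that)
  note gs = projection_star[OF abelian_is_projection[OF g]]
  have gx: "g * x\<^sup>\<star> = x\<^sup>\<star>" using arg_cong[OF x(2), of star] by (simp add: star_mult gs)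
  have gb: "g * b = b * g" by (rule b(5)) (simp add: mult.assoc x(2) mult_assoc_rewrite[OF gx])
  have xbg: "x * b * g = x * b" by (simp add: mult.assoc gb[symmetric] mult_assoc_rewrite[OF x(2)])
  have "e * g = e" using b(4) xbg by (metis mult.assoc)
  then obtain z where "central_projection z" "e = z * g" using subprojection_of_abelian[OF g b(1)] by blast
  then show ?thesis using that[of z b] b xbg gb by metis
qed

text \<open>An abelian \<open>g\<close> of central support \<open>1\<close> satisfies
  \<open>e * y\<^sup>\<star> * g \<noteq> 0\<close> for some \<open>y\<close>. Normalising this
  element yields a partial isometry whose range projection is abelian and lies below
  \<open>e\<close>.\<close>

lemma abelian_below_discrete:
  fixes e :: "'a::aw_star_algebra"
  assumes d: "discrete_algebra TYPE('a)" and e: "is_projection e" "e \<noteq> 0"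
  obtains h where "abelian_projection h" "h \<noteq> 0" "h * e = h" "e * h = h"
proof -
  obtain g :: 'a where g: "abelian_projection g" "has_central_support g 1"
    using d by (auto simp: discrete_algebra_def)
  note pg = abelian_is_projection[OF g(1)]
  obtain z where z: "central_projection z" "z * g = g" "\<And>t. (\<And>y. g\<^sup>\<star> * (y * t) = 0) \<Longrightarrow> z * t = 0"
    using central_support by blast
  have "g * z = g" using z(1,2) by (metis central_commute)
  then have "z = 1" using g(2) z(1) by (auto simp: has_central_support_def proj_le_def)
  then obtain y where y: "g * (y * e) \<noteq> 0" using z(3)[of e] e(2) projection_star[OF pg] by auto
  define x where "x = e * (y\<^sup>\<star> * g)"
  have "x\<^sup>\<star> = g * (y * e)"
    by (simp add: x_def star_mult projection_star[OF pg] projection_star[OF e(1)] star_star mult.assoc)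
  then have x0: "x \<noteq> 0" using y by auto
  have xg: "x * g = x" by (simp add: x_def mult.assoc projection_idem[OF pg])
  have ex: "e * x = x" by (simp add: x_def projection_idem_left[OF e(1)])
  obtain w b where b: "central_projection w" "w * g \<noteq> 0" "(x * b)\<^sup>\<star> * (x * b) = w * g" "x * b * g = x * b"
    by (rule partial_isometry_into[OF g(1) x0 xg])
  define v where "v = x * b"
  have pv: "is_projection (v\<^sup>\<star> * v)" unfolding v_def b(3) by (rule is_projection_central_mult[OF b(1) pg])
  have ab: "abelian_projection (v * v\<^sup>\<star>)"
    by (rule abelian_range_projection[OF g(1) pv]) (simp add: v_def b(4))
  have ev: "e * (v * v\<^sup>\<star>) = v * v\<^sup>\<star>" by (simp add: v_def mult.assoc mult_assoc_rewrite[OF ex])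
  moreover have "v * v\<^sup>\<star> * e = v * v\<^sup>\<star>"
    using arg_cong[OF ev, of star] by (simp add: star_mult star_star projection_star[OF e(1)] mult.assoc)
  moreover have "v * v\<^sup>\<star> \<noteq> 0"
  proof
    assume "v * v\<^sup>\<star> = 0"
    then have "v\<^sup>\<star> = 0" using star_mult_self_eq_0_iff[of "v\<^sup>\<star>"] by (simp add: star_star)
    then show False using b(2,3) by (simp add: v_def)
  qed
  ultimately show ?thesis using that ab by blast
qed

section \<open>Finite projections\<close>

lemma finite_is_projection: "finite_projection f \<Longrightarrow> is_projection f"
  by (simp add: finite_projection_def)

lemma finite_projectionI:
  assumes "is_projection e" "\<And>v. v\<^sup>\<star> * v = e \<Longrightarrow> is_projection (v * v\<^sup>\<star>) \<Longrightarrow> v * v\<^sup>\<star> * e = v * v\<^sup>\<star> \<Longrightarrow> v * v\<^sup>\<star> = e"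
  shows "finite_projection e"
  using assms by (auto simp: finite_projection_def proj_equiv_def proj_le_def)

lemma finite_projectionD:
  assumes "finite_projection e" "v\<^sup>\<star> * v = e" "v * v\<^sup>\<star> * e = v * v\<^sup>\<star>"
  shows "v * v\<^sup>\<star> = e"
proof -
  have "is_projection (v * v\<^sup>\<star>)"
    using range_projection_of_partial_isometry assms finite_is_projection by metis
  moreover have "proj_equiv e (v * v\<^sup>\<star>)" unfolding proj_equiv_def using assms(2) by metis
  ultimately show ?thesis using assms(1,3) unfolding finite_projection_def proj_le_def by blast
qed

lemma abelian_imp_finite:
  assumes g: "abelian_projection g"
  shows "finite_projection g"
proof (rule finite_projectionI)
  show pg: "is_projection g" by (rule abelian_is_projection[OF g])
  fix v assume v: "v\<^sup>\<star> * v = g" "is_projection (v * v\<^sup>\<star>)" "v * v\<^sup>\<star> * g = v * v\<^sup>\<star>"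
  have vg: "v * g = v" using partial_isometry_mult[of v] v(1) pg by simp
  have gq: "g * (v * v\<^sup>\<star>) = v * v\<^sup>\<star>" by (rule projection_le_commute[OF v(2) pg v(3)])
  have "v * v\<^sup>\<star> * v = v" using vg v(1) by (simp add: mult.assoc)
  then have gv: "g * v = v" by (metis gq mult.assoc)
  have gvs: "g * v\<^sup>\<star> = v\<^sup>\<star>" "v\<^sup>\<star> * g = v\<^sup>\<star>"
    using arg_cong[OF vg, of star] arg_cong[OF gv, of star] by (simp_all add: star_mult projection_star[OF pg])
  show "v * v\<^sup>\<star> = g" using abelian_projection_commute[OF g gv vg gvs] v(1) by simp
qed

text \<open>Adding \<open>f - e\<close> to \<open>v\<close> gives a \<open>u\<close> with
  \<open>u\<^sup>\<star> * u = f\<close>, and finiteness of \<open>f\<close> makes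
  \<open>u * u\<^sup>\<star> = f\<close>, which is \<open>v * v\<^sup>\<star> = e\<close>.\<close>

lemma finite_subprojection:
  assumes f: "finite_projection f" and e: "is_projection e" "e * f = e"
  shows "finite_projection e"
proof (rule finite_projectionI[OF e(1)])
  fix v assume v: "v\<^sup>\<star> * v = e" "is_projection (v * v\<^sup>\<star>)" "v * v\<^sup>\<star> * e = v * v\<^sup>\<star>"
  note pf = finite_is_projection[OF f]
  have fe: "f * e = e" by (rule projection_le_commute[OF e(1) pf e(2)])
  have ve: "v * e = v" using partial_isometry_mult[of v] v(1) e(1) by simp
  have eq: "e * (v * v\<^sup>\<star>) = v * v\<^sup>\<star>" by (rule projection_le_commute[OF v(2) e(1) v(3)])
  have "v * v\<^sup>\<star> * v = v" using ve v(1) by (simp add: mult.assoc)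
  then have ev: "e * v = v" by (metis eq mult.assoc)
  have fv: "f * v = v" by (metis ev fe mult.assoc)
  have vf: "v * f = v" by (metis ve e(2) mult.assoc)
  have s: "v\<^sup>\<star> * e = v\<^sup>\<star>" "v\<^sup>\<star> * f = v\<^sup>\<star>" "e * v\<^sup>\<star> = v\<^sup>\<star>" "f * v\<^sup>\<star> = v\<^sup>\<star>"
    using arg_cong[OF ev, of star] arg_cong[OF fv, of star] arg_cong[OF ve, of star] arg_cong[OF vf, of star]
    by (simp_all add: star_mult projection_star[OF pf] projection_star[OF e(1)])
  define u where "u = v + (f - e)"
  have us: "u\<^sup>\<star> = v\<^sup>\<star> + (f - e)" by (simp add: u_def star_simps projection_star[OF pf] projection_star[OF e(1)])
  note r = ve ev fv vf s fe e(2) projection_idem[OF pf] projection_idem[OF e(1)]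
  have 1: "u\<^sup>\<star> * u = f" unfolding us unfolding u_def by (simp add: algebra_simps r v(1))
  have 2: "u * u\<^sup>\<star> = v * v\<^sup>\<star> + (f - e)" unfolding us unfolding u_def by (simp add: algebra_simps r)
  have "u * u\<^sup>\<star> = f"
    by (rule finite_projectionD[OF f 1]) (simp add: 2 distrib_right left_diff_distrib mult.assoc r)
  then show "v * v\<^sup>\<star> = e" using 2 by (simp add: algebra_simps)
qed

lemma finite_projection_conj:
  assumes f: "finite_projection f" and u: "u\<^sup>\<star> * u = 1" "u * u\<^sup>\<star> = 1"
  shows "finite_projection (u * f * u\<^sup>\<star>)"
proof (rule finite_projectionI)
  note pf = finite_is_projection[OF f]
  note ua = mult_assoc_rewrite[OF u(1)] mult_assoc_rewrite[OF u(2)]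
  show "is_projection (u * f * u\<^sup>\<star>)"
    by (simp add: is_projection_def star_simps projection_star[OF pf] mult.assoc ua projection_idem_left[OF pf])
  fix v assume v: "v\<^sup>\<star> * v = u * f * u\<^sup>\<star>" "v * v\<^sup>\<star> * (u * f * u\<^sup>\<star>) = v * v\<^sup>\<star>"
  define w where "w = u\<^sup>\<star> * v * u"
  have ws: "w\<^sup>\<star> = u\<^sup>\<star> * v\<^sup>\<star> * u" by (simp add: w_def star_simps mult.assoc)
  have "w\<^sup>\<star> * w = u\<^sup>\<star> * (v\<^sup>\<star> * v) * u" unfolding ws unfolding w_def by (simp add: mult.assoc ua)
  also have "\<dots> = f" by (simp add: v(1) mult.assoc ua u)
  finally have 1: "w\<^sup>\<star> * w = f" .
  have ww: "w * w\<^sup>\<star> = u\<^sup>\<star> * (v * v\<^sup>\<star>) * u" unfolding ws unfolding w_def by (simp add: mult.assoc ua)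
  have "w * w\<^sup>\<star> * f = u\<^sup>\<star> * (v * v\<^sup>\<star> * (u * f * u\<^sup>\<star>)) * u" unfolding ww by (simp add: mult.assoc ua u)
  then have "w * w\<^sup>\<star> * f = w * w\<^sup>\<star>" unfolding v(2) ww by simp
  then have "u\<^sup>\<star> * (v * v\<^sup>\<star>) * u = f" using finite_projectionD[OF f 1] ww by simp
  then have "u * (u\<^sup>\<star> * (v * v\<^sup>\<star>) * u) * u\<^sup>\<star> = u * f * u\<^sup>\<star>" by simp
  then show "v * v\<^sup>\<star> = u * f * u\<^sup>\<star>" by (simp add: mult.assoc ua u)
qed

text \<open>The equation \<open>v * v\<^sup>\<star> = e\<close> may be verified on the pieces. This
  locality carries finiteness through \<open>masa_projection_glue\<close>.\<close>

lemma finite_projection_central_partition: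
  fixes e :: "'a::aw_star_algebra"
  assumes Z: "central_partition Z" and e: "is_projection e" and fin: "\<And>z. z \<in> Z \<Longrightarrow> finite_projection (z * e)"
  shows "finite_projection e"
proof (rule finite_projectionI[OF e])
  fix v assume v: "v\<^sup>\<star> * v = e" "v * v\<^sup>\<star> * e = v * v\<^sup>\<star>"
  show "v * v\<^sup>\<star> = e"
  proof (rule central_partition_eq[OF Z])
    fix z assume z: "z \<in> Z"
    note c = central_partition_central[OF Z z]
    note cs = central_star_mult[OF c] central_mult_mult[OF c]
    have 1: "(z * v)\<^sup>\<star> * (z * v) = z * e" using v(1) by (simp add: cs)
    have 2: "z * v * (z * v)\<^sup>\<star> = z * (v * v\<^sup>\<star>)" by (simp add: cs)
    have "z * v * (z * v)\<^sup>\<star> * (z * e) = z * v * (z * v)\<^sup>\<star>" unfolding 2 using v(2) by (simp add: cs)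
    from finite_projectionD[OF fin[OF z] 1 this] show "z * (v * v\<^sup>\<star>) = z * e" by (simp add: 2)
  qed
qed

section \<open>Comparison and rank\<close>

text \<open>The supremum described by annihilators, the form in which it arises and is applied;
  \<open>projection_sup_le\<close> recovers that it is the least upper bound.\<close>

definition projection_sup :: "'a::cstar_algebra set \<Rightarrow> 'a \<Rightarrow> bool" where
  "projection_sup S E \<longleftrightarrow> is_projection E \<and> (\<forall>s\<in>S. s * E = s) \<and> (\<forall>x. (\<forall>s\<in>S. s * x = 0) \<longrightarrow> E * x = 0)"

lemma projection_sup_exists:
  fixes S :: "'a::aw_star_algebra set"
  assumes "\<And>s. s \<in> S \<Longrightarrow> is_projection s"
  obtains E where "projection_sup S E"
proof (rule support_projection_of_set_of_projections[OF assms])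
  fix E assume "is_projection E" "\<And>s. s \<in> S \<Longrightarrow> s * E = s" "\<And>s. s \<in> S \<Longrightarrow> E * s = s"
    "\<And>x. (\<And>s. s \<in> S \<Longrightarrow> s * x = 0) \<Longrightarrow> E * x = 0"
  then show thesis using that[of E] by (auto simp: projection_sup_def)
qed

text \<open>The projections \<open>g\<^sub>i = (e\<^sub>i + f\<^sub>i + v\<^sub>i + v\<^sub>i\<^sup>\<star>)/2\<close> onto the graphs of the \<open>v\<^sub>i\<close> are orthogonal;
  the sum of the \<open>v\<^sub>i\<close> is read off from the supremum \<open>G\<close> of the \<open>g\<^sub>i\<close> as \<open>2 F G E\<close>.\<close>

lemma add_partial_isometries:
  fixes v :: "'i \<Rightarrow> 'a::aw_star_algebra"
  assumes e: "\<And>i. i \<in> I \<Longrightarrow> is_projection ((v i)\<^sup>\<star> * v i)"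
    and ee: "\<And>i j. i \<in> I \<Longrightarrow> j \<in> I \<Longrightarrow> i \<noteq> j \<Longrightarrow> ((v i)\<^sup>\<star> * v i) * ((v j)\<^sup>\<star> * v j) = 0"
    and ff: "\<And>i j. i \<in> I \<Longrightarrow> j \<in> I \<Longrightarrow> i \<noteq> j \<Longrightarrow> (v i * (v i)\<^sup>\<star>) * (v j * (v j)\<^sup>\<star>) = 0"
    and ef: "\<And>i j. i \<in> I \<Longrightarrow> j \<in> I \<Longrightarrow> ((v i)\<^sup>\<star> * v i) * (v j * (v j)\<^sup>\<star>) = 0"
    and E: "projection_sup ((\<lambda>i. (v i)\<^sup>\<star> * v i) ` I) E"
    and F: "projection_sup ((\<lambda>i. v i * (v i)\<^sup>\<star>) ` I) F"
  obtains V where "V\<^sup>\<star> * V = E" "V * V\<^sup>\<star> = F"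
proof -
  define w where "w i = (v i)\<^sup>\<star>" for i
  have vw: "v i * (w i * v i) = v i" if "i \<in> I" for i
    using partial_isometry_mult[OF e[OF that]] by (simp add: w_def)
  have ws: "(w i)\<^sup>\<star> = v i" "(v i)\<^sup>\<star> = w i" for i by (simp_all add: w_def star_star)
  have wv: "w i * (v i * w i) = w i" if "i \<in> I" for i
    using arg_cong[OF vw[OF that], of star] by (simp add: star_mult ws mult.assoc)
  have v0: "v i * v j = 0" if "i \<in> I" "j \<in> I" for i j
  proof -
    have "v i * v j = v i * ((w i * v i) * (v j * w j)) * v j" using vw that by (simp add: mult.assoc) (metis mult.assoc)
    then show ?thesis using ef[OF that] by (simp add: w_def)
  qed
  have w0: "w i * w j = 0" if "i \<in> I" "j \<in> I" for i j
    using arg_cong[OF v0[OF that(2,1)], of star] by (simp add: star_mult ws)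
  have wv0: "w i * v j = 0" if "i \<in> I" "j \<in> I" "i \<noteq> j" for i j
  proof -
    have "w i * v j = w i * ((v i * w i) * (v j * w j)) * v j"
      using vw[OF that(2)] wv[OF that(1)] by (simp add: mult.assoc) (metis mult.assoc)
    then show ?thesis using ff[OF that] by (simp add: w_def)
  qed
  have vw0: "v i * w j = 0" if "i \<in> I" "j \<in> I" "i \<noteq> j" for i j
  proof -
    have "v i * w j = v i * ((w i * v i) * (w j * v j)) * w j"
      using vw[OF that(1)] wv[OF that(2)] by (simp add: mult.assoc) (metis mult.assoc)
    then show ?thesis using ee[OF that] by (simp add: w_def)
  qed
  \<comment> \<open>The relations of 2-by-2 matrix units for each \<open>i\<close>, mutually
    orthogonal for different \<open>i\<close>.\<close>
  note rules = mult.assoc vw wv v0 w0 wv0 vw0 mult_assoc_rewrite[OF vw, unfolded mult.assoc]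
    mult_assoc_rewrite[OF wv, unfolded mult.assoc] mult_assoc_rewrite[OF v0] mult_assoc_rewrite[OF w0]
    mult_assoc_rewrite[OF wv0] mult_assoc_rewrite[OF vw0] ws star_simps
  define g where "g i = (1/2) *\<^sub>R (w i * v i + v i * w i + v i + w i)" for i
  have pg: "is_projection (g i)" if "i \<in> I" for i
  proof -
    have "(w i * v i + v i * w i + v i + w i) * (w i * v i + v i * w i + v i + w i)
      = 2 *\<^sub>R (w i * v i + v i * w i + v i + w i)"
      using that by (simp add: distrib_left distrib_right rules scaleR_2)
    then show ?thesis by (simp add: is_projection_def g_def rules ac_simps)
  qed
  obtain G where G: "projection_sup (g ` I) G" by (rule projection_sup_exists[of "g ` I"]) (use pg in auto)
  have pE: "is_projection E" and pF: "is_projection F" and pG: "is_projection G"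
    using E F G by (auto simp: projection_sup_def)
  have eE: "w i * v i * E = w i * v i" "E * (w i * v i) = w i * v i" if "i \<in> I" for i
  proof -
    show *: "w i * v i * E = w i * v i" using E that by (auto simp: projection_sup_def w_def)
    show "E * (w i * v i) = w i * v i" using arg_cong[OF *, of star] by (simp add: star_mult ws projection_star[OF pE])
  qed
  have fF: "v i * w i * F = v i * w i" "F * (v i * w i) = v i * w i" if "i \<in> I" for i
  proof -
    show *: "v i * w i * F = v i * w i" using F that by (auto simp: projection_sup_def w_def)
    show "F * (v i * w i) = v i * w i" using arg_cong[OF *, of star] by (simp add: star_mult ws projection_star[OF pF])
  qed
  have E0: "E * x = 0" if "\<And>i. i \<in> I \<Longrightarrow> w i * v i * x = 0" for x
    using E that by (auto simp: projection_sup_def w_def)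
  have F0: "F * x = 0" if "\<And>i. i \<in> I \<Longrightarrow> v i * w i * x = 0" for x
    using F that by (auto simp: projection_sup_def w_def)
  \<comment> \<open>The difference of the two summands' total and \<open>g n\<close> is annihilated
    by every \<open>g i\<close>, hence by \<open>G\<close>; so \<open>G\<close> compresses the total
    to \<open>g n\<close>.\<close>
  have Gg: "G * (w n * v n + v n * w n) = g n" if n: "n \<in> I" for n
  proof -
    have "G * (w n * v n + v n * w n - g n) = 0"
    proof -
      have "g i * (w n * v n + v n * w n - g n) = 0" if i: "i \<in> I" for i
      proof (cases "i = n")
        case True
        have "g n * (w n * v n + v n * w n) = g n"
          using n by (simp add: g_def distrib_left distrib_right rules) (simp add: ac_simps scaleR_right_distrib)
        then show ?thesis using True projection_idem[OF pg[OF n]] by (simp add: right_diff_distrib)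
      next
        case False
        then show ?thesis using n i
          by (simp add: g_def distrib_left distrib_right right_diff_distrib rules)
      qed
      then show ?thesis using G by (auto simp: projection_sup_def)
    qed
    moreover have "g n * G = g n" using G n by (auto simp: projection_sup_def)
    then have "G * g n = g n" by (rule projection_le_commute[OF pg[OF n] pG])
    ultimately show ?thesis by (simp add: right_diff_distrib)
  qed
  \<comment> \<open>The factor 2 cancels the \<open>1/2\<close> in \<open>g n\<close>, whose corner
    from \<open>w n * v n\<close> to \<open>v n * w n\<close> is half of \<open>v n\<close>.\<close>
  define V where "V = 2 *\<^sub>R (F * G * E)"
  have Fv: "F * v n = v n" if n: "n \<in> I" for n
    using vw[OF n] fF(2)[OF n] by (metis mult.assoc)
  have Vs: "V\<^sup>\<star> = 2 *\<^sub>R (E * G * F)"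
    by (simp add: V_def star_simps projection_star[OF pE] projection_star[OF pF] projection_star[OF pG] mult.assoc)
  have Ev: "E * w n = w n" if n: "n \<in> I" for n
    using wv[OF n] eE(2)[OF n] by (metis mult.assoc)
  have Ve: "V * (w n * v n) = v n" if n: "n \<in> I" for n
  proof -
    have "G * (w n * v n) = G * ((w n * v n + v n * w n) * (w n * v n))"
      using n by (simp add: distrib_right rules)
    also have "\<dots> = g n * (w n * v n)" by (simp add: mult.assoc[symmetric] Gg[OF n])
    also have "\<dots> = (1/2) *\<^sub>R (w n * v n + v n)" using n by (simp add: g_def distrib_right rules)
    finally have Ge: "G * (w n * v n) = (1/2) *\<^sub>R (w n * v n + v n)" .
    have "F * (w n * v n) = 0" by (rule F0) (use n in \<open>simp add: rules\<close>)
    then show ?thesis using n by (simp add: V_def mult.assoc eE[unfolded mult.assoc] Ge distrib_left Fv)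
  qed
  have Vf: "V\<^sup>\<star> * (v n * w n) = w n" if n: "n \<in> I" for n
  proof -
    have "G * (v n * w n) = G * ((w n * v n + v n * w n) * (v n * w n))"
      using n by (simp add: distrib_right rules)
    also have "\<dots> = g n * (v n * w n)" by (simp add: mult.assoc[symmetric] Gg[OF n])
    also have "\<dots> = (1/2) *\<^sub>R (v n * w n + w n)" using n by (simp add: g_def distrib_right rules)
    finally have Ge: "G * (v n * w n) = (1/2) *\<^sub>R (v n * w n + w n)" .
    have "E * (v n * w n) = 0" by (rule E0) (use n in \<open>simp add: rules\<close>)
    then show ?thesis using n by (simp add: Vs mult.assoc fF[unfolded mult.assoc] Ge distrib_left Ev)
  qed
  have Vv: "V\<^sup>\<star> * v n = w n * v n" if n: "n \<in> I" for n
  proof -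
    have "V\<^sup>\<star> * v n = V\<^sup>\<star> * (v n * w n) * v n" using vw[OF n] by (simp add: mult.assoc)
    then show ?thesis by (simp add: Vf[OF n])
  qed
  have Vw: "V * w n = v n * w n" if n: "n \<in> I" for n
  proof -
    have "V * w n = V * (w n * v n) * w n" using wv[OF n] by (simp add: mult.assoc)
    then show ?thesis by (simp add: Ve[OF n])
  qed
  have VE: "E * V\<^sup>\<star> = V\<^sup>\<star>" by (simp add: Vs mult.assoc[symmetric] projection_idem[OF pE])
  have FV: "F * V = V" by (simp add: V_def mult.assoc[symmetric] projection_idem[OF pF])
  \<comment> \<open>There is no sum to expand: \<open>V\<^sup>\<star> * V\<close> acts as
    \<open>1\<close> on each initial projection, and \<open>E\<close> is their supremum.\<close>
  have "E * (V\<^sup>\<star> * V - 1) = 0"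
  proof (rule E0)
    fix n assume n: "n \<in> I"
    have "V\<^sup>\<star> * V * (w n * v n) = w n * v n" by (simp add: mult.assoc Ve[OF n] Vv[OF n])
    then have "(V\<^sup>\<star> * V * (w n * v n))\<^sup>\<star> = (w n * v n)\<^sup>\<star>" by simp
    then have "w n * v n * (V\<^sup>\<star> * V) = w n * v n" by (simp add: star_mult star_star ws mult.assoc)
    then show "w n * v n * (V\<^sup>\<star> * V - 1) = 0" by (simp add: right_diff_distrib)
  qed
  then have "V\<^sup>\<star> * V = E" using VE by (simp add: right_diff_distrib mult_assoc_rewrite[OF VE])
  moreover have "F * (V * V\<^sup>\<star> - 1) = 0"
  proof (rule F0)
    fix n assume n: "n \<in> I"
    have "V * V\<^sup>\<star> * (v n * w n) = v n * w n" by (simp add: mult.assoc Vf[OF n] Vw[OF n])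
    then have "(V * V\<^sup>\<star> * (v n * w n))\<^sup>\<star> = (v n * w n)\<^sup>\<star>" by simp
    then have "v n * w n * (V * V\<^sup>\<star>) = v n * w n" by (simp add: star_mult star_star ws mult.assoc)
    then show "v n * w n * (V * V\<^sup>\<star> - 1) = 0" by (simp add: right_diff_distrib)
  qed
  then have "V * V\<^sup>\<star> = F" using FV by (simp add: right_diff_distrib mult_assoc_rewrite[OF FV])
  ultimately show ?thesis using that by blast
qed

lemma projection_sup_le:
  assumes "projection_sup S E" "is_projection f" "\<And>s. s \<in> S \<Longrightarrow> s * f = s"
  shows "E * f = E"
proof -
  have "\<forall>s\<in>S. s * (1 - f) = 0" using assms(3) by (simp add: right_diff_distrib)
  then have "E * (1 - f) = 0" using assms(1) unfolding projection_sup_def by blast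
  then show ?thesis by (simp add: right_diff_distrib)
qed

text \<open>\<open>cover\<close> puts \<open>g\<close> below the central support of
  \<open>r\<close>. So wherever \<open>z * g \<noteq> 0\<close> there is a nonzero element of
  \<open>r M (z g)\<close>, and normalising it embeds a central cut of \<open>g\<close> into
  \<open>r\<close>. The local embeddings are added along a central partition;
  \<open>r * g = 0\<close> provides the orthogonality of initial and range projections that
  \<open>add_partial_isometries\<close> requires.\<close>

lemma abelian_comparison:
  fixes g r :: "'a::aw_star_algebra"
  assumes g: "abelian_projection g" and r: "is_projection r" and rg: "r * g = 0"
    and cover: "\<And>z. central_projection z \<Longrightarrow> z * r = 0 \<Longrightarrow> z * g = 0"
  obtains v where "v\<^sup>\<star> * v = g" "v * v\<^sup>\<star> * r = v * v\<^sup>\<star>"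
proof -
  note pg = abelian_is_projection[OF g]
  have gr: "g * r = 0" by (rule projection_orth_commute[OF r pg rg])
  define Q where "Q z v \<longleftrightarrow> v\<^sup>\<star> * v = z * g \<and> r * v = v" for z v
  have ex: "\<exists>w. central_projection w \<and> w \<noteq> 0 \<and> z * w = w \<and> (\<exists>v. Q w v)"
    if z: "central_projection z" "z \<noteq> 0" for z
  proof (cases "z * g = 0")
    case True
    \<comment> \<open>On a piece where \<open>g\<close> vanishes the partial isometry is
      \<open>0\<close>.\<close>
    then show ?thesis using z by (intro exI[of _ z]) (auto simp: Q_def central_idem intro!: exI[of _ 0])
  next
    case False
    obtain c where c: "central_projection c" "c * r = r" "\<And>t. (\<And>y. r\<^sup>\<star> * (y * t) = 0) \<Longrightarrow> c * t = 0"
      using central_support by blast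
    have "\<exists>y. r * (y * (z * g)) \<noteq> 0"
    proof (rule ccontr)
      assume "\<not> ?thesis"
      then have *: "c * (z * g) = 0" by (intro c(3)) (simp add: projection_star[OF r])
      have "(1 - c) * z * g = 0"
        by (rule cover[OF central_projection_mult[OF central_projection_compl[OF c(1)] z(1)]])
          (simp add: left_diff_distrib mult.assoc central_left_commute[OF z(1), of c] c(2))
      then show False using * False by (simp add: left_diff_distrib mult.assoc)
    qed
    then obtain y where y: "r * (y * (z * g)) \<noteq> 0" by blast
    define x where "x = r * (y * (z * g))"
    have x0: "x \<noteq> 0" using y by (simp add: x_def)
    have xg: "x * g = x" by (simp add: x_def mult.assoc projection_idem[OF pg])
    obtain w b where b: "central_projection w" "w * g \<noteq> 0" "(x * b)\<^sup>\<star> * (x * b) = w * g" "x * b * g = x * b"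
      "b * g = g * b"
      by (rule partial_isometry_into[OF g x0 xg])
    have xz: "z * x = x"
      by (simp add: x_def central_left_commute[OF z(1), of r, symmetric]
          central_left_commute[OF z(1), of y, symmetric] central_idem_left[OF z(1)])
    have "z * (w * g) = z * ((x * b)\<^sup>\<star> * (x * b))" by (simp only: b(3))
    also have "\<dots> = (z * (x * b)\<^sup>\<star>) * (x * b)" by (simp only: mult.assoc)
    also have "z * (x * b)\<^sup>\<star> = (x * b)\<^sup>\<star>"
      by (subst central_star_mult[OF z(1), symmetric]) (simp add: mult_assoc_rewrite[OF xz])
    finally have zwg: "z * (w * g) = w * g" by (simp only: b(3))
    show ?thesis
    proof (intro exI conjI)
      show "central_projection (z * w)" by (rule central_projection_mult[OF z(1) b(1)])
      show "z * w \<noteq> 0" using zwg b(2) by (auto simp: mult.assoc[symmetric])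
      show "z * (z * w) = z * w" by (rule central_idem_left[OF z(1)])
      show "Q (z * w) (x * b)"
        unfolding Q_def using b(3) zwg by (simp add: mult.assoc x_def projection_idem_left[OF r])
    qed
  qed
  obtain Z where Z: "central_partition Z" "\<And>z. z \<in> Z \<Longrightarrow> \<exists>v. Q z v"
    by (rule exhaustion[of "\<lambda>z. \<exists>v. Q z v", OF ex], assumption+, rule that)
  note cZ = central_partition_central[OF Z(1)]
  obtain v where Q: "\<And>z. z \<in> Z \<Longrightarrow> Q z (v z)" using Z(2) by metis
  have vv: "(v z)\<^sup>\<star> * v z = z * g" and rv: "r * v z = v z" if "z \<in> Z" for z
    using Q[OF that] by (auto simp: Q_def)
  have e: "is_projection ((v z)\<^sup>\<star> * v z)" if "z \<in> Z" for z
    unfolding vv[OF that] by (rule is_projection_central_mult[OF cZ[OF that] pg])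
  have zv: "z * v z = v z" if z: "z \<in> Z" for z
  proof -
    have "v z = v z * (z * g)" using partial_isometry_mult[OF e[OF z]] vv[OF z] by simp
    then have "v z = z * (v z * g)" using central_left_commute[OF cZ[OF z]] by metis
    then show ?thesis using central_idem_left[OF cZ[OF z]] by metis
  qed
  have pf: "is_projection (v z * (v z)\<^sup>\<star>)" if "z \<in> Z" for z
    by (rule range_projection_of_partial_isometry[OF e[OF that]])
  have orth: "x * y = 0" if "z * x = x" "w * y = y" "z \<in> Z" "w \<in> Z" "z \<noteq> w" for x y z w
  proof -
    have "x * y = z * (x * (w * y))" using that by (metis mult.assoc)
    also have "\<dots> = z * w * (x * y)" using central_left_commute[OF cZ[OF that(4)]] by (metis mult.assoc)
    finally show ?thesis using central_partition_orth[OF Z(1)] that by simp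
  qed
  obtain E where E: "projection_sup ((\<lambda>z. (v z)\<^sup>\<star> * v z) ` Z) E"
    by (rule projection_sup_exists[of "(\<lambda>z. (v z)\<^sup>\<star> * v z) ` Z"]) (use e in auto)
  obtain F where F: "projection_sup ((\<lambda>z. v z * (v z)\<^sup>\<star>) ` Z) F"
    by (rule projection_sup_exists[of "(\<lambda>z. v z * (v z)\<^sup>\<star>) ` Z"]) (use pf in auto)
  obtain V where V: "V\<^sup>\<star> * V = E" "V * V\<^sup>\<star> = F"
  proof (rule add_partial_isometries[OF _ _ _ _ E F])
    show "is_projection ((v z)\<^sup>\<star> * v z)" if "z \<in> Z" for z by (rule e[OF that])
    show "((v z)\<^sup>\<star> * v z) * ((v w)\<^sup>\<star> * v w) = 0" if "z \<in> Z" "w \<in> Z" "z \<noteq> w" for z w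
      by (rule orth[OF _ _ that]) (simp_all add: vv that central_idem_left[OF cZ])
    show "(v z * (v z)\<^sup>\<star>) * (v w * (v w)\<^sup>\<star>) = 0" if "z \<in> Z" "w \<in> Z" "z \<noteq> w" for z w
      by (rule orth[OF _ _ that]) (simp_all add: mult_assoc_rewrite[OF zv] that)
    show "((v z)\<^sup>\<star> * v z) * (v w * (v w)\<^sup>\<star>) = 0" if "z \<in> Z" "w \<in> Z" for z w
    proof -
      have "((v z)\<^sup>\<star> * v z) * (v w * (v w)\<^sup>\<star>) = z * (g * r) * (v w * (v w)\<^sup>\<star>)"
        by (simp add: vv[OF that(1)] mult.assoc mult_assoc_rewrite[OF rv[OF that(2)]])
      then show ?thesis by (simp add: gr)
    qed
  qed
  have "E = g"
  proof (rule central_partition_eq[OF Z(1)])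
    fix z assume z: "z \<in> Z"
    have pE: "is_projection E" using E by (simp add: projection_sup_def)
    have "E * g = E"
      by (rule projection_sup_le[OF E pg]) (auto simp: vv mult.assoc projection_idem[OF pg])
    then have gE: "g * E = E" by (rule projection_le_commute[OF pE pg])
    have "z * g * E = z * g" using E z by (auto simp: projection_sup_def vv)
    then show "z * E = z * g" by (simp add: mult.assoc gE)
  qed
  moreover have "F * r = F"
  proof (rule projection_sup_le[OF F r])
    fix s assume "s \<in> (\<lambda>z. v z * (v z)\<^sup>\<star>) ` Z"
    then obtain z where z: "z \<in> Z" "s = v z * (v z)\<^sup>\<star>" by blast
    have "(v z)\<^sup>\<star> * r = (v z)\<^sup>\<star>" using arg_cong[OF rv[OF z(1)], of star] by (simp add: star_mult projection_star[OF r])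
    then show "s * r = s" by (simp add: z(2) mult.assoc)
  qed
  ultimately show ?thesis using that[of V] V by simp
qed

section \<open>Finite projections as local sums of abelian ones\<close>

definition sum_of_abelian :: "'a::cstar_algebra \<Rightarrow> bool" where
  "sum_of_abelian x \<longleftrightarrow> (\<exists>hs. (\<forall>h\<in>set hs. abelian_projection h) \<and> x = sum_list hs)"

lemma sum_of_abelian_0 [simp]: "sum_of_abelian 0"
  unfolding sum_of_abelian_def by (rule exI[of _ "[]"]) simp

lemma sum_of_abelian_add: "sum_of_abelian x \<Longrightarrow> abelian_projection h \<Longrightarrow> sum_of_abelian (h + x)"
  unfolding sum_of_abelian_def by (metis set_ConsD sum_list.Cons)

lemma sum_list_mult_left: "(z::'a::ring) * sum_list xs = sum_list (map ((*) z) xs)"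
  by (induction xs) (auto simp: distrib_left)

lemma sum_of_abelian_central_mult:
  assumes "sum_of_abelian x" "central_projection z"
  shows "sum_of_abelian (z * x)"
proof -
  obtain hs where hs: "\<forall>h\<in>set hs. abelian_projection h" "x = sum_list hs"
    using assms(1) sum_of_abelian_def by blast
  have "z * x = sum_list (map ((*) z) hs)" by (simp add: hs(2) sum_list_mult_left)
  then show ?thesis unfolding sum_of_abelian_def
    using hs(1) abelian_projection_central_mult[OF _ assms(2)] by (intro exI[of _ "map ((*) z) hs"]) auto
qed

text \<open>Infinitely many orthogonal copies of \<open>g\<close> under \<open>f\<close>: the even ones are equivalent to the odd
  ones, and these to every fourth one, so \<open>f\<close> has an infinite subprojection.\<close>

lemma no_infinite_orthogonal_copies:
  fixes g f :: "'a::aw_star_algebra" and v :: "nat \<Rightarrow> 'a"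
  assumes f: "finite_projection f" and g: "is_projection g"
    and v: "\<And>n. (v n)\<^sup>\<star> * v n = g" and vf: "\<And>n. v n * (v n)\<^sup>\<star> * f = v n * (v n)\<^sup>\<star>"
    and orth: "\<And>m n. m \<noteq> n \<Longrightarrow> v m * (v m)\<^sup>\<star> * (v n * (v n)\<^sup>\<star>) = 0"
  shows "g = 0"
proof -
  define q where "q n = v n * (v n)\<^sup>\<star>" for n :: nat
  have pv: "is_projection ((v n)\<^sup>\<star> * v n)" for n by (simp add: v g)
  have pq: "is_projection (q n)" for n unfolding q_def by (rule range_projection_of_partial_isometry[OF pv])
  have qq: "q m * q n = 0" if "m \<noteq> n" for m n using orth[OF that] by (simp add: q_def)
  have vg: "v n * g = v n" for n using partial_isometry_mult[OF pv[of n]] by (simp add: v)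
  have equiv: "\<exists>V. V\<^sup>\<star> * V = E \<and> V * V\<^sup>\<star> = F"
    if inj: "inj \<phi>" "inj \<psi>" and dis: "\<And>m n. \<psi> m \<noteq> \<phi> n"
      and E: "projection_sup (range (\<lambda>n. q (\<psi> n))) E" and F: "projection_sup (range (\<lambda>n. q (\<phi> n))) F"
    for \<phi> \<psi> :: "nat \<Rightarrow> nat" and E F
  proof -
    define u where "u n = v (\<phi> n) * (v (\<psi> n))\<^sup>\<star>" for n
    have us: "(u n)\<^sup>\<star> = v (\<psi> n) * (v (\<phi> n))\<^sup>\<star>" for n by (simp add: u_def star_simps)
    have uu: "(u n)\<^sup>\<star> * u n = q (\<psi> n)" for n
    proof -
      have "(u n)\<^sup>\<star> * u n = v (\<psi> n) * ((v (\<phi> n))\<^sup>\<star> * v (\<phi> n)) * (v (\<psi> n))\<^sup>\<star>"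
        unfolding us unfolding u_def by (simp only: mult.assoc)
      then show ?thesis by (simp only: v vg q_def)
    qed
    have uu': "u n * (u n)\<^sup>\<star> = q (\<phi> n)" for n
    proof -
      have "u n * (u n)\<^sup>\<star> = v (\<phi> n) * ((v (\<psi> n))\<^sup>\<star> * v (\<psi> n)) * (v (\<phi> n))\<^sup>\<star>"
        unfolding us unfolding u_def by (simp only: mult.assoc)
      then show ?thesis by (simp only: v vg q_def)
    qed
    show ?thesis
    proof (rule add_partial_isometries[where v = u and I = UNIV and E = E and F = F])
      show "projection_sup (range (\<lambda>i. (u i)\<^sup>\<star> * u i)) E" "projection_sup (range (\<lambda>i. u i * (u i)\<^sup>\<star>)) F"
        unfolding uu uu' by (rule E, rule F)
    qed (auto simp: uu uu' pq qq inj dis inj_eq)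
  qed
  have sup: "\<exists>E. projection_sup (range (\<lambda>n. q (\<phi> n))) E" for \<phi> :: "nat \<Rightarrow> nat"
    by (rule projection_sup_exists[of "range (\<lambda>n. q (\<phi> n))"]) (use pq in auto)
  obtain E where E: "projection_sup (range (\<lambda>n. q (2 * n))) E" using sup by blast
  obtain D where D: "projection_sup (range (\<lambda>n. q (2 * n + 1))) D" using sup[of "\<lambda>n. 2 * n + 1"] by blast
  obtain F where F: "projection_sup (range (\<lambda>n. q (4 * n))) F" using sup by blast
  have "2 * m \<noteq> 2 * n + (1::nat)" "2 * m + 1 \<noteq> 4 * (n::nat)" for m n by presburger+
  then obtain V W where V: "V\<^sup>\<star> * V = E" "V * V\<^sup>\<star> = D" and W: "W\<^sup>\<star> * W = D" "W * W\<^sup>\<star> = F"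
    using equiv[OF _ _ _ E D] equiv[OF _ _ _ D F] by (auto simp: inj_def)
  have pE: "is_projection E" and pF: "is_projection F" and pD: "is_projection D"
    using E F D by (auto simp: projection_sup_def)
  have WD: "W * D = W" using partial_isometry_mult[of W] pD by (simp add: W)
  have VE: "V * E = V" using partial_isometry_mult[of V] pE by (simp add: V)
  have pf: "is_projection f" by (rule finite_is_projection[OF f])
  have "E * f = E" by (rule projection_sup_le[OF E pf]) (use vf in \<open>auto simp: q_def\<close>)
  then have finE: "finite_projection E" by (rule finite_subprojection[OF f pE])
  have "(W * V)\<^sup>\<star> * (W * V) = V\<^sup>\<star> * (W\<^sup>\<star> * W) * V" by (simp add: star_mult mult.assoc)
  also have "\<dots> = (V\<^sup>\<star> * V) * (V\<^sup>\<star> * V)" by (simp only: W V(2)[symmetric] mult.assoc)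
  also have "\<dots> = E" by (simp add: V projection_idem[OF pE])
  finally have 1: "(W * V)\<^sup>\<star> * (W * V) = E" .
  have "(W * V) * (W * V)\<^sup>\<star> = W * (V * V\<^sup>\<star>) * W\<^sup>\<star>" by (simp add: star_mult mult.assoc)
  also have "\<dots> = F" by (simp add: V WD W)
  finally have 2: "(W * V) * (W * V)\<^sup>\<star> = F" .
  have "F * E = F"
  proof (rule projection_sup_le[OF F pE])
    fix s assume "s \<in> range (\<lambda>n. q (4 * n))"
    then obtain n where n: "s = q (4 * n)" by blast
    have "q (2 * (2 * n)) * E = q (2 * (2 * n))" using E unfolding projection_sup_def by blast
    then show "s * E = s" by (simp add: n)
  qed
  then have "F = E" using finite_projectionD[OF finE 1] 2 by simp
  \<comment> \<open>The index 2 is even but no multiple of 4, so \<open>q 2\<close> lies below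
    \<open>E\<close> and is orthogonal to \<open>F\<close>.\<close>
  have "q (2 * 1) * E = q (2 * 1)" using E unfolding projection_sup_def by blast
  moreover have "F * q 2 = 0"
  proof -
    have "(4::nat) * n \<noteq> 2" for n by presburger
    then have "\<forall>s\<in>range (\<lambda>n. q (4 * n)). s * q 2 = 0" using qq by auto
    then show ?thesis using F unfolding projection_sup_def by blast
  qed
  then have "q 2 * F = 0" by (rule projection_orth_commute[OF pF pq])
  ultimately have "q 2 = 0" using \<open>F = E\<close> by simp
  then have "v 2 * (v 2)\<^sup>\<star> = 0" by (simp add: q_def)
  then have "(v 2)\<^sup>\<star> = 0" using star_mult_self_eq_0_iff[of "(v 2)\<^sup>\<star>"] by (simp add: star_star)
  then show ?thesis using v[of 2] by simp
qed

text \<open>Copies of an abelian \<open>g\<close> are removed from \<open>f\<close> one after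
  another, \<open>r\<close> being the remainder. If a central \<open>c\<close> annihilated
  \<open>r\<close> but not \<open>g\<close>, then \<open>f\<close> would be a sum of abelian
  projections on the nonzero piece \<open>z * c\<close>. By assumption there is no such piece, so
  the covering condition of \<open>abelian_comparison\<close> never fails and the removal never
  stops.\<close>

lemma finite_locally_sum_of_abelian:
  fixes f :: "'a::aw_star_algebra"
  assumes d: "discrete_algebra TYPE('a)" and f: "finite_projection f"
    and z: "central_projection z" "z \<noteq> 0"
  obtains w where "central_projection w" "w \<noteq> 0" "z * w = w" "sum_of_abelian (w * f)"
proof (rule ccontr)
  assume "\<not> thesis"
  then have no: "\<not> sum_of_abelian (w * f)" if "central_projection w" "w \<noteq> 0" "z * w = w" for w
    using that \<open>\<And>w. central_projection w \<Longrightarrow> w \<noteq> 0 \<Longrightarrow> z * w = w \<Longrightarrow> sum_of_abelian (w * f) \<Longrightarrow> thesis\<close> by blast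
  note pf = finite_is_projection[OF f]
  have "z * f \<noteq> 0" using no[OF z] central_idem[OF z(1)] sum_of_abelian_0 by metis
  then obtain g where g: "abelian_projection g" "g \<noteq> 0" "g * (z * f) = g" "z * f * g = g"
    using abelian_below_discrete[OF d is_projection_central_mult[OF z(1) pf]] by blast
  note pg = abelian_is_projection[OF g(1)]
  have zg: "z * g = g" using g(4) central_idem_left[OF z(1)] by (metis mult.assoc)
  have fg: "f * g = g"
    using g(4) zg central_commute[OF z(1)] by (metis mult.assoc)
  have gf: "g * f = g" using arg_cong[OF fg, of star] by (simp add: star_mult projection_star[OF pg] projection_star[OF pf])
  define inv where "inv r \<longleftrightarrow> is_projection r \<and> r * f = r \<and> r * g = 0 \<and> sum_of_abelian (f - r)" for r
  have step: "\<exists>v. v\<^sup>\<star> * v = g \<and> v * v\<^sup>\<star> * r = v * v\<^sup>\<star>" if r: "inv r" for r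
  proof -
    have "c * g = 0" if c: "central_projection c" "c * r = 0" for c
    proof (rule ccontr)
      assume cg: "c * g \<noteq> 0"
      have "sum_of_abelian (z * (c * (f - r)))"
        using r sum_of_abelian_central_mult c(1) z(1) by (auto simp: inv_def)
      then have "sum_of_abelian (z * c * f)" by (simp add: right_diff_distrib c(2) mult.assoc)
      moreover have "z * c \<noteq> 0"
        using cg zg central_commute[OF c(1)] by (metis mult.assoc mult_zero_left)
      ultimately show False using no[OF central_projection_mult[OF z(1) c(1)]] central_idem_left[OF z(1)] by blast
    qed
    then show ?thesis using abelian_comparison[OF g(1)] r unfolding inv_def by metis
  qed
  have next_inv: "inv (r - v * v\<^sup>\<star>)" if r: "inv r" and v: "v\<^sup>\<star> * v = g" "v * v\<^sup>\<star> * r = v * v\<^sup>\<star>" for r v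
  proof -
    have pv: "is_projection (v\<^sup>\<star> * v)" by (simp add: v pg)
    have pq: "is_projection (v * v\<^sup>\<star>)" by (rule range_projection_of_partial_isometry[OF pv])
    have ab: "abelian_projection (v * v\<^sup>\<star>)"
      by (rule abelian_range_projection[OF g(1) pv]) (use partial_isometry_mult[OF pv] v in simp)
    have rr: "r * f = r" "r * g = 0" "is_projection r" using r by (auto simp: inv_def)
    have "v * v\<^sup>\<star> * f = v * v\<^sup>\<star>" using v(2) rr(1) by (metis mult.assoc)
    moreover have "v * v\<^sup>\<star> * g = 0" using v(2) rr(2) by (metis mult.assoc mult_zero_right)
    moreover have "sum_of_abelian (v * v\<^sup>\<star> + (f - r))"
      using sum_of_abelian_add[OF _ ab] r by (simp add: inv_def)
    then have "sum_of_abelian (f - (r - v * v\<^sup>\<star>))" by (simp add: algebra_simps)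
    ultimately show ?thesis
      using is_projection_diff[OF pq rr(3) v(2)] rr
      by (simp add: inv_def left_diff_distrib)
  qed
  \<comment> \<open>The state is a remainder together with an embedding of \<open>g\<close> into it,
    so that the sequence of chosen copies can be read off.\<close>
  define P where "P s \<longleftrightarrow> inv (fst s) \<and> (snd s)\<^sup>\<star> * snd s = g \<and> snd s * (snd s)\<^sup>\<star> * fst s = snd s * (snd s)\<^sup>\<star>"
    for s :: "'a \<times> 'a"
  \<comment> \<open>The start is \<open>f - g\<close> and not \<open>f\<close>, because comparison
    needs a remainder orthogonal to \<open>g\<close>.\<close>
  have init: "inv (f - g)"
    using is_projection_diff[OF pg pf gf] sum_of_abelian_add[OF sum_of_abelian_0 g(1)]
    by (simp add: inv_def left_diff_distrib projection_idem[OF pf] projection_idem[OF pg] gf fg)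
  have "\<exists>s. \<forall>n::nat. P (s n) \<and> fst (s (Suc n)) = fst (s n) - snd (s n) * (snd (s n))\<^sup>\<star>"
  proof (rule dependent_nat_choice)
    show "\<exists>s. P s" using init step[OF init] by (auto simp: P_def)
    fix s :: "'a \<times> 'a" and n :: nat assume s: "P s"
    define r where "r = fst s - snd s * (snd s)\<^sup>\<star>"
    have "inv r" using next_inv s by (simp add: P_def r_def)
    with step[OF this] show "\<exists>t. P t \<and> fst t = fst s - snd s * (snd s)\<^sup>\<star>"
      by (auto simp: P_def r_def)
  qed
  then obtain s where s: "\<And>n::nat. P (s n)" "\<And>n. fst (s (Suc n)) = fst (s n) - snd (s n) * (snd (s n))\<^sup>\<star>"
    by blast
  define r v where "r n = fst (s n)" and "v n = snd (s n)" for n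
  have v: "(v n)\<^sup>\<star> * v n = g" "v n * (v n)\<^sup>\<star> * r n = v n * (v n)\<^sup>\<star>" and r: "inv (r n)"
    and rS: "r (Suc n) = r n - v n * (v n)\<^sup>\<star>" for n
    using s by (auto simp: P_def r_def v_def)
  have pr: "is_projection (r n)" and rf: "r n * f = r n" for n using r by (auto simp: inv_def)
  have pv: "is_projection ((v n)\<^sup>\<star> * v n)" for n by (simp add: v pg)
  have pq: "is_projection (v n * (v n)\<^sup>\<star>)" for n by (rule range_projection_of_partial_isometry[OF pv])
  have dec: "r (n + k) * r n = r (n + k)" for n k
  proof (induction k)
    case 0
    show ?case by (simp add: projection_idem[OF pr])
  next
    case (Suc k)
    have "v (n + k) * (v (n + k))\<^sup>\<star> * r n = v (n + k) * (v (n + k))\<^sup>\<star>"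
      using v(2)[of "n + k"] Suc by (metis mult.assoc)
    then show ?case using Suc by (simp add: rS left_diff_distrib)
  qed
  have orth': "v m * (v m)\<^sup>\<star> * (v n * (v n)\<^sup>\<star>) = 0" if "n < m" for m n
  proof -
    have "r (Suc n) * (v n * (v n)\<^sup>\<star>) = 0"
      using projection_le_commute[OF pq pr v(2)] projection_idem[OF pq] by (simp add: rS left_diff_distrib)
    moreover have "v m * (v m)\<^sup>\<star> = v m * (v m)\<^sup>\<star> * r m * r (Suc n)"
    proof -
      have "r m * r (Suc n) = r m" using dec[of "Suc n" "m - Suc n"] that by simp
      then show ?thesis using v(2)[of m] by (metis mult.assoc)
    qed
    ultimately show ?thesis by (metis mult.assoc mult_zero_right)
  qed
  have "g = 0"
  proof (rule no_infinite_orthogonal_copies[OF f pg v(1)])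
    show "v n * (v n)\<^sup>\<star> * f = v n * (v n)\<^sup>\<star>" for n using v(2)[of n] rf[of n] by (metis mult.assoc)
    show "v m * (v m)\<^sup>\<star> * (v n * (v n)\<^sup>\<star>) = 0" if "m \<noteq> n" for m n
      using orth'[of n m] projection_orth_commute[OF pq pq orth'[of m n]] that by (meson nat_neq_iff)
  qed
  then show False using g(2) by blast
qed

text \<open>A homogeneous linear system over the commutative corner \<open>g M g\<close> with more unknowns than
  equations has a nontrivial solution: \<open>h M g\<close> has rank at most one when \<open>h\<close> is abelian. In each
  elimination step \<open>g\<close> is cut down by a central projection, to make the pivot invertible.\<close>

lemma abelian_elimination:
  fixes g :: "'a::aw_star_algebra" and y :: "'i \<Rightarrow> 'a"
  assumes "\<forall>h\<in>set hs. abelian_projection h" "abelian_projection g" "g \<noteq> 0" "finite K" "card K = Suc (length hs)"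
    "\<forall>k\<in>K. y k * g = y k"
  shows "\<exists>b. (\<forall>k\<in>K. g * b k = b k \<and> b k * g = b k) \<and> (\<exists>k\<in>K. b k \<noteq> 0) \<and> (\<forall>h\<in>set hs. h * (\<Sum>k\<in>K. y k * b k) = 0)"
  using assms
proof (induction hs arbitrary: g K y)
  case Nil
  then obtain k where "K = {k}" using card_1_singletonE by auto
  then show ?case using Nil projection_idem[OF abelian_is_projection[OF Nil(2)]]
    by (intro exI[of _ "\<lambda>_. g"]) auto
next
  case (Cons h hs)
  note g = Cons.prems(2) and K = Cons.prems(4) and y = Cons.prems(6)[rule_format]
  note pg = abelian_is_projection[OF g]
  have h: "abelian_projection h" and hs: "\<forall>h\<in>set hs. abelian_projection h" using Cons.prems(1) by auto
  note ph = abelian_is_projection[OF h]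
  have card: "card (K - {k}) = Suc (length hs)" if "k \<in> K" for k using that K Cons.prems(5) by simp
  show ?case
  proof (cases "\<forall>k\<in>K. h * y k = 0")
    case True
    \<comment> \<open>Here \<open>h\<close> imposes no condition. One unknown is set to 0 so that
      the counts fit the induction hypothesis.\<close>
    obtain k0 where k0: "k0 \<in> K" using Cons.prems(5) by (metis card.empty ex_in_conv nat.distinct(1))
    obtain b where b: "\<forall>k\<in>K - {k0}. g * b k = b k \<and> b k * g = b k" "\<exists>k\<in>K - {k0}. b k \<noteq> 0"
      "\<forall>h\<in>set hs. h * (\<Sum>k\<in>K - {k0}. y k * b k) = 0"
      using Cons.IH[OF hs g Cons.prems(3) _ card[OF k0], of y] K y by auto
    define b' where "b' k = (if k = k0 then 0 else b k)" for k
    have "(\<Sum>k\<in>K. y k * b' k) = (\<Sum>k\<in>K - {k0}. y k * b k)"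
      by (subst sum.remove[OF K k0]) (auto simp: b'_def intro!: sum.cong)
    moreover have "h * (\<Sum>k\<in>K. y k * b' k) = 0"
      using True by (simp add: sum_distrib_left mult.assoc[symmetric])
    ultimately show ?thesis using b by (intro exI[of _ b']) (auto simp: b'_def)
  next
    case False
    then obtain k0 where k0: "k0 \<in> K" "h * y k0 \<noteq> 0" by blast
    have "h * y k0 * g = h * y k0" by (simp add: mult.assoc y[OF k0(1)])
    then obtain z c where c: "central_projection z" "z * g \<noteq> 0" "(h * y k0 * c)\<^sup>\<star> * (h * y k0 * c) = z * g"
      "h * y k0 * c * g = h * y k0 * c" "c * g = g * c"
      by (rule partial_isometry_into[OF g k0(2)])
    define v where "v = h * y k0 * c"
    define g' where "g' = z * g"
    have ag': "abelian_projection g'" unfolding g'_def by (rule abelian_projection_central_mult[OF g c(1)])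
    have vv: "v\<^sup>\<star> * v = g'" using c(3) by (simp add: v_def g'_def)
    have vg: "v * g = v" using c(4) by (simp add: v_def)
    have hv: "h * v = v" by (simp add: v_def mult.assoc projection_idem_left[OF ph])
    have pv: "is_projection (v\<^sup>\<star> * v)" unfolding vv by (rule abelian_is_projection[OF ag'])
    have vq: "v\<^sup>\<star> * (v * v\<^sup>\<star>) = v\<^sup>\<star>"
      using arg_cong[OF partial_isometry_mult[OF pv], of star] by (simp add: star_simps mult.assoc)
    have gv: "g * v\<^sup>\<star> = v\<^sup>\<star>" using arg_cong[OF vg, of star] by (simp add: star_mult projection_star[OF pg])
    have vh: "v\<^sup>\<star> * h = v\<^sup>\<star>" using arg_cong[OF hv, of star] by (simp add: star_mult projection_star[OF ph])
    have gg': "g * g' = g'" "g' * g = g'"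
      by (simp_all add: g'_def mult.assoc projection_idem[OF pg] central_left_commute[OF c(1), of g])
    \<comment> \<open>From column \<open>l\<close> the multiple of the pivot column
      \<open>y k0\<close> is subtracted that \<open>h\<close> cannot distinguish from it on the
      corner of \<open>g'\<close>.\<close>
    define y' where "y' l = (y l - y k0 * c * v\<^sup>\<star> * y l) * g'" for l
    \<comment> \<open>In the commutative corner of \<open>h\<close> the factor
      \<open>h - v * v\<^sup>\<star>\<close> can be moved to the right of
      \<open>h * y l * v\<^sup>\<star>\<close>, where \<open>v\<^sup>\<star>\<close> annihilates it.
      This is the rank-one property.\<close>
    have hy': "h * y' l = 0" for l
    proof -
      have "(h - v * v\<^sup>\<star>) * (h * y l * v\<^sup>\<star>) = (h * y l * v\<^sup>\<star>) * (h - v * v\<^sup>\<star>)"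
        by (rule abelian_projection_commute[OF h])
          (simp_all add: algebra_simps projection_idem[OF ph] projection_idem_left[OF ph] mult_assoc_rewrite[OF hv] vh)
      also have "\<dots> = 0" by (simp add: right_diff_distrib mult.assoc vh vq)
      finally have "(h - v * v\<^sup>\<star>) * (h * y l * v\<^sup>\<star>) * v = 0" by simp
      then have "(h - v * v\<^sup>\<star>) * (y l * g') = 0"
        by (simp add: left_diff_distrib mult.assoc vv projection_idem_left[OF ph] mult_assoc_rewrite[OF vh])
      moreover have "h * y' l = (h - v * v\<^sup>\<star>) * (y l * g')"
        by (simp add: y'_def left_diff_distrib right_diff_distrib v_def mult.assoc)
      ultimately show ?thesis by simp
    qed
    have "\<forall>k\<in>K - {k0}. y' k * g' = y' k"
      using projection_idem[OF abelian_is_projection[OF ag']] by (simp add: y'_def mult.assoc)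
    then obtain b where b: "\<forall>k\<in>K - {k0}. g' * b k = b k \<and> b k * g' = b k" "\<exists>k\<in>K - {k0}. b k \<noteq> 0"
      "\<forall>h\<in>set hs. h * (\<Sum>k\<in>K - {k0}. y' k * b k) = 0"
      using Cons.IH[OF hs ag' _ _ card[OF k0(1)], of y'] K c(2) by (auto simp: g'_def)
    define s where "s = (\<Sum>k\<in>K - {k0}. y k * b k)"
    \<comment> \<open>Back substitution: the coefficient of the pivot column collects all the
      subtracted multiples.\<close>
    define b' where "b' k = (if k = k0 then - (c * (v\<^sup>\<star> * s)) else b k)" for k
    have gb: "g * b k = b k" "b k * g = b k" if "k \<in> K - {k0}" for k
      using b(1) that gg' by (metis mult.assoc)+
    have "(\<Sum>k\<in>K - {k0}. y' k * b k) = (\<Sum>k\<in>K - {k0}. y k * b k - y k0 * c * v\<^sup>\<star> * (y k * b k))"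
      by (rule sum.cong) (use b(1) in \<open>auto simp: y'_def mult.assoc left_diff_distrib\<close>)
    also have "\<dots> = s - y k0 * c * v\<^sup>\<star> * s" by (simp add: sum_subtractf sum_distrib_left s_def)
    also have "\<dots> = (\<Sum>k\<in>K. y k * b' k)"
      by (subst sum.remove[OF K k0(1)]) (simp add: b'_def s_def mult.assoc)
    finally have eq: "(\<Sum>k\<in>K. y k * b' k) = (\<Sum>k\<in>K - {k0}. y' k * b k)" by simp
    have sg: "s * g = s" unfolding s_def by (simp add: sum_distrib_right mult.assoc gb)
    show ?thesis
    proof (intro exI[of _ b'] conjI ballI)
      fix k assume k: "k \<in> K"
      have "g * (c * (v\<^sup>\<star> * s)) = c * (v\<^sup>\<star> * s)"
        using mult_assoc_rewrite[OF c(5)[symmetric]] mult_assoc_rewrite[OF gv] by (simp add: mult.assoc)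
      then show "g * b' k = b' k" using gb k by (simp add: b'_def)
      show "b' k * g = b' k" using gb k by (simp add: b'_def mult.assoc sg)
    next
      show "\<exists>k\<in>K. b' k \<noteq> 0" using b(2) by (auto simp: b'_def)
      fix h' assume "h' \<in> set (h # hs)"
      moreover have "h * (\<Sum>k\<in>K - {k0}. y' k * b k) = 0"
        by (simp add: sum_distrib_left mult.assoc[symmetric] hy')
      ultimately show "h' * (\<Sum>k\<in>K. y k * b' k) = 0" using b(3) unfolding eq by auto
    qed
  qed
qed

section \<open>The ideal generated by the finite projections\<close>

text \<open>On small central pieces the kernel of \<open>x\<close> contains the common kernel of
  finitely many abelian projections. Put in terms of kernels, the property passes to sums by
  concatenating the lists, so it reaches the whole span of the finite projections.\<close>

definition locally_finite_rank :: "'a::aw_star_algebra \<Rightarrow> bool" where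
  "locally_finite_rank x \<longleftrightarrow> (\<forall>z. central_projection z \<and> z \<noteq> 0 \<longrightarrow>
     (\<exists>w hs. central_projection w \<and> w \<noteq> 0 \<and> z * w = w \<and> (\<forall>h\<in>set hs. abelian_projection h) \<and>
       (\<forall>u. w * u = u \<and> (\<forall>h\<in>set hs. h * u = 0) \<longrightarrow> x * u = 0)))"

lemma locally_finite_rank_add:
  assumes "locally_finite_rank x" "locally_finite_rank y"
  shows "locally_finite_rank (x + y)"
  unfolding locally_finite_rank_def
proof (intro allI impI)
  fix z :: 'a assume "central_projection z \<and> z \<noteq> 0"
  then obtain w1 hs1 where 1: "central_projection w1" "w1 \<noteq> 0" "z * w1 = w1" "\<forall>h\<in>set hs1. abelian_projection h"
    "\<forall>u. w1 * u = u \<and> (\<forall>h\<in>set hs1. h * u = 0) \<longrightarrow> x * u = 0"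
    using assms(1) unfolding locally_finite_rank_def by blast
  then obtain w2 hs2 where 2: "central_projection w2" "w2 \<noteq> 0" "w1 * w2 = w2" "\<forall>h\<in>set hs2. abelian_projection h"
    "\<forall>u. w2 * u = u \<and> (\<forall>h\<in>set hs2. h * u = 0) \<longrightarrow> y * u = 0"
    using assms(2) unfolding locally_finite_rank_def by blast
  show "\<exists>w hs. central_projection w \<and> w \<noteq> 0 \<and> z * w = w \<and> (\<forall>h\<in>set hs. abelian_projection h) \<and>
       (\<forall>u. w * u = u \<and> (\<forall>h\<in>set hs. h * u = 0) \<longrightarrow> (x + y) * u = 0)"
  proof (intro exI[of _ w2] exI[of _ "hs1 @ hs2"] conjI allI impI)
    show "z * w2 = w2" by (metis 1(3) 2(3) mult.assoc)
    fix u assume u: "w2 * u = u \<and> (\<forall>h\<in>set (hs1 @ hs2). h * u = 0)"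
    then have "w1 * u = u" by (metis 2(3) mult.assoc)
    then show "(x + y) * u = 0" using u 1(5) 2(5) by (simp add: distrib_right)
  qed (use 1 2 in auto)
qed

lemma locally_finite_rank_scaleC: "locally_finite_rank x \<Longrightarrow> locally_finite_rank (c *\<^sub>C x)"
  unfolding locally_finite_rank_def by (simp add: mult_scaleC_left) (metis scaleC_0_right)

lemma locally_finite_rank_finite:
  fixes f :: "'a::aw_star_algebra"
  assumes d: "discrete_algebra TYPE('a)" and f: "finite_projection f"
  shows "locally_finite_rank f"
  unfolding locally_finite_rank_def
proof (intro allI impI)
  fix z :: 'a assume "central_projection z \<and> z \<noteq> 0"
  then obtain w where w: "central_projection w" "w \<noteq> 0" "z * w = w" "sum_of_abelian (w * f)"
    using finite_locally_sum_of_abelian[OF d f] by metis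
  then obtain hs where hs: "\<forall>h\<in>set hs. abelian_projection h" "w * f = sum_list hs"
    unfolding sum_of_abelian_def by blast
  have "f * u = 0" if "w * u = u" "\<forall>h\<in>set hs. h * u = 0" for u
  proof -
    have "f * u = w * f * u" using that(1) by (metis central_commute[OF w(1)] mult.assoc)
    also have "\<dots> = 0" unfolding hs(2) using that(2) by (induction hs) (auto simp: distrib_right)
    finally show ?thesis .
  qed
  then show "\<exists>w hs. central_projection w \<and> w \<noteq> 0 \<and> z * w = w \<and> (\<forall>h\<in>set hs. abelian_projection h) \<and>
       (\<forall>u. w * u = u \<and> (\<forall>h\<in>set hs. h * u = 0) \<longrightarrow> f * u = 0)"
    using w hs by blast
qed

lemma locally_finite_rank_span:
  fixes x :: "'a::aw_star_algebra"
  assumes d: "discrete_algebra TYPE('a)" and x: "x \<in> cspan {e. finite_projection e}"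
  shows "locally_finite_rank x"
  using x
proof (induction rule: complex_vector.span_induct)
  case base
  have "locally_finite_rank (0::'a)"
    using locally_finite_rank_scaleC[OF locally_finite_rank_finite[OF d abelian_imp_finite[OF abelian_projection_0]], of 0]
    by simp
  then show ?case
    unfolding complex_vector.subspace_def
    using locally_finite_rank_add locally_finite_rank_scaleC by auto
next
  case (step x)
  then show ?case using locally_finite_rank_finite[OF d] by simp
qed

text \<open>If \<open>u\<close> is a proper isometry of \<open>p M p\<close>, then below \<open>r = p - u u\<^sup>\<star>\<close> there is an abelian \<open>g\<close>
  and the \<open>u\<^sup>k g\<close> are infinitely many orthogonal copies of it; a combination of them
  is annihilated by an element of locally finite rank that is close to \<open>p\<close>.\<close>

lemma projection_in_ideal_imp_finite:
  fixes p :: "'a::aw_star_algebra"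
  assumes d: "discrete_algebra TYPE('a)" and p: "is_projection p" "p \<in> finite_projection_ideal"
  shows "finite_projection p"
proof (rule finite_projectionI[OF p(1)], rule ccontr)
  fix u assume u: "u\<^sup>\<star> * u = p" "is_projection (u * u\<^sup>\<star>)" "u * u\<^sup>\<star> * p = u * u\<^sup>\<star>" and ne: "u * u\<^sup>\<star> \<noteq> p"
  \<comment> \<open>Any distance below 1 would do: the aim is a nonzero \<open>U\<close> with
    \<open>U = (p - x) * U\<close>.\<close>
  obtain x where x: "x \<in> cspan {e. finite_projection e}" "dist x p < 1/2"
    using p(2) unfolding finite_projection_ideal_def closure_approachable by (metis half_gt_zero_iff zero_less_one)
  have lx: "locally_finite_rank x" by (rule locally_finite_rank_span[OF d x(1)])
  define r where "r = p - u * u\<^sup>\<star>"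
  have pr: "is_projection r" unfolding r_def by (rule is_projection_diff[OF u(2) p(1) u(3)])
  have r0: "r \<noteq> 0" using ne by (simp add: r_def)
  have up: "u * p = u" using partial_isometry_mult[of u] u(1) p(1) by simp
  have uuu: "u * (u\<^sup>\<star> * u) = u" by (simp add: u(1) up)
  have pq: "p * (u * u\<^sup>\<star>) = u * u\<^sup>\<star>" by (rule projection_le_commute[OF u(2) p(1) u(3)])
  have pu: "p * u = u" by (metis pq uuu mult.assoc)
  have pr': "p * r = r" by (simp add: r_def right_diff_distrib pq projection_idem[OF p(1)])
  have ru: "r * u = 0" by (simp add: r_def left_diff_distrib mult.assoc u(1) up pu)
  obtain c where c: "central_projection c" "c * r = r" "\<And>t. (\<And>y. r\<^sup>\<star> * (y * t) = 0) \<Longrightarrow> c * t = 0"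
    using central_support by blast
  have "c \<noteq> 0" using c(2) r0 by auto
  \<comment> \<open>The piece is taken below the central support of \<open>r\<close>, so that
    \<open>w * r \<noteq> 0\<close>.\<close>
  then obtain w hs where w: "central_projection w" "w \<noteq> 0" "c * w = w" "\<forall>h\<in>set hs. abelian_projection h"
    "\<forall>u. w * u = u \<and> (\<forall>h\<in>set hs. h * u = 0) \<longrightarrow> x * u = 0"
    using lx c(1) unfolding locally_finite_rank_def by blast
  have "w * r \<noteq> 0"
  proof
    assume wr: "w * r = 0"
    have "c * w = 0"
    proof (rule c(3))
      fix y
      have "r * (y * w) = w * r * y" using central_commute[OF w(1)] by (metis mult.assoc)
      then show "r\<^sup>\<star> * (y * w) = 0" by (simp add: projection_star[OF pr] wr)
    qed
    then show False using w(2,3) by simp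
  qed
  then obtain g where g: "abelian_projection g" "g \<noteq> 0" "g * (w * r) = g" "w * r * g = g"
    using abelian_below_discrete[OF d is_projection_central_mult[OF w(1) pr]] by blast
  note pg = abelian_is_projection[OF g(1)]
  have wg: "w * g = g" using g(4) central_idem_left[OF w(1)] by (metis mult.assoc)
  have rg: "r * g = g" using g(4) wg central_commute[OF w(1)] by (metis mult.assoc)
  have gr: "g * r = g" using arg_cong[OF rg, of star] by (simp add: star_mult projection_star[OF pg] projection_star[OF pr])
  have gu: "g * u = 0" by (metis gr ru mult.assoc mult_zero_right)
  define v where "v = rec_nat g (\<lambda>_ x. u * x)"
  have v0: "v 0 = g" and vS: "v (Suc k) = u * v k" for k by (simp_all add: v_def)
  have pv: "p * v k = v k" for k
  proof (cases k)
    case 0 then show ?thesis by (metis v0 rg pr' mult.assoc)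
  next
    case (Suc j) then show ?thesis by (metis vS pu mult.assoc)
  qed
  have wv: "w * v k = v k" for k
    by (induction k) (simp_all add: v0 vS wg central_left_commute[OF w(1), of u, symmetric])
  have vg: "v k * g = v k" for k
    by (induction k) (simp_all add: v0 vS projection_idem[OF pg] mult.assoc)
  \<comment> \<open>The \<open>v k\<close> are orthonormal over the corner of \<open>g\<close>:
    \<open>u\<^sup>\<star> * u = p\<close> cancels common powers of \<open>u\<close>, and
    \<open>g * u = 0\<close> since \<open>g\<close> lies below \<open>r\<close>.\<close>
  have vv: "(v k)\<^sup>\<star> * v l = (if k = l then g else 0)" for k l
  proof (induction k arbitrary: l)
    case 0
    show ?case
      by (cases l) (simp_all add: v0 vS projection_star[OF pg] projection_idem[OF pg] mult_assoc_rewrite[OF gu])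
  next
    case (Suc k)
    show ?case
    proof (cases l)
      case 0
      have "u\<^sup>\<star> * g = 0" using arg_cong[OF gu, of star] by (simp add: star_mult projection_star[OF pg])
      then show ?thesis by (simp add: 0 v0 vS star_mult mult.assoc)
    next
      case l: (Suc j)
      have "(v (Suc k))\<^sup>\<star> * v (Suc j) = (v k)\<^sup>\<star> * ((u\<^sup>\<star> * u) * v j)" by (simp add: vS star_mult mult.assoc)
      then show ?thesis using Suc[of j] by (simp add: u(1) pv l)
    qed
  qed
  \<comment> \<open>There are \<open>length hs + 1\<close> unknowns for \<open>length hs\<close>
    equations.\<close>
  obtain b where b: "\<forall>k\<in>{..length hs}. g * b k = b k \<and> b k * g = b k" "\<exists>k\<in>{..length hs}. b k \<noteq> 0"
    "\<forall>h\<in>set hs. h * (\<Sum>k\<in>{..length hs}. v k * b k) = 0"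
    using abelian_elimination[OF w(4) g(1,2), of "{..length hs}" v] vg by auto
  define U where "U = (\<Sum>k\<in>{..length hs}. v k * b k)"
  have pU: "p * U = U" and wU: "w * U = U"
    by (simp_all add: U_def sum_distrib_left mult.assoc[symmetric] pv wv)
  obtain j where j: "j \<le> length hs" "b j \<noteq> 0" using b(2) by auto
  \<comment> \<open>By orthonormality the coefficients of \<open>U\<close> can be recovered, so a
    nontrivial solution gives \<open>U \<noteq> 0\<close>.\<close>
  have "(v j)\<^sup>\<star> * U = (\<Sum>k\<in>{..length hs}. if k = j then b j else 0)"
    unfolding U_def sum_distrib_left
    by (rule sum.cong) (use b(1) in \<open>auto simp: mult.assoc[symmetric] vv\<close>)
  also have "\<dots> = b j" using j(1) by simp
  finally have U0: "U \<noteq> 0" using j(2) by auto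
  have "x * U = 0" using w(5) wU b(3) by (auto simp: U_def)
  then have "U = (p - x) * U" by (simp add: left_diff_distrib pU)
  then have "norm U \<le> norm (p - x) * norm U" by (metis norm_mult_ineq)
  moreover have "norm (p - x) < 1/2" using x(2) by (simp add: dist_norm norm_minus_commute)
  ultimately have "norm U \<le> 1/2 * norm U" by (meson less_imp_le mult_right_mono norm_ge_zero order.trans)
  then show False using U0 by simp
qed

section \<open>Absorption of multiplication by the closed span\<close>

lemma bounded_linear_scaleC: "bounded_linear (\<lambda>x::'a::cstar_algebra. c *\<^sub>C x)"
  by (rule bounded_linear_intro[where K = "cmod c"])
    (simp_all add: scaleC_add_right scaleC_scaleR norm_scaleC mult.commute)

lemma bounded_linear_star: "bounded_linear (star :: 'a::cstar_algebra \<Rightarrow> 'a)"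
  by (rule bounded_linear_intro[where K = 1]) (simp_all add: star_simps)

lemma csubspace_closure:
  assumes "csubspace S"
  shows "csubspace (closure S)"
  unfolding complex_vector.subspace_def
proof (intro conjI ballI allI)
  have S: "0 \<in> S" "\<And>x y. x \<in> S \<Longrightarrow> y \<in> S \<Longrightarrow> x + y \<in> S" "\<And>c x. x \<in> S \<Longrightarrow> c *\<^sub>C x \<in> S"
    using assms unfolding complex_vector.subspace_def by auto
  show "0 \<in> closure S" using S(1) closure_subset by blast
  show "x + y \<in> closure S" if "x \<in> closure S" "y \<in> closure S" for x y
  proof -
    have "\<exists>w\<in>S. dist w (x + y) < e" if e: "e > 0" for e
    proof -
      have "e / 2 > 0" using e by simp
      then obtain v w where "v \<in> S" "dist v x < e / 2" "w \<in> S" "dist w y < e / 2"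
        using \<open>x \<in> closure S\<close> \<open>y \<in> closure S\<close> unfolding closure_approachable by metis
      moreover from this have "dist (v + w) (x + y) < e" using dist_triangle_add[of v w x y] by linarith
      ultimately show ?thesis using S(2) by blast
    qed
    then show ?thesis by (simp add: closure_approachable)
  qed
  show "c *\<^sub>C x \<in> closure S" if "x \<in> closure S" for c x
    using image_closure_subset[of S "\<lambda>x. c *\<^sub>C x" "closure S"] that S(3) closure_subset[of S]
      linear_continuous_on[OF bounded_linear_scaleC, of "closure S" c] by blast
qed

lemma csubspace_ideal: "csubspace finite_projection_ideal"
  unfolding finite_projection_ideal_def
  by (rule csubspace_closure) (rule complex_vector.subspace_span)

lemma ideal_0: "0 \<in> finite_projection_ideal"
  and ideal_add: "x \<in> finite_projection_ideal \<Longrightarrow> y \<in> finite_projection_ideal \<Longrightarrow> x + y \<in> finite_projection_ideal"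
  and ideal_scaleC: "x \<in> finite_projection_ideal \<Longrightarrow> c *\<^sub>C x \<in> finite_projection_ideal"
  using csubspace_ideal by (auto simp: complex_vector.subspace_def)

lemmas ideal_diff = complex_vector.subspace_diff[OF csubspace_ideal]

lemma ideal_scaleR: "x \<in> finite_projection_ideal \<Longrightarrow> r *\<^sub>R x \<in> finite_projection_ideal"
  by (metis ideal_scaleC scaleC_of_real)

lemma closed_ideal: "closed finite_projection_ideal"
  by (simp add: finite_projection_ideal_def)

lemma span_subset_ideal: "cspan {e. finite_projection e} \<subseteq> finite_projection_ideal"
  by (simp add: finite_projection_ideal_def closure_subset)

lemma finite_in_ideal: "finite_projection e \<Longrightarrow> e \<in> finite_projection_ideal"
  using span_subset_ideal complex_vector.span_base by blast

lemma in_ideal_if_approx: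
  assumes "\<And>e. e > 0 \<Longrightarrow> \<exists>y\<in>finite_projection_ideal. norm (y - x) < e"
  shows "x \<in> finite_projection_ideal"
  by (rule closed_approachable[OF closed_ideal, THEN iffD1]) (simp add: dist_norm assms)

text \<open>The condition on scalars is weaker than complex linearity, so that the conjugate-linear
  \<open>star\<close> is covered as well.\<close>

lemma ideal_map:
  assumes T: "bounded_linear T" and scale: "\<And>c x. T x \<in> finite_projection_ideal \<Longrightarrow> T (c *\<^sub>C x) \<in> finite_projection_ideal"
    and gen: "\<And>p. finite_projection p \<Longrightarrow> T p \<in> finite_projection_ideal" and x: "x \<in> finite_projection_ideal"
  shows "T x \<in> finite_projection_ideal"
proof -
  interpret T: bounded_linear T by (rule T)
  have "T y \<in> finite_projection_ideal" if "y \<in> cspan {e. finite_projection e}" for y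
    using that
  proof (induction rule: complex_vector.span_induct)
    case base
    show ?case
      unfolding complex_vector.subspace_def
      using ideal_0 ideal_add scale by (auto simp: T.zero T.add)
  qed (use gen in simp)
  then have "T ` closure (cspan {e. finite_projection e}) \<subseteq> finite_projection_ideal"
    by (intro image_closure_subset closed_ideal linear_continuous_on T) blast
  then show ?thesis using x by (auto simp: finite_projection_ideal_def)
qed

lemma ideal_star: "x \<in> finite_projection_ideal \<Longrightarrow> x\<^sup>\<star> \<in> finite_projection_ideal"
  by (rule ideal_map[OF bounded_linear_star])
    (auto simp: star_simps ideal_scaleC finite_in_ideal projection_star finite_is_projection)

lemma cartesian_decomposition:
  fixes x :: "'a::cstar_algebra"
  obtains a b where "a\<^sup>\<star> = a" "b\<^sup>\<star> = b" "x = a + \<i> *\<^sub>C b" "a = (1/2) *\<^sub>C (x + x\<^sup>\<star>)" "b = (-\<i>/2) *\<^sub>C (x - x\<^sup>\<star>)"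
proof (rule that[of "(1/2) *\<^sub>C (x + x\<^sup>\<star>)" "(-\<i>/2) *\<^sub>C (x - x\<^sup>\<star>)"])
  show "((1/2) *\<^sub>C (x + x\<^sup>\<star>))\<^sup>\<star> = (1/2) *\<^sub>C (x + x\<^sup>\<star>)" by (simp add: star_simps add.commute)
  show "((-\<i>/2) *\<^sub>C (x - x\<^sup>\<star>))\<^sup>\<star> = (-\<i>/2) *\<^sub>C (x - x\<^sup>\<star>)"
    by (simp add: star_simps complex_vector.scale_right_diff_distrib)
  have "x = (1/2 + 1/2) *\<^sub>C x" by simp
  then show "x = (1/2) *\<^sub>C (x + x\<^sup>\<star>) + \<i> *\<^sub>C ((-\<i>/2) *\<^sub>C (x - x\<^sup>\<star>))"
    unfolding scaleC_add_left by (simp add: scaleC_simps scaleC_scaleC)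
qed (rule refl)+

text \<open>For self-adjoint \<open>k\<close> and small \<open>t\<close>, \<open>u = t k + \<i> (1 - t\<^sup>2 k\<^sup>2)\<^sup>1\<^sup>/\<^sup>2\<close> is unitary, and
  \<open>(u p u\<^sup>\<star> - u\<^sup>\<star> p u) / (2 \<i> t)\<close> tends to \<open>p k - k p\<close>.\<close>

lemma commutator_self_adjoint_in_ideal:
  fixes k :: "'a::aw_star_algebra"
  assumes p: "finite_projection p" and k: "k\<^sup>\<star> = k"
  shows "p * k - k * p \<in> finite_projection_ideal"
proof (rule in_ideal_if_approx)
  fix \<epsilon> :: real assume eps: "\<epsilon> > 0"
  define N where "N = norm k + 1"
  have N: "N \<ge> 1" "norm k \<le> N" by (simp_all add: N_def)
  \<comment> \<open>The first bound gives \<open>norm (t *\<^sub>R k) \<le> 1\<close>, so the root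
    exists. The second makes each of the two error terms at most \<open>t * N ^ 3\<close>, hence at
    most a third of \<epsilon>.\<close>
  define t where "t = min (1 / N) (\<epsilon> / (3 * N ^ 3))"
  have t: "t > 0" "t \<le> 1 / N" "t \<le> \<epsilon> / (3 * N ^ 3)" using N eps by (auto simp: t_def)
  have tN: "t * N \<le> 1" using t(2) N by (simp add: field_simps)
  have t1: "t \<le> 1" using t(2) N by (smt (verit) divide_le_eq_1_pos)
  define y where "y = (t *\<^sub>R k) * (t *\<^sub>R k)"
  have ys: "y\<^sup>\<star> = y" by (simp add: y_def star_simps k)
  have "norm (t *\<^sub>R k) \<le> t * N" using N t by simp
  then have ny: "norm y \<le> (t * N) * (t * N)"
    unfolding y_def using norm_mult_ineq[of "t *\<^sub>R k" "t *\<^sub>R k"] by (smt (verit) mult_mono norm_ge_zero)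
  have "(t * N) * (t * N) \<le> 1" using tN t(1) N by (simp add: mult_le_one)
  then have "norm y \<le> 1" using ny by simp
  then obtain r where r: "r\<^sup>\<star> = r" "(1 - r) * (1 - r) = 1 - y" "norm r \<le> norm y"
    "\<And>w. w * y = y * w \<Longrightarrow> w * r = r * w"
    using sqrt_one_minus[OF ys] by metis
  define s where "s = 1 - r"
  have ss: "s\<^sup>\<star> = s" and s2: "s * s = 1 - y" by (simp_all add: s_def star_simps r(1) r(2))
  have kr: "k * r = r * k" by (rule r(4)) (simp add: y_def mult.assoc)
  then have ks: "k * s = s * k" by (simp add: s_def algebra_simps)
  define u where "u = t *\<^sub>R k + \<i> *\<^sub>C s"
  have us: "u\<^sup>\<star> = t *\<^sub>R k - \<i> *\<^sub>C s" by (simp add: u_def star_simps k ss)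
  have uu: "u\<^sup>\<star> * u = 1" "u * u\<^sup>\<star> = 1"
    unfolding us unfolding u_def
    by (simp_all add: distrib_left distrib_right left_diff_distrib right_diff_distrib mult_scaleC_left mult_scaleC_right
        scaleC_scaleC s2 scaleC_minus_one ks scaleC_scaleR)
      (simp_all add: y_def scaleC_simps scaleC_scaleC scaleC_minus_one scaleC_scaleR scaleR_right_distrib scaleR_right_diff_distrib)
  have uu2: "(u\<^sup>\<star>)\<^sup>\<star> * u\<^sup>\<star> = 1" "u\<^sup>\<star> * (u\<^sup>\<star>)\<^sup>\<star> = 1" using uu by (simp_all add: star_star)
  have A: "u * p * u\<^sup>\<star> - u\<^sup>\<star> * p * (u\<^sup>\<star>)\<^sup>\<star> \<in> finite_projection_ideal"
    by (intro ideal_diff finite_in_ideal finite_projection_conj p uu uu2)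
  have "u * p * u\<^sup>\<star> - u\<^sup>\<star> * p * (u\<^sup>\<star>)\<^sup>\<star> = (2 * \<i> * complex_of_real t) *\<^sub>C (s * p * k - k * p * s)"
  proof -
    define d where "d = \<i> *\<^sub>C (t *\<^sub>R (s * p * k - k * p * s))"
    have "u * p * u\<^sup>\<star> - u\<^sup>\<star> * p * u = d + d"
      unfolding us unfolding u_def d_def
      by (simp add: distrib_left distrib_right left_diff_distrib right_diff_distrib scaleC_scaleR scaleC_simps
          scaleR_right_diff_distrib scaleR_right_distrib)
    also have "d = (\<i> * complex_of_real t) *\<^sub>C (s * p * k - k * p * s)"
      by (simp add: d_def scaleC_of_real[symmetric] scaleC_scaleC)
    also have "\<dots> + \<dots> = (2 * \<i> * complex_of_real t) *\<^sub>C (s * p * k - k * p * s)"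
      by (simp flip: scaleC_add_left)
    finally show ?thesis by (simp add: star_star)
  qed
  then have "(1 / (2 * \<i> * complex_of_real t)) *\<^sub>C ((2 * \<i> * complex_of_real t) *\<^sub>C (s * p * k - k * p * s))
    \<in> finite_projection_ideal" using ideal_scaleC[OF A] by metis
  then have B: "s * p * k - k * p * s \<in> finite_projection_ideal" using t(1) by (simp add: scaleC_scaleC)
  have pn: "norm p \<le> 1" by (rule norm_projection_le[OF finite_is_projection[OF p]])
  have nr: "norm r \<le> t * (N * N)"
  proof -
    have "t * N * (t * N) = t * (t * (N * N))" by simp
    also have "\<dots> \<le> t * (1 * (N * N))" using t(1) t1 N by (intro mult_left_mono mult_right_mono) auto
    finally show ?thesis using r(3) ny by simp
  qed
  have b1: "norm (r * p * k) \<le> norm r * norm k" "norm (k * p * r) \<le> norm r * norm k"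
  proof -
    have "norm (r * p) \<le> norm r" "norm (p * r) \<le> norm r"
      using norm_projection_mult_le[OF finite_is_projection[OF p]] by auto
    then show "norm (r * p * k) \<le> norm r * norm k" "norm (k * p * r) \<le> norm r * norm k"
      using norm_mult_ineq[of "r * p" k] norm_mult_ineq[of k "p * r"]
      by (simp_all add: mult.assoc mult.commute[of "norm r"]) (smt (verit) mult_left_mono mult_right_mono norm_ge_zero mult.commute)+
  qed
  \<comment> \<open>Replacing the root \<open>s = 1 - r\<close> by \<open>1\<close> leaves only
    terms with \<open>r\<close>, which is of order \<open>t\<close>.\<close>
  have eq: "s * p * k - k * p * s - (p * k - k * p) = k * p * r - r * p * k"
    by (simp add: s_def algebra_simps)
  have "norm (s * p * k - k * p * s - (p * k - k * p)) \<le> norm r * norm k + norm r * norm k"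
    unfolding eq using norm_triangle_ineq4[of "k * p * r" "r * p * k"] b1 by linarith
  also have "norm r * norm k \<le> t * (N * N) * N" using nr N t(1) by (intro mult_mono) auto
  also have "t * (N * N) * N = t * N ^ 3" by (simp add: power3_eq_cube)
  also have "t * N ^ 3 \<le> \<epsilon> / 3" using t(3) N by (simp add: field_simps)
  finally have "norm (s * p * k - k * p * s - (p * k - k * p)) \<le> \<epsilon> / 3 + \<epsilon> / 3" by simp
  then have "norm (s * p * k - k * p * s - (p * k - k * p)) < \<epsilon>" using eps by linarith
  then show "\<exists>y\<in>finite_projection_ideal. norm (y - (p * k - k * p)) < \<epsilon>" using B by blast
qed

lemma commutator_in_ideal:
  fixes x :: "'a::aw_star_algebra"
  assumes p: "finite_projection p"
  shows "p * x - x * p \<in> finite_projection_ideal"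
proof -
  obtain a b where ab: "a\<^sup>\<star> = a" "b\<^sup>\<star> = b" "x = a + \<i> *\<^sub>C b" using cartesian_decomposition[of x] by metis
  have "p * x - x * p = (p * a - a * p) + \<i> *\<^sub>C (p * b - b * p)"
    by (simp add: ab(3) algebra_simps scaleC_simps)
  then show ?thesis
    using ideal_add[OF commutator_self_adjoint_in_ideal[OF p ab(1)] ideal_scaleC[OF commutator_self_adjoint_in_ideal[OF p ab(2)]]]
    by metis
qed

text \<open>One step of the dyadic expansion of an element between \<open>0\<close> and
  \<open>r *\<^sub>R p\<close>. The digit is the part below \<open>p\<close> of the spectral
  projection for the values above \<open>r/2\<close>; the rest lies between \<open>0\<close> and
  \<open>(r/2) *\<^sub>R p\<close>. The digit is finite because it lies below
  \<open>p\<close>.\<close>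

lemma binary_digit:
  fixes h :: "'a::aw_star_algebra"
  assumes p: "finite_projection p" and h: "pos h" "h * p = h" "pos (r *\<^sub>R p - h)"
  obtains e where "finite_projection e" "pos (h - (r/2) *\<^sub>R e)" "(h - (r/2) *\<^sub>R e) * p = h - (r/2) *\<^sub>R e"
    "pos ((r/2) *\<^sub>R p - (h - (r/2) *\<^sub>R e))"
proof -
  note pp = finite_is_projection[OF p]
  have ph: "p * h = h" using arg_cong[OF h(2), of star] by (simp add: star_mult pos_star[OF h(1)] projection_star[OF pp])
  obtain e where e: "is_projection e" "\<And>w. w * h = h * w \<Longrightarrow> w * e = e * w"
    "pos (h * e - (r/2) *\<^sub>R e)" "pos ((r/2) *\<^sub>R (1 - e) - h * (1 - e))"
    using spectral_projection_level[OF pos_star[OF h(1)]] by blast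
  have pe: "p * e = e * p" by (rule e(2)) (simp add: ph h(2))
  have he: "h * e = e * h" by (rule e(2)) simp
  note pr = projection_idem[OF pp] projection_idem_left[OF pp]
  have pep: "is_projection (e * p)" by (rule is_projection_mult[OF e(1) pp pe[symmetric]])
  have ple: "e * p * p = e * p" by (simp add: mult.assoc pr)
  have hep: "h * (e * p) = e * h" by (simp add: mult.assoc[symmetric] he) (simp add: mult.assoc h(2))
  have hep': "e * p * h = e * h" by (simp add: mult.assoc ph)
  have 1: "pos ((h * e - (r/2) *\<^sub>R e) * p)"
    by (rule pos_mult_projection[OF e(3) pp]) 
      (simp add: left_diff_distrib right_diff_distrib mult.assoc hep pe mult_assoc_rewrite[OF ph]
        mult_assoc_rewrite[OF pe] he ph h(2))
  have 2: "pos (h * (p - e * p))"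
    by (rule pos_mult_projection[OF h(1) is_projection_diff[OF pep pp ple]])
      (simp add: right_diff_distrib left_diff_distrib hep hep' ph h(2))
  have "h - (r/2) *\<^sub>R (e * p) = (h * e - (r/2) *\<^sub>R e) * p + h * (p - e * p)"
    by (simp add: left_diff_distrib right_diff_distrib mult.assoc h(2))
  then have A: "pos (h - (r/2) *\<^sub>R (e * p))" using pos_add[OF 1 2] by simp
  \<comment> \<open>For the upper bound: off \<open>e\<close> the element \<open>h\<close> is at
    most \<open>r/2\<close>, and on \<open>e\<close> it is at most \<open>r\<close>, of which
    \<open>r/2\<close> has been subtracted.\<close>
  have 3: "pos (((r/2) *\<^sub>R (1 - e) - h * (1 - e)) * p)"
    by (rule pos_mult_projection[OF e(4) pp])
      (simp add: left_diff_distrib right_diff_distrib mult.assoc hep pe mult_assoc_rewrite[OF ph]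
        mult_assoc_rewrite[OF pe] he h(2) ph)
  have 4: "pos ((r *\<^sub>R p - h) * e)"
    by (rule pos_mult_projection[OF h(3) e(1)]) (simp add: left_diff_distrib right_diff_distrib pe he)
  have "r *\<^sub>R (e * p) = (r/2) *\<^sub>R (e * p) + (r/2) *\<^sub>R (e * p)" by (simp flip: scaleR_add_left)
  then have "(r/2) *\<^sub>R p - (h - (r/2) *\<^sub>R (e * p)) = ((r/2) *\<^sub>R (1 - e) - h * (1 - e)) * p + (r *\<^sub>R p - h) * e"
    by (simp add: left_diff_distrib right_diff_distrib mult.assoc h(2) hep pe he scaleR_right_diff_distrib)
  then have B: "pos ((r/2) *\<^sub>R p - (h - (r/2) *\<^sub>R (e * p)))" using pos_add[OF 3 4] by simp
  show ?thesis
    by (rule that[OF finite_subprojection[OF p pep ple] A _ B]) (simp add: left_diff_distrib h(2) mult.assoc pr)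
qed

text \<open>After \<open>n\<close> binary digits the remainder has norm at most
  \<open>r / 2 ^ n\<close>, so \<open>h\<close> is a norm limit of real combinations of finite
  projections.\<close>

lemma pos_corner_in_ideal:
  fixes h :: "'a::aw_star_algebra"
  assumes p: "finite_projection p" and h: "pos h" "h * p = h" "pos (r *\<^sub>R p - h)" and r: "0 \<le> r"
  shows "h \<in> finite_projection_ideal"
proof (rule in_ideal_if_approx)
  note pp = finite_is_projection[OF p]
  have *: "\<exists>w\<in>finite_projection_ideal. pos (h - w) \<and> (h - w) * p = h - w \<and> pos ((r / 2 ^ n) *\<^sub>R p - (h - w))" for n
  proof (induction n)
    case 0
    show ?case by (rule bexI[OF _ ideal_0]) (use h in simp)
  next
    case (Suc n)
    then obtain w where w: "w \<in> finite_projection_ideal" "pos (h - w)" "(h - w) * p = h - w"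
      "pos ((r / 2 ^ n) *\<^sub>R p - (h - w))" by blast
    obtain e where e: "finite_projection e" "pos (h - w - (r / 2 ^ n / 2) *\<^sub>R e)"
      "(h - w - (r / 2 ^ n / 2) *\<^sub>R e) * p = h - w - (r / 2 ^ n / 2) *\<^sub>R e"
      "pos ((r / 2 ^ n / 2) *\<^sub>R p - (h - w - (r / 2 ^ n / 2) *\<^sub>R e))"
      by (rule binary_digit[OF p w(2-4)])
    have eq: "h - w - (r / 2 ^ n / 2) *\<^sub>R e = h - (w + (r / 2 ^ Suc n) *\<^sub>R e)" by (simp add: field_simps)
    have r2: "r / 2 ^ n / 2 = r / 2 ^ Suc n" by simp
    show ?case
      by (rule bexI[of _ "w + (r / 2 ^ Suc n) *\<^sub>R e"])
        (use e[unfolded eq, unfolded r2] ideal_add[OF w(1) ideal_scaleR[OF finite_in_ideal[OF e(1)]]] in auto)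
  qed
  fix \<epsilon> :: real assume eps: "\<epsilon> > 0"
  obtain n where n: "r / \<epsilon> < 2 ^ n" using real_arch_pow[of 2 "r / \<epsilon>"] by auto
  obtain w where w: "w \<in> finite_projection_ideal" "pos (h - w)" "pos ((r / 2 ^ n) *\<^sub>R p - (h - w))" using * by blast
  have "pos (((r / 2 ^ n) *\<^sub>R p - (h - w)) + (r / 2 ^ n) *\<^sub>R (1 - p))"
    by (intro pos_add w pos_scaleR pos_projection is_projection_compl pp) (use r in simp)
  moreover have "((r / 2 ^ n) *\<^sub>R p - (h - w)) + (r / 2 ^ n) *\<^sub>R (1 - p) = (r / 2 ^ n) *\<^sub>R 1 - (h - w)"
    by (simp add: algebra_simps)
  ultimately have "norm (h - w) \<le> r / 2 ^ n" using norm_le_if_pos[OF w(2)] r by simp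
  also have "\<dots> < \<epsilon>" using n eps by (simp add: field_simps)
  finally show "\<exists>y\<in>finite_projection_ideal. norm (y - h) < \<epsilon>" using w(1) by (metis norm_minus_commute)
qed

lemma corner_in_ideal:
  fixes x :: "'a::aw_star_algebra"
  assumes p: "finite_projection p"
  shows "p * x * p \<in> finite_projection_ideal"
proof -
  note pp = finite_is_projection[OF p]
  have sa: "p * a * p \<in> finite_projection_ideal" if a: "a\<^sup>\<star> = a" for a
  proof -
    define k where "k = p * a * p"
    define T where "T = norm k"
    have ks: "k\<^sup>\<star> = k" by (simp add: k_def star_mult projection_star[OF pp] a mult.assoc)
    have kp: "k * p = k" "p * k = k" by (simp_all add: k_def mult.assoc projection_idem[OF pp] projection_idem_left[OF pp])
    have pl: "pos ((T *\<^sub>R 1 - k) * p)"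
      by (rule pos_mult_projection[OF pos_diff_if_norm_le[OF ks] pp])
        (simp_all add: T_def left_diff_distrib right_diff_distrib kp)
    have "(- k)\<^sup>\<star> = - k" "norm (- k) \<le> T" by (simp_all add: ks T_def)
    from pos_diff_if_norm_le[OF this] have "pos ((T *\<^sub>R 1 - (- k)) * p)"
      by (rule pos_mult_projection[OF _ pp]) (simp add: left_diff_distrib right_diff_distrib distrib_left distrib_right kp)
    \<comment> \<open>Shifting \<open>k\<close> by its norm inside the corner moves it between
      \<open>0\<close> and \<open>(2 * T) *\<^sub>R p\<close>.\<close>
    then have 1: "pos (k + T *\<^sub>R p)" by (simp add: distrib_right kp add.commute)
    have "(2 * T) *\<^sub>R p = T *\<^sub>R p + T *\<^sub>R p" by (simp flip: scaleR_add_left)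
    then have 2: "pos ((2 * T) *\<^sub>R p - (k + T *\<^sub>R p))" using pl by (simp add: left_diff_distrib kp)
    have "k + T *\<^sub>R p \<in> finite_projection_ideal"
      by (rule pos_corner_in_ideal[OF p 1 _ 2]) (simp_all add: distrib_right kp projection_idem[OF pp] T_def)
    then have "k + T *\<^sub>R p - T *\<^sub>R p \<in> finite_projection_ideal"
      by (rule ideal_diff) (intro ideal_scaleR finite_in_ideal p)
    then show ?thesis by (simp add: k_def)
  qed
  obtain a b where ab: "a\<^sup>\<star> = a" "b\<^sup>\<star> = b" "x = a + \<i> *\<^sub>C b" using cartesian_decomposition[of x] by metis
  have "p * x * p = p * a * p + \<i> *\<^sub>C (p * b * p)"
    by (simp add: ab(3) algebra_simps scaleC_simps)
  then show ?thesis using ideal_add[OF sa[OF ab(1)] ideal_scaleC[OF sa[OF ab(2)]]] by metis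
qed

lemma ideal_mult_right:
  fixes a x :: "'a::aw_star_algebra"
  assumes "a \<in> finite_projection_ideal"
  shows "a * x \<in> finite_projection_ideal"
proof (rule ideal_map[OF bounded_linear_mult_left _ _ assms])
  fix p :: 'a assume p: "finite_projection p"
  note pp = finite_is_projection[OF p]
  \<comment> \<open>An off-diagonal element equals its own commutator with \<open>p\<close>, as
    \<open>p * y = y\<close> and \<open>y * p = 0\<close>.\<close>
  define y where "y = p * x * (1 - p)"
  have "p * y - y * p = y" by (simp add: y_def algebra_simps projection_idem[OF pp] projection_idem_left[OF pp])
  then have "y \<in> finite_projection_ideal" using commutator_in_ideal[OF p] by metis
  then have "p * x * p + y \<in> finite_projection_ideal" by (intro ideal_add corner_in_ideal p)
  moreover have "p * x * p + y = p * x" by (simp add: y_def algebra_simps)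
  ultimately show "p * x \<in> finite_projection_ideal" by simp
qed (simp add: mult_scaleC_left ideal_scaleC)

lemma ideal_mult_left:
  fixes a x :: "'a::aw_star_algebra"
  assumes "a \<in> finite_projection_ideal"
  shows "x * a \<in> finite_projection_ideal"
  using ideal_star[OF ideal_mult_right[OF ideal_star[OF assms], of "x\<^sup>\<star>"]] by (simp add: star_simps)

section \<open>Approximate units in a masa\<close>

lemma norm_central_cut_square:
  assumes "central_projection z"
  shows "(norm (z * y))\<^sup>2 = norm (z * (y\<^sup>\<star> * y))"
  using cstar_identity[of "z * y"]
  by (simp add: central_star_mult[OF assms] central_mult_mult[OF assms])

lemma pos_central_cut: "central_projection z \<Longrightarrow> pos (z * (y\<^sup>\<star> * (y::'a::aw_star_algebra)))"
  using pos_star_mult_self[of "z * y"]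
  by (simp add: central_star_mult central_mult_mult)

text \<open>With \<open>f\<close> abelian, \<open>y \<mapsto> y\<^sup>\<star> y\<close> takes values in the commutative algebra \<open>f M f\<close> on \<open>M f\<close>. There, comparing
  norms on all central pieces amounts to comparing functions pointwise.\<close>

lemma norm_le_if_central_cuts_le:
  fixes f q y :: "'a::aw_star_algebra"
  assumes f: "abelian_projection f" and y: "y * f = y" and q: "is_projection q"
    and le: "\<And>z. central_projection z \<Longrightarrow> (norm (z * y))\<^sup>2 \<le> (norm (z * ((1 - q) * y)))\<^sup>2 + d"
  shows "(norm (q * y))\<^sup>2 \<le> d"
proof (rule ccontr)
  assume "\<not> ?thesis"
  then have less: "d < (norm (q * y))\<^sup>2" by simp
  note pf = abelian_is_projection[OF f]
  have fy: "f * y\<^sup>\<star> = y\<^sup>\<star>" using arg_cong[OF y, of star] by (simp add: star_mult projection_star[OF pf])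
  define g h k where "g = (q * y)\<^sup>\<star> * (q * y)" and "h = y\<^sup>\<star> * y" and "k = ((1 - q) * y)\<^sup>\<star> * ((1 - q) * y)"
  have hgk: "h = g + k"
    by (simp add: g_def h_def k_def star_simps projection_star[OF q] algebra_simps projection_idem_left[OF q])
  have fg: "f * g = g" "g * f = g" and fh: "f * h = h" "h * f = h"
    by (simp_all add: g_def h_def star_mult mult.assoc y mult_assoc_rewrite[OF fy])
  have pg: "pos g" unfolding g_def by (rule pos_star_mult_self)
  have ng: "norm g = (norm (q * y))\<^sup>2" by (simp add: g_def cstar_identity)
  obtain \<epsilon> where eps: "d < \<epsilon>" "\<epsilon> < norm g" using less ng dense by metis
  define \<delta> where "\<delta> = max \<epsilon> (norm g / 2)"
  have g0: "norm g > 0"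
  proof -
    have "0 \<le> d" using le[of 0] by (simp add: central_projection_def)
    then show ?thesis using eps by linarith
  qed
  have del: "d < \<delta>" "\<delta> < norm g" "0 < \<delta>" using eps g0 by (simp_all add: \<delta>_def less_max_iff_disj)
  \<comment> \<open>\<open>e\<close> marks where \<open>g\<close> exceeds \<delta>. It lies below
    the abelian \<open>f\<close>, so it amounts to a central piece \<open>z\<close>, on which the
    hypothesis is then contradicted.\<close>
  obtain e where e: "is_projection e" "\<And>w. w * g = g * w \<Longrightarrow> w * e = e * w"
    "pos (g * e - \<delta> *\<^sub>R e)" "pos (\<delta> *\<^sub>R (1 - e) - g * (1 - e))"
    using spectral_projection_level[OF pos_star[OF pg]] by blast
  have e0: "e \<noteq> 0"
  proof
    assume "e = 0"
    then have "pos (\<delta> *\<^sub>R 1 - g)" using e(4) by simp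
    then have "norm g \<le> \<delta>" using norm_le_if_pos[OF pg] del by simp
    then show False using del by simp
  qed
  have fe: "f * e = e * f" by (rule e(2)) (simp add: fg)
  \<comment> \<open>Off \<open>f\<close> the element \<open>g\<close> vanishes, so it cannot be at
    least \<delta> there.\<close>
  have "e * f = e"
  proof -
    have com: "(1 - f) * e = e * (1 - f)" by (simp add: left_diff_distrib right_diff_distrib fe)
    have "g * e * (1 - f) = 0" by (simp add: right_diff_distrib mult.assoc fe[symmetric] mult_assoc_rewrite[OF fg(2)])
    moreover have "(1 - f) * (g * e) = 0" by (simp add: left_diff_distrib mult_assoc_rewrite[OF fg(1)])
    ultimately have "pos ((g * e - \<delta> *\<^sub>R e) * (1 - f))"
      by (intro pos_mult_projection e(3) is_projection_compl pf) (simp add: left_diff_distrib[of "g * e"] right_diff_distrib[of "1 - f"] com)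
    then have "pos (- (\<delta> *\<^sub>R (e * (1 - f))))" using \<open>g * e * (1 - f) = 0\<close> by (simp add: left_diff_distrib[of "g * e"])
    then have "pos ((1 / \<delta>) *\<^sub>R (- (\<delta> *\<^sub>R (e * (1 - f)))))" using del by (intro pos_scaleR) auto
    then have "pos (- (e * (1 - f)))" using del by simp
    moreover have "is_projection (e * (1 - f))"
      by (rule is_projection_mult[OF e(1) is_projection_compl[OF pf] com[symmetric]])
    ultimately have "e * (1 - f) = 0" by (rule pos_zero_if_neg_projection[rotated])
    then show ?thesis by (simp add: right_diff_distrib)
  qed
  then obtain z where z: "central_projection z" "e = z * f" using subprojection_of_abelian[OF f e(1)] by blast
  have ge: "g * e = z * g" by (simp add: z(2) central_left_commute[OF z(1), of g] fg)
  have he: "h * e = z * h" by (simp add: z(2) central_left_commute[OF z(1), of h] fh)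
  have eh: "e * h = z * h" by (simp add: z(2) mult.assoc fh)
  define r where "r = (norm (z * y))\<^sup>2"
  have r: "r = norm (z * h)" unfolding r_def h_def by (rule norm_central_cut_square[OF z(1)])
  have zh: "pos (z * h)" unfolding h_def by (rule pos_central_cut[OF z(1)])
  have zk: "pos (z * k)" unfolding k_def by (rule pos_central_cut[OF z(1)])
  have "pos ((r *\<^sub>R 1 - z * h) * e)"
    by (rule pos_mult_projection[OF pos_diff_if_norm_le[OF pos_star[OF zh]] e(1)])
      (simp_all add: r left_diff_distrib right_diff_distrib mult.assoc he central_left_commute[OF z(1), of e] eh)
  moreover have "(r *\<^sub>R 1 - z * h) * e = r *\<^sub>R e - z * h"
    by (simp add: left_diff_distrib mult.assoc he central_idem_left[OF z(1)])
  ultimately have "pos ((r *\<^sub>R e - z * h) + (z * g - \<delta> *\<^sub>R e))" using pos_add e(3) ge by simp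
  moreover have "(r *\<^sub>R e - z * h) + (z * g - \<delta> *\<^sub>R e) = (r - \<delta>) *\<^sub>R e - z * k"
    by (simp add: hgk algebra_simps)
  \<comment> \<open>On the piece, \<open>h\<close> is at most \<open>r\<close> and \<open>g\<close>
    at least \<delta>, so \<open>k = h - g\<close> is at most \<open>r - \<delta>\<close>. With
    \<open>d < \<delta>\<close> this is too small for the hypothesis.\<close>
  ultimately have A: "pos ((r - \<delta>) *\<^sub>R e - z * k)" by simp
  have rd: "\<delta> \<le> r"
  proof (rule ccontr)
    assume "\<not> \<delta> \<le> r"
    then have r\<delta>: "\<delta> - r > 0" by simp
    have "pos ((r - \<delta>) *\<^sub>R e)" using pos_add[OF A zk] by simp
    then have "pos ((1 / (\<delta> - r)) *\<^sub>R ((r - \<delta>) *\<^sub>R e))" by (rule pos_scaleR) (use r\<delta> in simp)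
    moreover have "(1 / (\<delta> - r)) *\<^sub>R ((r - \<delta>) *\<^sub>R e) = - e"
    proof -
      have "(1 / (\<delta> - r)) * (r - \<delta>) = - 1" using r\<delta> by (simp add: field_simps)
      then show ?thesis by (simp only: scaleR_scaleR) simp
    qed
    ultimately have "e = 0" using pos_zero_if_neg_projection[OF e(1)] by simp
    then show False using e0 by blast
  qed
  have "pos (((r - \<delta>) *\<^sub>R e - z * k) + (r - \<delta>) *\<^sub>R (1 - e))"
    by (intro pos_add A pos_scaleR pos_projection is_projection_compl e(1)) (use rd in simp)
  moreover have "((r - \<delta>) *\<^sub>R e - z * k) + (r - \<delta>) *\<^sub>R (1 - e) = (r - \<delta>) *\<^sub>R 1 - z * k"
    by (simp add: algebra_simps)
  ultimately have "norm (z * k) \<le> r - \<delta>" using norm_le_if_pos[OF zk] rd by simp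
  moreover have "r \<le> norm (z * k) + d"
    using le[OF z(1)] unfolding r_def k_def norm_central_cut_square[OF z(1), of "(1 - q) * y"] .
  ultimately show False using del by linarith
qed

lemma star_commute: "x * y = y * x \<Longrightarrow> x\<^sup>\<star> * y\<^sup>\<star> = y\<^sup>\<star> * (x::'a::cstar_algebra)\<^sup>\<star>"
  by (metis star_mult)

locale discrete_masa =
  fixes C :: "'a::aw_star_algebra set"
  assumes discrete: "discrete_algebra TYPE('a)" and masa: "masa finite_projection_ideal C"
begin

lemma C_ideal: "c \<in> C \<Longrightarrow> c \<in> finite_projection_ideal"
  and C_subspace: "csubspace C"
  and C_mult: "x \<in> C \<Longrightarrow> y \<in> C \<Longrightarrow> x * y \<in> C"
  and C_star: "x \<in> C \<Longrightarrow> x\<^sup>\<star> \<in> C"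
  and C_commute: "x \<in> C \<Longrightarrow> y \<in> C \<Longrightarrow> x * y = y * x"
  using masa by (auto simp: masa_def abelian_star_subalgebra_def)

lemmas C_0 = complex_vector.subspace_0[OF C_subspace]
  and C_add = complex_vector.subspace_add[OF C_subspace]
  and C_diff = complex_vector.subspace_diff[OF C_subspace]
  and C_scaleC = complex_vector.subspace_scale[OF C_subspace]

lemma commutant_star:
  assumes "x \<in> commutant C"
  shows "x\<^sup>\<star> \<in> commutant C"
proof -
  have "x\<^sup>\<star> * c = c * x\<^sup>\<star>" if "c \<in> C" for c
    using star_commute[of x "c\<^sup>\<star>"] C_star[OF that] assms by (simp add: commutant_def star_star)
  then show ?thesis by (simp add: commutant_def)
qed

text \<open>The double commutant of \<open>insert x C\<close>, cut down to the ideal, is an abelian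
  self-adjoint subalgebra containing \<open>C\<close> and \<open>x\<close>. It replaces a
  description of the algebra generated by them.\<close>

lemma self_adjoint_in_masa:
  assumes x: "x \<in> finite_projection_ideal" "x\<^sup>\<star> = x" "x \<in> commutant C"
  shows "x \<in> C"
proof -
  define S where "S = insert x C"
  have SS: "s * t = t * s" if "s \<in> S" "t \<in> S" for s t
    using that x(3) C_commute by (auto simp: S_def commutant_def)
  have Sstar: "s\<^sup>\<star> \<in> S" if "s \<in> S" for s using that C_star x(2) by (auto simp: S_def)
  define W where "W = {w. \<forall>s\<in>S. w * s = s * w}"
  define D where "D = {y \<in> finite_projection_ideal. \<forall>w\<in>W. w * y = y * w}"
  have Wstar: "w\<^sup>\<star> \<in> W" if "w \<in> W" for w
  proof -
    have "w\<^sup>\<star> * s = s * w\<^sup>\<star>" if "s \<in> S" for s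
      using star_commute[of w "s\<^sup>\<star>"] \<open>w \<in> W\<close> Sstar[OF that] by (simp add: W_def star_star)
    then show ?thesis by (simp add: W_def)
  qed
  have SD: "s \<in> D" if "s \<in> S" for s
    using that x(1) C_ideal unfolding D_def W_def by (auto simp: S_def)
  have "D \<subseteq> W"
  proof
    fix y assume y: "y \<in> D"
    have "S \<subseteq> W" using SS by (auto simp: W_def)
    then show "y \<in> W" using y unfolding D_def W_def by auto
  qed
  then have "\<forall>x\<in>D. \<forall>y\<in>D. x * y = y * x" by (auto simp: D_def)
  moreover have "csubspace D"
    unfolding complex_vector.subspace_def
    by (auto simp: D_def ideal_0 ideal_add ideal_scaleC distrib_left distrib_right mult_scaleC_left mult_scaleC_right)
  moreover have "y * y' \<in> D" if "y \<in> D" "y' \<in> D" for y y'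
    using that ideal_mult_right unfolding D_def by (auto simp: mult.assoc[symmetric]) (metis mult.assoc)
  moreover have "y\<^sup>\<star> \<in> D" if "y \<in> D" for y
  proof -
    have "w * y\<^sup>\<star> = y\<^sup>\<star> * w" if "w \<in> W" for w
      using star_commute[of y "w\<^sup>\<star>"] \<open>y \<in> D\<close> Wstar[OF that] by (simp add: D_def star_star)
    then show ?thesis using that ideal_star by (auto simp: D_def)
  qed
  ultimately have "abelian_star_subalgebra D" by (auto simp: abelian_star_subalgebra_def)
  moreover have "D \<subseteq> finite_projection_ideal" "C \<subseteq> D" using SD by (auto simp: D_def S_def)
  ultimately have "D = C" using masa by (simp add: masa_def)
  then show ?thesis using SD by (auto simp: S_def)
qed

text \<open>\<open>x\<close> is not known to be normal, so it cannot be adjoined to \<open>C\<close>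
  together with its adjoint. Its two self-adjoint parts are treated separately.\<close>

lemma in_masa:
  assumes x: "x \<in> finite_projection_ideal" "x \<in> commutant C"
  shows "x \<in> C"
proof -
  obtain a b where ab: "a\<^sup>\<star> = a" "b\<^sup>\<star> = b" "x = a + \<i> *\<^sub>C b" "a = (1/2) *\<^sub>C (x + x\<^sup>\<star>)" "b = (-\<i>/2) *\<^sub>C (x - x\<^sup>\<star>)"
    by (rule cartesian_decomposition)
  have xs: "x\<^sup>\<star> \<in> finite_projection_ideal" "x\<^sup>\<star> \<in> commutant C"
    using ideal_star[OF x(1)] commutant_star[OF x(2)] by auto
  have a: "a \<in> C"
    by (rule self_adjoint_in_masa[OF _ ab(1)])
      (use x xs in \<open>simp_all add: ab(4) ideal_scaleC ideal_add commutant_def mult_scaleC_left mult_scaleC_right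
        distrib_left distrib_right\<close>)
  have b: "b \<in> C"
    by (rule self_adjoint_in_masa[OF _ ab(2)])
      (use x xs in \<open>simp_all add: ab(5) ideal_scaleC ideal_diff commutant_def mult_scaleC_left mult_scaleC_right
        left_diff_distrib right_diff_distrib del: complex_vector.scale_minus_left\<close>)
  show ?thesis unfolding ab(3) by (intro C_add C_scaleC a b)
qed

section \<open>Projections of the masa and their gluing\<close>

definition masa_projections :: "'a set" where
  "masa_projections = {p \<in> C. is_projection p}"

lemma masa_projection: "p \<in> masa_projections \<Longrightarrow> is_projection p"
  and masa_projection_in: "p \<in> masa_projections \<Longrightarrow> p \<in> C"
  and masa_projection_commute: "p \<in> masa_projections \<Longrightarrow> q \<in> masa_projections \<Longrightarrow> p * q = q * p"
  by (auto simp: masa_projections_def C_commute)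

lemma masa_projection_0: "0 \<in> masa_projections"
  by (simp add: masa_projections_def C_0)

lemma masa_projection_join:
  assumes p: "p \<in> masa_projections" "q \<in> masa_projections"
  obtains j where "j \<in> masa_projections" "1 - j = (1 - q) * (1 - p)" "1 - j = (1 - p) * (1 - q)"
proof (rule that[of "p + q - p * q"])
  show "p + q - p * q \<in> masa_projections"
    using p is_projection_join[OF masa_projection[OF p(1)] masa_projection[OF p(2)] masa_projection_commute[OF p]]
    unfolding masa_projections_def by (blast intro: C_add C_diff C_mult)
qed (simp_all add: algebra_simps masa_projection_commute[OF p])

text \<open>\<open>P\<close> comes from an annihilator, so its membership in the ideal is not
  visible. But each \<open>p z\<close> is finite by \<open>projection_in_ideal_imp_finite\<close>,
  hence \<open>P\<close> is finite and lies in the ideal. It commutes with \<open>C\<close> piece by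
  piece, and maximality applies.\<close>

lemma masa_projection_glue:
  assumes Z: "central_partition Z" and p: "\<And>z. z \<in> Z \<Longrightarrow> p z \<in> masa_projections"
  obtains P where "P \<in> masa_projections" "\<And>z. z \<in> Z \<Longrightarrow> z * P = z * p z"
proof -
  obtain P where P: "is_projection P" "\<And>z. z \<in> Z \<Longrightarrow> z * P = z * p z"
    using glue_projections[OF Z, of p] masa_projection[OF p] by blast
  note cZ = central_partition_central[OF Z]
  have "finite_projection P"
  proof (rule finite_projection_central_partition[OF Z P(1)])
    fix z assume z: "z \<in> Z"
    note pz = masa_projection[OF p[OF z]]
    have "finite_projection (p z)"
      by (rule projection_in_ideal_imp_finite[OF discrete pz]) (rule C_ideal[OF masa_projection_in[OF p[OF z]]])
    then have "finite_projection (z * p z)"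
      by (rule finite_subprojection[OF _ is_projection_central_mult[OF cZ[OF z] pz]])
        (simp add: mult.assoc projection_idem[OF pz])
    then show "finite_projection (z * P)" by (simp add: P(2)[OF z])
  qed
  moreover have "P * c = c * P" if c: "c \<in> C" for c
  proof (rule central_partition_eq[OF Z])
    fix z assume z: "z \<in> Z"
    have "z * (P * c) = z * (p z * c)" by (simp add: mult.assoc[symmetric] P(2)[OF z])
    also have "p z * c = c * p z" by (rule C_commute[OF masa_projection_in[OF p[OF z]] c])
    also have "z * (c * p z) = z * (c * P)"
      by (simp add: central_left_commute[OF cZ[OF z], symmetric] P(2)[OF z])
    finally show "z * (P * c) = z * (c * P)" .
  qed
  ultimately have "P \<in> C" by (intro in_masa finite_in_ideal) (auto simp: commutant_def)
  then show ?thesis using that P by (auto simp: masa_projections_def)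
qed

text \<open>\<open>e\<close> is the spectral projection of \<open>h = c\<^sup>\<star> * c\<close>
  for the values above \<open>\<delta>\<^sup>2\<close>. It lies in the ideal because
  \<open>h\<close> is invertible on \<open>e\<close>: up to a geometrically small error,
  \<open>e\<close> is a sum of multiples of \<open>h\<close>.\<close>

lemma masa_spectral_projection:
  assumes c: "c \<in> C" and \<delta>: "\<delta> > 0"
  obtains q where "q \<in> masa_projections" "norm (c * (1 - q)) \<le> \<delta>"
proof -
  define h where "h = c\<^sup>\<star> * c"
  have hC: "h \<in> C" unfolding h_def by (intro C_mult C_star c)
  have ph: "pos h" unfolding h_def by (rule pos_star_mult_self)
  obtain e where e: "is_projection e" "\<And>w. w * h = h * w \<Longrightarrow> w * e = e * w"
    "pos (h * e - \<delta>\<^sup>2 *\<^sub>R e)" "pos (\<delta>\<^sup>2 *\<^sub>R (1 - e) - h * (1 - e))"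
    using spectral_projection_level[OF pos_star[OF ph]] by blast
  have he: "h * e = e * h" by (rule e(2)) simp
  have E: "is_projection (1 - e)" by (rule is_projection_compl[OF e(1)])
  have he': "h * (1 - e) = (1 - e) * h" by (simp add: left_diff_distrib right_diff_distrib he)
  have small: "norm (c * (1 - e)) \<le> \<delta>"
  proof -
    have "(c * (1 - e))\<^sup>\<star> * (c * (1 - e)) = (1 - e) * h * (1 - e)"
      by (simp only: star_mult projection_star[OF E] h_def mult.assoc)
    also have "\<dots> = h * (1 - e)" by (simp only: he'[symmetric] mult.assoc projection_idem[OF E])
    finally have eq: "(norm (c * (1 - e)))\<^sup>2 = norm (h * (1 - e))" by (metis cstar_identity)
    have "pos ((\<delta>\<^sup>2 *\<^sub>R (1 - e) - h * (1 - e)) + \<delta>\<^sup>2 *\<^sub>R e)"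
      by (intro pos_add e(4) pos_scaleR pos_projection e(1)) simp
    moreover have "(\<delta>\<^sup>2 *\<^sub>R (1 - e) - h * (1 - e)) + \<delta>\<^sup>2 *\<^sub>R e = \<delta>\<^sup>2 *\<^sub>R 1 - h * (1 - e)" by (simp add: algebra_simps)
    ultimately have "pos (\<delta>\<^sup>2 *\<^sub>R 1 - h * (1 - e))" by metis
    then have "norm (h * (1 - e)) \<le> \<delta>\<^sup>2"
      by (rule norm_le_if_pos[OF pos_mult_projection[OF ph E he']]) simp
    then have "(norm (c * (1 - e)))\<^sup>2 \<le> \<delta>\<^sup>2" unfolding eq .
    then show ?thesis by (rule power2_le_imp_le) (rule less_imp_le[OF \<delta>])
  qed
  have "e \<in> finite_projection_ideal"
  proof (rule in_ideal_if_approx)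
    fix \<epsilon> :: real assume eps: "\<epsilon> > 0"
    define T where "T = norm h + \<delta>\<^sup>2"
    have T: "T > 0" "\<delta>\<^sup>2 \<le> T" "norm h \<le> T" using \<delta> by (auto simp: T_def add_nonneg_pos)
    define n where "n = e - (1/T) *\<^sub>R (h * e)"
    define s where "s = 1 - \<delta>\<^sup>2 / T"
    have s: "0 \<le> s" "s < 1" using T \<delta> by (auto simp: s_def field_simps)
    have "pos ((T *\<^sub>R 1 - h) * e)"
      by (rule pos_mult_projection[OF pos_diff_if_norm_le[OF pos_star[OF ph] T(3)] e(1)])
        (simp add: left_diff_distrib right_diff_distrib he)
    then have "pos ((1/T) *\<^sub>R ((T *\<^sub>R 1 - h) * e))" using T by (intro pos_scaleR) auto
    moreover have "(1/T) *\<^sub>R ((T *\<^sub>R 1 - h) * e) = n" using T by (simp add: n_def algebra_simps)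
    ultimately have pn: "pos n" by simp
    have "pos (s *\<^sub>R (1 - e) + (1/T) *\<^sub>R (h * e - \<delta>\<^sup>2 *\<^sub>R e))"
      using T s by (intro pos_add pos_scaleR e(3) pos_projection E) auto
    moreover have "s *\<^sub>R (1 - e) + (1/T) *\<^sub>R (h * e - \<delta>\<^sup>2 *\<^sub>R e) = s *\<^sub>R 1 - n"
      by (simp add: s_def n_def algebra_simps)
    ultimately have ns: "norm n \<le> s" using norm_le_if_pos[OF pn _ s(1)] by simp
    \<comment> \<open>The powers of \<open>n\<close> in the corner with unit \<open>e\<close>; hence
      the start at \<open>e\<close>. On \<open>e\<close> the element \<open>h\<close> lies between
      \<open>\<delta>\<^sup>2\<close> and \<open>T\<close>, so these powers tend to 0.\<close>
    define m where "m = rec_nat e (\<lambda>_ x. x * n)"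
    have m0: "m 0 = e" and mS: "m (Suc j) = m j * n" for j by (simp_all add: m_def)
    have ee: "e * e = e" by (rule projection_idem[OF e(1)])
    have ne: "n * e = n" by (simp add: n_def left_diff_distrib mult.assoc ee)
    have me: "m j * e = m j" for j by (cases j) (simp_all add: m0 mS ee mult.assoc ne)
    have "norm (m j) \<le> s ^ j" for j
    proof (induction j)
      case 0 then show ?case using norm_projection_le[OF e(1)] by (simp add: m0)
    next
      case (Suc j)
      have "norm (m j * n) \<le> s ^ j * s"
        using norm_mult_ineq[of "m j" n] mult_mono[OF Suc ns] s by force
      then show ?case by (simp add: mS mult.commute)
    qed
    moreover have "e - m j \<in> finite_projection_ideal" for j
    proof (induction j)
      case (Suc j)
      have "e - m (Suc j) = (e - m j) + (1/T) *\<^sub>R (m j * h * e)"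
        by (simp add: mS n_def right_diff_distrib me mult.assoc)
      then show ?case
        by (simp only: ideal_add[OF Suc ideal_scaleR[OF ideal_mult_right[OF ideal_mult_left[OF C_ideal[OF hC]]]]])
    qed (simp add: m0 ideal_0)
    moreover obtain j where "s ^ j < \<epsilon>" using real_arch_pow_inv[OF eps s(2)] by blast
    ultimately show "\<exists>y\<in>finite_projection_ideal. norm (y - e) < \<epsilon>"
      by (intro bexI[of _ "e - m j"]) (auto intro: le_less_trans)
  qed
  moreover have "e \<in> commutant C" unfolding commutant_def using e(2) C_commute[OF hC] by auto
  ultimately have "e \<in> masa_projections" using in_masa e(1) by (auto simp: masa_projections_def)
  then show ?thesis using that small by blast
qed

text \<open>Ranging over all central \<open>z\<close> makes optimality pointwise over the centre, as
  \<open>norm_le_if_central_cuts_le\<close> requires.\<close>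

definition near_optimal :: "'a \<Rightarrow> real \<Rightarrow> 'a \<Rightarrow> bool" where
  "near_optimal f \<delta> p \<longleftrightarrow> (\<forall>z q. central_projection z \<and> q \<in> masa_projections \<longrightarrow>
     (norm (z * ((1 - p) * f)))\<^sup>2 \<le> (norm (z * ((1 - q) * f)))\<^sup>2 + \<delta>)"

text \<open>On a suitable central piece the infimum of the distances is nearly attained, and then it is
  nearly attained on all smaller pieces by the same projection.\<close>

lemma near_optimal_exists:
  assumes \<delta>: "\<delta> > 0"
  obtains p where "p \<in> masa_projections" "near_optimal f \<delta> p"
proof -
  define Q where "Q z p \<longleftrightarrow> p \<in> masa_projections \<and> (\<forall>w q. central_projection w \<and> z * w = w \<and> q \<in> masa_projections \<longrightarrow>
     (norm (w * ((1 - p) * f)))\<^sup>2 \<le> (norm (w * ((1 - q) * f)))\<^sup>2 + \<delta>)" for z p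
  have ex: "\<exists>w. central_projection w \<and> w \<noteq> 0 \<and> z * w = w \<and> (\<exists>p. Q w p)"
    if z: "central_projection z" "z \<noteq> 0" for z
  proof -
    \<comment> \<open>Take \<open>w\<close> and \<open>p\<close> with value within \<delta> of the
      infimum. On smaller pieces the value of \<open>p\<close> can only drop, while the infimum
      still bounds every competitor from below.\<close>
    define V where "V = {(norm (w * ((1 - q) * f)))\<^sup>2 | w q.
      central_projection w \<and> w \<noteq> 0 \<and> z * w = w \<and> q \<in> masa_projections}"
    have bdd: "bdd_below V" by (rule bdd_belowI[of _ 0]) (auto simp: V_def)
    have ne: "V \<noteq> {}" using z central_idem[OF z(1)] masa_projection_0 by (auto simp: V_def)
    obtain v where v: "v \<in> V" "v < Inf V + \<delta>" using cInf_lessD[OF ne, of "Inf V + \<delta>"] \<delta> by auto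
    then obtain w p where w: "central_projection w" "w \<noteq> 0" "z * w = w" "p \<in> masa_projections"
      "v = (norm (w * ((1 - p) * f)))\<^sup>2" by (auto simp: V_def)
    have "Q w p"
      unfolding Q_def
    proof (intro conjI allI impI w(4))
      fix w' q assume w': "central_projection w' \<and> w * w' = w' \<and> q \<in> masa_projections"
      show "(norm (w' * ((1 - p) * f)))\<^sup>2 \<le> (norm (w' * ((1 - q) * f)))\<^sup>2 + \<delta>"
      proof (cases "w' = 0")
        case True
        then show ?thesis using \<delta> by simp
      next
        case False
        have "z * w' = w'" using w' w(3) by (metis mult.assoc)
        then have "Inf V \<le> (norm (w' * ((1 - q) * f)))\<^sup>2"
          using w' False by (intro cInf_lower[OF _ bdd]) (auto simp: V_def)
        moreover have "w' * ((1 - p) * f) = w' * (w * ((1 - p) * f))"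
          using w' central_commute[OF w(1), of w'] by (simp add: mult.assoc[symmetric])
        then have "(norm (w' * ((1 - p) * f)))\<^sup>2 \<le> v"
          unfolding w(5) using norm_projection_mult_le(1)[OF central_is_projection, of w'] w'
          by (simp add: power_mono)
        ultimately show ?thesis using v(2) by linarith
      qed
    qed
    then show ?thesis using w by blast
  qed
  obtain Z where Z: "central_partition Z" "\<And>z. z \<in> Z \<Longrightarrow> \<exists>p. Q z p"
    by (rule exhaustion[of "\<lambda>z. \<exists>p. Q z p", OF ex], assumption+, rule that)
  note cZ = central_partition_central[OF Z(1)]
  obtain p where p: "\<And>z. z \<in> Z \<Longrightarrow> Q z (p z)" using Z(2) by metis
  obtain P where P: "P \<in> masa_projections" "\<And>z. z \<in> Z \<Longrightarrow> z * P = z * p z"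
    using masa_projection_glue[OF Z(1), of p] p unfolding Q_def by blast
  have "near_optimal f \<delta> P"
    unfolding near_optimal_def
  proof (intro allI impI)
    fix z q :: 'a assume z: "central_projection z \<and> q \<in> masa_projections"
    define R where "R = (norm (z * ((1 - q) * f)))\<^sup>2 + \<delta>"
    have "norm (z * ((1 - P) * f)) \<le> sqrt R"
    proof (rule norm_le_if_central_partition[OF Z(1)])
      fix w assume w: "w \<in> Z"
      define u where "u = w * z"
      have cu: "central_projection u" unfolding u_def using central_projection_mult cZ[OF w] z by blast
      have wu: "w * u = u" by (simp add: u_def central_idem_left[OF cZ[OF w]])
      have "u * P = u * p w"
        using P(2)[OF w] central_commute[OF cZ[OF w], of z] unfolding u_def
        by (metis central_commute[OF cZ[OF w]] mult.assoc)
      then have "w * (z * ((1 - P) * f)) = u * ((1 - p w) * f)"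
        by (simp add: u_def mult.assoc[symmetric] right_diff_distrib)
      then have "(norm (w * (z * ((1 - P) * f))))\<^sup>2 = (norm (u * ((1 - p w) * f)))\<^sup>2" by simp
      also have "\<dots> \<le> (norm (u * ((1 - q) * f)))\<^sup>2 + \<delta>"
        using p[OF w] cu wu z unfolding Q_def by blast
      also have "\<dots> \<le> R"
        unfolding R_def u_def mult.assoc[of w]
        using norm_projection_mult_le(1)[OF central_is_projection[OF cZ[OF w]]] by (simp add: power_mono)
      finally show "norm (w * (z * ((1 - P) * f))) \<le> sqrt R" by (rule real_le_rsqrt)
    qed (use \<delta> in \<open>simp add: R_def\<close>)
    then have "(norm (z * ((1 - P) * f)))\<^sup>2 \<le> (sqrt R)\<^sup>2" by (rule power_mono) simp
    then show "(norm (z * ((1 - P) * f)))\<^sup>2 \<le> (norm (z * ((1 - q) * f)))\<^sup>2 + \<delta>"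
      using \<delta> by (simp add: R_def)
  qed
  then show ?thesis using that P(1) by blast
qed

text \<open>If the support \<open>E\<close> of \<open>C\<close> were not \<open>1\<close>, there
  would be a nonzero abelian \<open>h\<close> below \<open>1 - E\<close>. It lies in the ideal and
  its products with \<open>C\<close> vanish on both sides, so it commutes with \<open>C\<close> and
  belongs to \<open>C\<close> by maximality. Then \<open>h = h * h = 0\<close>.\<close>

lemma annihilator_of_masa:
  assumes w: "\<And>c. c \<in> C \<Longrightarrow> c * w = 0"
  shows "w = 0"
proof (rule support_projection[of C])
  fix E assume E: "is_projection E" "\<And>s. s \<in> C \<Longrightarrow> s * E = s" "\<And>x. (\<And>s. s \<in> C \<Longrightarrow> s * x = 0) \<Longrightarrow> E * x = 0"
  show "w = 0"
  proof (rule ccontr)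
    assume "w \<noteq> 0"
    moreover have "E * w = 0" using E(3) w by blast
    ultimately have "1 - E \<noteq> 0" by auto
    then obtain h where h: "abelian_projection h" "h \<noteq> 0" "(1 - E) * h = h"
      using abelian_below_discrete[OF discrete is_projection_compl[OF E(1)]] by blast
    note ph = abelian_is_projection[OF h(1)]
    have ch: "c * h = 0" if "c \<in> C" for c
    proof -
      have "c * (1 - E) = 0" using E(2)[OF that] by (simp add: right_diff_distrib)
      then show ?thesis by (metis h(3) mult.assoc mult_zero_left)
    qed
    moreover have "h * c = 0" if "c \<in> C" for c
      using arg_cong[OF ch[OF C_star[OF that]], of star] by (simp add: star_simps projection_star[OF ph])
    ultimately have "h \<in> C" by (intro in_masa finite_in_ideal abelian_imp_finite h(1)) (auto simp: commutant_def)
    then show False using ch[of h] projection_idem[OF ph] h(2) by simp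
  qed
qed

text \<open>Only one side is recorded; the other is obtained from the adjoint of
  \<open>a\<close>.\<close>

definition approximable :: "'a \<Rightarrow> bool" where
  "approximable a \<longleftrightarrow> (\<forall>\<epsilon>>0. \<exists>p\<in>masa_projections. norm ((1 - p) * a) \<le> \<epsilon>)"

text \<open>The near optimal \<open>p\<^sub>n f\<close> converge to the point of the closure of \<open>C f\<close> nearest to \<open>f\<close>. The
  difference is orthogonal to \<open>C f\<close>, hence annihilated by \<open>C\<close>.\<close>

lemma approximable_abelian:
  assumes f: "abelian_projection f"
  shows "approximable f"
proof -
  note pf = abelian_is_projection[OF f]
  define \<delta> where "\<delta> n = inverse (real (Suc n))" for n
  have \<delta>: "\<delta> n > 0" for n by (simp add: \<delta>_def)
  \<comment> \<open>Joining each new projection with its predecessor makes the sequence increasing.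
    Near optimality survives, since a larger projection only shortens
    \<open>(1 - p) * f\<close>.\<close>
  have "\<exists>P. \<forall>n. (P n \<in> masa_projections \<and> near_optimal f (\<delta> n) (P n)) \<and> (1 - P (Suc n)) * (1 - P n) = 1 - P (Suc n)"
  proof (rule dependent_nat_choice)
    show "\<exists>p. p \<in> masa_projections \<and> near_optimal f (\<delta> 0) p" using near_optimal_exists[OF \<delta>] by metis
    fix p n assume p: "p \<in> masa_projections \<and> near_optimal f (\<delta> n) p"
    obtain q where q: "q \<in> masa_projections" "near_optimal f (\<delta> (Suc n)) q" using near_optimal_exists[OF \<delta>] by metis
    obtain j where j: "j \<in> masa_projections" "1 - j = (1 - p) * (1 - q)" "1 - j = (1 - q) * (1 - p)"
      using masa_projection_join[OF q(1) conjunct1[OF p]] by metis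
    have P: "is_projection (1 - p)" using p masa_projection is_projection_compl by blast
    have "norm (z * ((1 - j) * f)) \<le> norm (z * ((1 - q) * f))" if z: "central_projection z" for z
      unfolding j(2) mult.assoc central_left_commute[OF z, of "1 - p", symmetric]
      by (rule norm_projection_mult_le(1)[OF P])
    then have "near_optimal f (\<delta> (Suc n)) j"
      using q(2) unfolding near_optimal_def by (meson norm_ge_zero order.trans power_mono)
    moreover have "(1 - j) * (1 - p) = 1 - j" unfolding j(3) by (simp only: mult.assoc projection_idem[OF P])
    ultimately show "\<exists>j. (j \<in> masa_projections \<and> near_optimal f (\<delta> (Suc n)) j) \<and> (1 - j) * (1 - p) = 1 - j"
      using j(1) by blast
  qed
  then obtain P where P: "\<And>n. P n \<in> masa_projections" "\<And>n. near_optimal f (\<delta> n) (P n)"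
    "\<And>n. (1 - P (Suc n)) * (1 - P n) = 1 - P (Suc n)" by blast
  have dec: "(1 - P (m + k)) * (1 - P m) = 1 - P (m + k)" for m k
  proof (induction k)
    case 0
    show ?case using projection_idem[OF is_projection_compl[OF masa_projection[OF P(1)]]] by simp
  next
    case (Suc k)
    then show ?case using P(3)[of "m + k"] by (metis add_Suc_right mult.assoc)
  qed
  define y where "y n = (1 - P n) * f" for n
  have yf: "y n * f = y n" for n by (simp add: y_def mult.assoc projection_idem[OF pf])
  \<comment> \<open>The difference is \<open>P (m + k) * y m\<close>, and near optimality of
    \<open>P m\<close> is tested against the competitor \<open>P (m + k)\<close>.\<close>
  have close: "(norm (y m - y (m + k)))\<^sup>2 \<le> \<delta> m" for m k
  proof -
    have "(norm (P (m + k) * y m))\<^sup>2 \<le> \<delta> m"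
    proof (rule norm_le_if_central_cuts_le[OF f yf masa_projection[OF P(1)]])
      fix z :: 'a assume z: "central_projection z"
      have "(1 - P (m + k)) * y m = (1 - P (m + k)) * f" by (simp add: y_def mult.assoc[symmetric] dec)
      then show "(norm (z * y m))\<^sup>2 \<le> (norm (z * ((1 - P (m + k)) * y m)))\<^sup>2 + \<delta> m"
        using P(2)[of m] z P(1)[of "m + k"] unfolding near_optimal_def y_def by metis
    qed
    moreover have "P (m + k) * y m = y m - (1 - P (m + k)) * (1 - P m) * f"
      by (simp add: y_def algebra_simps)
    then have "P (m + k) * y m = y m - y (m + k)" by (simp add: dec) (simp add: y_def)
    ultimately show ?thesis by simp
  qed
  have \<delta>0: "\<delta> \<longlonglongrightarrow> 0" unfolding \<delta>_def by (rule LIMSEQ_inverse_real_of_nat)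
  have "Cauchy y"
  proof (rule metric_CauchyI)
    fix e :: real assume e: "e > 0"
    then have "(e / 2)\<^sup>2 > 0" by simp
    then obtain M where M: "\<delta> M < (e / 2)\<^sup>2"
      using order_tendstoD(2)[OF \<delta>0] by (metis eventually_sequentially order_refl)
    have *: "dist (y M) (y n) < e / 2" if "n \<ge> M" for n
    proof -
      have "(norm (y M - y n))\<^sup>2 < (e / 2)\<^sup>2" using close[of M "n - M"] M that by simp
      then show ?thesis unfolding dist_norm by (rule power_less_imp_less_base) (use e in simp)
    qed
    show "\<exists>M. \<forall>m\<ge>M. \<forall>n\<ge>M. dist (y m) (y n) < e"
      using * dist_triangle_half_r by blast
  qed
  then obtain w where w: "y \<longlonglongrightarrow> w" by (meson Cauchy_convergent convergent_def)
  have wf: "w * f = w"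
  proof -
    have "(\<lambda>n. y n * f) \<longlonglongrightarrow> w * f" by (intro tendsto_intros w)
    then show ?thesis using w LIMSEQ_unique unfolding yf by blast
  qed
  \<comment> \<open>The join of \<open>P n\<close> with \<open>q\<close> competes with
    \<open>P n\<close>. In the limit, cutting by \<open>1 - q\<close> does not shorten
    \<open>w\<close> on any central piece, so \<open>q * w\<close> vanishes.\<close>
  have qw: "q * w = 0" if q: "q \<in> masa_projections" for q
  proof -
    have "(norm (q * w))\<^sup>2 \<le> 0"
    proof (rule norm_le_if_central_cuts_le[OF f wf masa_projection[OF q]])
      fix z :: 'a assume z: "central_projection z"
      have "(norm (z * y n))\<^sup>2 \<le> (norm (z * ((1 - q) * y n)))\<^sup>2 + \<delta> n" for n
      proof -
        obtain j where j: "j \<in> masa_projections" "1 - j = (1 - q) * (1 - P n)"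
          using masa_projection_join[OF P(1)[of n] q] by metis
        then have "(1 - q) * y n = (1 - j) * f" by (simp add: y_def mult.assoc)
        then show ?thesis using P(2)[of n] z j(1) unfolding near_optimal_def y_def by metis
      qed
      moreover have "(\<lambda>n. (norm (z * y n))\<^sup>2) \<longlonglongrightarrow> (norm (z * w))\<^sup>2" by (intro tendsto_intros w)
      moreover have "(\<lambda>n. (norm (z * ((1 - q) * y n)))\<^sup>2 + \<delta> n) \<longlonglongrightarrow> (norm (z * ((1 - q) * w)))\<^sup>2 + 0"
        by (intro tendsto_intros w \<delta>0)
      ultimately show "(norm (z * w))\<^sup>2 \<le> (norm (z * ((1 - q) * w)))\<^sup>2 + 0"
        by (intro LIMSEQ_le) auto
    qed
    then show ?thesis by simp
  qed
  \<comment> \<open>From projections to all of \<open>C\<close>: some projection \<open>q\<close> of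
    \<open>C\<close> makes \<open>c * (1 - q)\<close> small.\<close>
  have "c * w = 0" if c: "c \<in> C" for c
  proof -
    have "norm (c * w) \<le> e" if e: "e > 0" for e
    proof -
      have pos: "e / (norm w + 1) > 0" using e by (simp add: add_nonneg_pos)
      obtain q where q: "q \<in> masa_projections" "norm (c * (1 - q)) \<le> e / (norm w + 1)"
        by (rule masa_spectral_projection[OF c pos])
      have "c * w = c * (1 - q) * w" using qw[OF q(1)] by (simp add: left_diff_distrib right_diff_distrib mult.assoc)
      then have "norm (c * w) \<le> norm (c * (1 - q)) * norm w" by (metis norm_mult_ineq)
      also have "\<dots> \<le> e / (norm w + 1) * (norm w + 1)" using q(2) pos by (intro mult_mono) auto
      also have "\<dots> = e" by (smt (verit) norm_ge_zero nonzero_eq_divide_eq)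
      finally show ?thesis .
    qed
    then show ?thesis by (metis field_le_epsilon add_0 norm_le_zero_iff)
  qed
  then have "w = 0" by (rule annihilator_of_masa)
  then have y0: "y \<longlonglongrightarrow> 0" using w by simp
  show ?thesis
    unfolding approximable_def
  proof (intro allI impI)
    fix \<epsilon> :: real assume "\<epsilon> > 0"
    then obtain n where "norm (y n) < \<epsilon>" using LIMSEQ_D[OF y0] by force
    then show "\<exists>p\<in>masa_projections. norm ((1 - p) * f) \<le> \<epsilon>"
      using P(1)[of n] unfolding y_def by (meson less_imp_le)
  qed
qed

section \<open>From abelian projections to the whole ideal\<close>

lemma approximable_0: "approximable 0"
  unfolding approximable_def using masa_projection_0 by auto

lemma simultaneously_approximable:
  assumes "finite F" "\<And>a. a \<in> F \<Longrightarrow> approximable a" "\<epsilon> > 0"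
  obtains p where "p \<in> masa_projections" "\<And>a. a \<in> F \<Longrightarrow> norm ((1 - p) * a) \<le> \<epsilon>"
proof -
  have "\<exists>p\<in>masa_projections. \<forall>a\<in>F. norm ((1 - p) * a) \<le> \<epsilon>"
    using assms
  proof (induction F rule: finite_induct)
    case empty
    show ?case using masa_projection_0 by auto
  next
    case (insert b F)
    then obtain p where p: "p \<in> masa_projections" "\<forall>a\<in>F. norm ((1 - p) * a) \<le> \<epsilon>" by auto
    obtain q where q: "q \<in> masa_projections" "norm ((1 - q) * b) \<le> \<epsilon>"
      using insert.prems unfolding approximable_def by blast
    obtain j where j: "j \<in> masa_projections" "1 - j = (1 - q) * (1 - p)" "1 - j = (1 - p) * (1 - q)"
      by (rule masa_projection_join[OF p(1) q(1)])
    have "norm ((1 - j) * a) \<le> norm ((1 - p) * a)" "norm ((1 - j) * a) \<le> norm ((1 - q) * a)" for a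
      using norm_projection_mult_le(1)[OF is_projection_compl[OF masa_projection[OF q(1)]], of "(1 - p) * a"]
        norm_projection_mult_le(1)[OF is_projection_compl[OF masa_projection[OF p(1)]], of "(1 - q) * a"]
      by (simp_all only: mult.assoc[symmetric] j(2)[symmetric] j(3)[symmetric])
    then show ?case using j(1) p(2) q(2) by (intro bexI[of _ j]) (auto intro: order.trans)
  qed
  then show ?thesis using that by blast
qed

lemma approximable_add:
  assumes "approximable a" "approximable b"
  shows "approximable (a + b)"
  unfolding approximable_def
proof (intro allI impI)
  fix \<epsilon> :: real assume "\<epsilon> > 0"
  then have "\<epsilon> / 2 > 0" by simp
  then obtain p where p: "p \<in> masa_projections" "\<And>x. x \<in> {a, b} \<Longrightarrow> norm ((1 - p) * x) \<le> \<epsilon> / 2"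
    using simultaneously_approximable[of "{a, b}"] assms by (metis finite.emptyI finite_insert insertE singletonD)
  have "norm ((1 - p) * (a + b)) \<le> \<epsilon>"
    using norm_triangle_ineq[of "(1 - p) * a" "(1 - p) * b"] p(2)[of a] p(2)[of b] by (simp add: distrib_left)
  then show "\<exists>p\<in>masa_projections. norm ((1 - p) * (a + b)) \<le> \<epsilon>" using p(1) by blast
qed

lemma approximable_scaleC:
  assumes "approximable a"
  shows "approximable (c *\<^sub>C a)"
  unfolding approximable_def
proof (intro allI impI)
  fix \<epsilon> :: real assume "\<epsilon> > 0"
  then have "\<epsilon> / (cmod c + 1) > 0" by (simp add: add_nonneg_pos)
  then obtain p where p: "p \<in> masa_projections" "norm ((1 - p) * a) \<le> \<epsilon> / (cmod c + 1)"
    using assms unfolding approximable_def by blast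
  have "norm ((1 - p) * (c *\<^sub>C a)) \<le> (cmod c + 1) * norm ((1 - p) * a)"
    by (simp add: mult_scaleC_right norm_scaleC mult_right_mono)
  also have "\<dots> \<le> (cmod c + 1) * (\<epsilon> / (cmod c + 1))" using p(2) by (intro mult_left_mono) auto
  also have "\<dots> = \<epsilon>" by (smt (verit) norm_ge_zero nonzero_mult_div_cancel_left times_divide_eq_right)
  finally show "\<exists>p\<in>masa_projections. norm ((1 - p) * (c *\<^sub>C a)) \<le> \<epsilon>" using p(1) by blast
qed

text \<open>On each piece of a central partition \<open>f\<close> is a finite sum of abelian
  projections. The number of summands may be unbounded over the pieces, but \<epsilon> is fixed
  beforehand, so the local choices glue to one projection with the same bound.\<close>

lemma approximable_finite:
  assumes f: "finite_projection f"
  shows "approximable f"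
  unfolding approximable_def
proof (intro allI impI)
  fix \<epsilon> :: real assume eps: "\<epsilon> > 0"
  define Q where "Q z p \<longleftrightarrow> p \<in> masa_projections \<and> norm (z * ((1 - p) * f)) \<le> \<epsilon>" for z p
  have ex: "\<exists>w. central_projection w \<and> w \<noteq> 0 \<and> z * w = w \<and> (\<exists>p. Q w p)"
    if z: "central_projection z" "z \<noteq> 0" for z
  proof -
    obtain w where w: "central_projection w" "w \<noteq> 0" "z * w = w" "sum_of_abelian (w * f)"
      by (rule finite_locally_sum_of_abelian[OF discrete f z])
    then obtain hs where hs: "\<forall>h\<in>set hs. abelian_projection h" "w * f = sum_list hs"
      unfolding sum_of_abelian_def by blast
    have "approximable (sum_list hs)"
      using hs(1) by (induction hs) (auto intro: approximable_0 approximable_add approximable_abelian)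
    then obtain p where "p \<in> masa_projections" "norm ((1 - p) * (w * f)) \<le> \<epsilon>"
      using eps unfolding approximable_def hs(2) by blast
    then have "Q w p" by (simp add: Q_def central_left_commute[OF w(1), of "1 - p"])
    then show ?thesis using w by blast
  qed
  obtain Z where Z: "central_partition Z" "\<And>z. z \<in> Z \<Longrightarrow> \<exists>p. Q z p"
    by (rule exhaustion[of "\<lambda>z. \<exists>p. Q z p", OF ex], assumption+, rule that)
  obtain p where p: "\<And>z. z \<in> Z \<Longrightarrow> Q z (p z)" using Z(2) by metis
  obtain P where P: "P \<in> masa_projections" "\<And>z. z \<in> Z \<Longrightarrow> z * P = z * p z"
    using masa_projection_glue[OF Z(1), of p] p unfolding Q_def by blast
  have "norm ((1 - P) * f) \<le> \<epsilon>"
  proof (rule norm_le_if_central_partition[OF Z(1)])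
    fix z assume z: "z \<in> Z"
    have "z * ((1 - P) * f) = z * ((1 - p z) * f)"
      by (simp add: mult.assoc[symmetric] right_diff_distrib P(2)[OF z])
    then show "norm (z * ((1 - P) * f)) \<le> \<epsilon>" using p[OF z] by (simp add: Q_def)
  qed (use eps in simp)
  then show "\<exists>p\<in>masa_projections. norm ((1 - p) * f) \<le> \<epsilon>" using P(1) by blast
qed

lemma approximable_ideal:
  assumes "a \<in> finite_projection_ideal"
  shows "approximable a"
  unfolding approximable_def
proof (intro allI impI)
  fix \<epsilon> :: real assume eps: "\<epsilon> > 0"
  have span: "approximable x" if "x \<in> cspan {e. finite_projection e}" for x
    using that
  proof (induction rule: complex_vector.span_induct)
    case base
    show ?case unfolding complex_vector.subspace_def
      using approximable_0 approximable_add approximable_scaleC by auto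
  qed (use approximable_finite in simp)
  have "\<epsilon> / 2 > 0" using eps by simp
  then obtain x where x: "x \<in> cspan {e. finite_projection e}" "dist x a < \<epsilon> / 2"
    using assms unfolding finite_projection_ideal_def closure_approachable by blast
  obtain p where p: "p \<in> masa_projections" "norm ((1 - p) * x) \<le> \<epsilon> / 2"
    using span[OF x(1)] \<open>\<epsilon> / 2 > 0\<close> unfolding approximable_def by blast
  have "norm ((1 - p) * (a - x)) \<le> norm (a - x)"
    by (rule norm_projection_mult_le(1)[OF is_projection_compl[OF masa_projection[OF p(1)]]])
  moreover have "(1 - p) * a = (1 - p) * x + (1 - p) * (a - x)" by (simp add: distrib_left[symmetric])
  then have "norm ((1 - p) * a) \<le> norm ((1 - p) * x) + norm ((1 - p) * (a - x))" by (metis norm_triangle_ineq)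
  ultimately have "norm ((1 - p) * a) \<le> \<epsilon>" using p(2) x(2) by (simp add: dist_norm norm_minus_commute)
  then show "\<exists>p\<in>masa_projections. norm ((1 - p) * a) \<le> \<epsilon>" using p(1) by blast
qed

lemma commutant_approximation:
  assumes x: "x \<in> commutant C" and F: "finite F" "F \<subseteq> finite_projection_ideal" and eps: "\<epsilon> > 0"
  obtains y where "y \<in> C" "\<forall>a\<in>F. norm ((y - x) * a) < \<epsilon> \<and> norm (a * (y - x)) < \<epsilon>"
proof -
  \<comment> \<open>The added 1 covers \<open>x = 0\<close> and makes the final estimates
    strict.\<close>
  define \<delta> where "\<delta> = \<epsilon> / (norm x + 1)"
  have \<delta>: "\<delta> > 0" using eps by (simp add: \<delta>_def add_nonneg_pos)
  have \<delta>x: "norm x * \<delta> < \<epsilon>"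
  proof -
    have "\<delta> * (norm x + 1) = \<epsilon>" unfolding \<delta>_def by (smt (verit) norm_ge_zero nonzero_eq_divide_eq)
    then show ?thesis using \<delta> by (simp add: algebra_simps)
  qed
  \<comment> \<open>The adjoints are included for the seminorms that multiply by \<open>a\<close>
    from the left.\<close>
  have G: "finite (F \<union> star ` F)" "\<And>a. a \<in> F \<union> star ` F \<Longrightarrow> approximable a"
    using F by (auto intro!: approximable_ideal ideal_star)
  obtain p where p: "p \<in> masa_projections" "\<And>a. a \<in> F \<union> star ` F \<Longrightarrow> norm ((1 - p) * a) \<le> \<delta>"
    by (rule simultaneously_approximable[OF G \<delta>], assumption, rule that)
  note pC = masa_projection_in[OF p(1)] and pp = masa_projection[OF p(1)]
  have xp: "x * p = p * x" using x pC by (auto simp: commutant_def)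
  have "x * p \<in> C"
  proof (rule in_masa)
    show "x * p \<in> finite_projection_ideal" by (rule ideal_mult_left[OF C_ideal[OF pC]])
    have "x * p * c = c * (x * p)" if "c \<in> C" for c
      using x C_commute[OF pC that] that by (simp add: commutant_def) (metis mult.assoc)
    then show "x * p \<in> commutant C" by (simp add: commutant_def)
  qed
  moreover have "norm ((x * p - x) * a) < \<epsilon>" if "a \<in> F" for a
  proof -
    have "(x * p - x) * a = - (x * ((1 - p) * a))" by (simp add: algebra_simps)
    then have "norm ((x * p - x) * a) \<le> norm x * norm ((1 - p) * a)" by (simp add: norm_mult_ineq)
    also have "\<dots> \<le> norm x * \<delta>" using p(2)[of a] that by (intro mult_left_mono) auto
    finally show ?thesis using \<delta>x by simp
  qed
  moreover have "norm (a * (x * p - x)) < \<epsilon>" if "a \<in> F" for a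
  proof -
    have "a * (x * p - x) = - (((1 - p) * a\<^sup>\<star>)\<^sup>\<star> * x)"
      by (simp add: star_simps projection_star[OF pp] xp algebra_simps)
    then have "norm (a * (x * p - x)) \<le> norm ((1 - p) * a\<^sup>\<star>) * norm x"
      by (metis norm_minus_cancel norm_mult_ineq norm_star)
    also have "\<dots> \<le> \<delta> * norm x" using p(2)[of "a\<^sup>\<star>"] that by (intro mult_right_mono) auto
    finally show ?thesis using \<delta>x by (simp add: mult.commute)
  qed
  ultimately show ?thesis using that by blast
qed

end

section \<open>The strict topology\<close>

lemma openin_strict_ball:
  assumes a: "a \<in> A" and r: "0 < r"
  shows "openin (strict_topology A) {y. norm ((y - x) * a) < r}"
    and "openin (strict_topology A) {y. norm (a * (y - x)) < r}"
proof -
  have *: "openin (strict_topology A) {y. p (y - x) < r}"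
    if "p \<in> (\<lambda>a x. norm (x * a)) ` A \<union> (\<lambda>a x. norm (a * x)) ` A" for p
    unfolding strict_topology_def seminorm_topology_def
    by (rule topology_generated_by_Basis, intro CollectI exI[of _ p] exI[of _ x] exI[of _ r]) (use that r in simp)
  show "openin (strict_topology A) {y. norm ((y - x) * a) < r}" by (rule *) (use a in blast)
  show "openin (strict_topology A) {y. norm (a * (y - x)) < r}" by (rule *) (use a in blast)
qed

lemma topspace_strict_topology:
  assumes "0 \<in> A"
  shows "topspace (strict_topology A) = UNIV"
proof -
  have "openin (strict_topology A) {y. norm ((y - x) * 0) < 1}" for x :: 'a
    by (rule openin_strict_ball(1)[OF assms]) simp
  then have "x \<in> topspace (strict_topology A)" for x :: 'a
    using openin_subset by fastforce
  then show ?thesis by auto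
qed

text \<open>By induction on the generation of open sets. A subbasic ball may be centred elsewhere,
  at \<open>x0\<close>; the triangle inequality leaves the radius \<open>r - p (x - x0)\<close>
  around \<open>x\<close>.\<close>

lemma strict_neighbourhood:
  fixes A :: "'a::cstar_algebra set"
  assumes "openin (strict_topology A) U" "x \<in> U"
  obtains F \<epsilon> where "finite F" "F \<subseteq> A" "\<epsilon> > 0"
    "\<And>y. \<forall>a\<in>F. norm ((y - x) * a) < \<epsilon> \<and> norm (a * (y - x)) < \<epsilon> \<Longrightarrow> y \<in> U"
proof -
  let ?B = "{{y. p (y - x) < r} | p x r. p \<in> (\<lambda>a x. norm (x * a)) ` A \<union> (\<lambda>a x. norm (a * x)) ` A \<and> 0 < r}"
  let ?N = "\<lambda>U x. \<exists>F \<epsilon>. finite F \<and> F \<subseteq> A \<and> \<epsilon> > 0 \<and>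
    (\<forall>y. (\<forall>a\<in>F. norm ((y - x) * a) < \<epsilon> \<and> norm (a * (y - x)) < \<epsilon>) \<longrightarrow> y \<in> U)"
  have "generate_topology_on ?B U"
    using assms(1) unfolding strict_topology_def seminorm_topology_def openin_topology_generated_by_iff .
  then have "\<forall>x\<in>U. ?N U x"
  proof (induction rule: generate_topology_on.induct)
    case Empty
    then show ?case by simp
  next
    case (Int U V)
    show ?case
    proof
      fix x assume "x \<in> U \<inter> V"
      then obtain F \<epsilon> G \<delta> where
        F: "finite F" "F \<subseteq> A" "\<epsilon> > 0" "\<forall>y. (\<forall>a\<in>F. norm ((y - x) * a) < \<epsilon> \<and> norm (a * (y - x)) < \<epsilon>) \<longrightarrow> y \<in> U" and
        G: "finite G" "G \<subseteq> A" "\<delta> > 0" "\<forall>y. (\<forall>a\<in>G. norm ((y - x) * a) < \<delta> \<and> norm (a * (y - x)) < \<delta>) \<longrightarrow> y \<in> V"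
        using Int.IH by (metis IntE)
      show "?N (U \<inter> V) x"
        by (intro exI[of _ "F \<union> G"] exI[of _ "min \<epsilon> \<delta>"]) (use F G in auto)
    qed
  next
    case (UN K)
    show ?case
    proof
      fix x assume "x \<in> \<Union>K"
      then obtain V where V: "V \<in> K" "x \<in> V" by blast
      then obtain F \<epsilon> where F: "finite F" "F \<subseteq> A" "\<epsilon> > 0"
        "\<forall>y. (\<forall>a\<in>F. norm ((y - x) * a) < \<epsilon> \<and> norm (a * (y - x)) < \<epsilon>) \<longrightarrow> y \<in> V"
        using UN.IH[OF V(1)] by meson
      show "?N (\<Union>K) x" by (intro exI[of _ F] exI[of _ \<epsilon>]) (use F V in auto)
    qed
  next
    case (Basis U)
    show ?case
    proof
      fix x assume x: "x \<in> U"
      obtain p x0 r where U: "U = {y. p (y - x0) < r}"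
        and p: "p \<in> (\<lambda>a x. norm (x * a)) ` A \<union> (\<lambda>a x. norm (a * x)) ` A"
        using Basis by (elim CollectE exE conjE) metis
      obtain a where a: "a \<in> A" and pa: "p = (\<lambda>x. norm (x * a)) \<or> p = (\<lambda>x. norm (a * x))" using p by blast
      have tri: "p (u + v) \<le> p u + p v" for u v
        using pa by (auto simp: distrib_left distrib_right norm_triangle_ineq)
      show "?N U x"
      proof (intro exI[of _ "{a}"] exI[of _ "r - p (x - x0)"] conjI allI impI)
        show "0 < r - p (x - x0)" using x by (simp add: U)
        fix y assume "\<forall>a\<in>{a}. norm ((y - x) * a) < r - p (x - x0) \<and> norm (a * (y - x)) < r - p (x - x0)"
        then have "p (y - x) < r - p (x - x0)" using pa by auto
        then show "y \<in> U" using tri[of "y - x" "x - x0"] by (simp add: U)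
      qed (use a in auto)
    qed
  qed
  then show ?thesis using assms(2) that by metis
qed

theorem theorem1:
  fixes A C :: "'a::aw_star_algebra set"
  assumes "discrete_algebra TYPE('a)"
    and "A = finite_projection_ideal"
    and "masa A C"
  shows "strict_topology A closure_of C = commutant C"
proof -
  interpret discrete_masa C using assms by unfold_locales auto
  have A: "A = finite_projection_ideal" by (rule assms(2))
  have top: "topspace (strict_topology A) = UNIV"
    by (rule topspace_strict_topology) (simp add: A ideal_0)
  show ?thesis
  proof (intro equalityI subsetI)
    fix x assume x: "x \<in> strict_topology A closure_of C"
    have "x * c = c * x" if c: "c \<in> C" for c
    proof -
      have cA: "c \<in> A" using C_ideal[OF c] by (simp add: A)
      have "norm (x * c - c * x) \<le> e" if e: "e > 0" for e
      proof -
        let ?U = "{y. norm ((y - x) * c) < e / 2} \<inter> {y. norm (c * (y - x)) < e / 2}"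
        have "openin (strict_topology A) ?U" using e by (intro openin_Int openin_strict_ball cA) auto
        moreover have "x \<in> ?U" using e by simp
        ultimately obtain y where y: "y \<in> C" "y \<in> ?U" using x unfolding in_closure_of by metis
        \<comment> \<open>Since \<open>y\<close> commutes with \<open>c\<close>, only
          \<open>y - x\<close> contributes to the commutator; each of the two terms is controlled by
          one strict seminorm.\<close>
        have "x * c - c * x = c * (y - x) - (y - x) * c" using C_commute[OF y(1) c] by (simp add: algebra_simps)
        then show ?thesis using norm_triangle_ineq4[of "c * (y - x)" "(y - x) * c"] y(2) by simp
      qed
      then have "norm (x * c - c * x) \<le> 0" by (metis field_le_epsilon add_0)
      then show ?thesis by simp
    qed
    then show "x \<in> commutant C" by (simp add: commutant_def)
  next
    fix x assume x: "x \<in> commutant C"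
    show "x \<in> strict_topology A closure_of C"
      unfolding in_closure_of
    proof (intro conjI allI impI)
      show "x \<in> topspace (strict_topology A)" by (simp add: top)
      fix U assume U: "x \<in> U \<and> openin (strict_topology A) U"
      obtain F \<epsilon> where F: "finite F" "F \<subseteq> A" "\<epsilon> > 0"
        "\<And>y. \<forall>a\<in>F. norm ((y - x) * a) < \<epsilon> \<and> norm (a * (y - x)) < \<epsilon> \<Longrightarrow> y \<in> U"
        by (rule strict_neighbourhood[OF conjunct2[OF U] conjunct1[OF U]]) metis
      obtain y where "y \<in> C" "\<forall>a\<in>F. norm ((y - x) * a) < \<epsilon> \<and> norm (a * (y - x)) < \<epsilon>"
        by (rule commutant_approximation[OF x F(1) F(2)[unfolded A] F(3)])
      then show "\<exists>y. y \<in> C \<and> y \<in> U" using F(4) by blast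
    qed
  qed
qed

end
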